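(* Let $N\geq 1$ and let $f\in C^1(\mathbb{R})$ satisfy $f(0)=0$ and suppose there exists $\delta>0$ such that $f'(s)\leq 0$ for all $|s|<\delta$. Let $u\in C^2(\mathbb{R}^N)$ be a classical solution of $$\Delta u+f(u)=0\quad\text{in }\mathbb{R}^N$$ satisfying $u(x)\to 0$ as $|x|\to\infty$. If $u$ is stable, i.e. $$\int_{\mathbb{R}^N}\left\{|\nabla\varphi|^2-f'(u)\varphi^2\right\}dx\geq 0\quad\text{for all }\varphi\in C_0^\infty(\mathbb{R}^N),$$ then $u\equiv 0$.
   Context: A solution of $\Delta u+f(u)=0$ in $\mathbb{R}^N$ is called stable if the displayed integral inequality holds for every smooth compactly supported test function $\varphi$; otherwise it is called unstable. *)

theory Defs
  imports "HOL-Analysis.Analysis"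
begin

definition pd :: "('a::euclidean_space \<Rightarrow> real) \<Rightarrow> 'a \<Rightarrow> 'a \<Rightarrow> real" where
  "pd u b x = deriv (\<lambda>t. u (x + t *\<^sub>R b)) 0"

fun pds :: "('a::euclidean_space \<Rightarrow> real) \<Rightarrow> 'a list \<Rightarrow> 'a \<Rightarrow> real" where
  "pds u [] = u"
| "pds u (b # bs) = pd (pds u bs) b"

definition Ck :: "nat \<Rightarrow> ('a::euclidean_space \<Rightarrow> real) \<Rightarrow> bool" where
  "Ck k u \<longleftrightarrow> (\<forall>bs. set bs \<subseteq> Basis \<and> length bs \<le> k \<longrightarrow>
      continuous_on UNIV (pds u bs) \<and>
      (length bs < k \<longrightarrow> (\<forall>b\<in>Basis. \<forall>x. (\<lambda>t. pds u bs (x + t *\<^sub>R b)) differentiable (at 0))))"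

definition smooth :: "('a::euclidean_space \<Rightarrow> real) \<Rightarrow> bool" where
  "smooth u \<longleftrightarrow> (\<forall>k. Ck k u)"

definition test_fun :: "('a::euclidean_space \<Rightarrow> real) \<Rightarrow> bool" where
  "test_fun \<phi> \<longleftrightarrow> smooth \<phi> \<and> compact (closure {x. \<phi> x \<noteq> 0})"

definition grad :: "('a::euclidean_space \<Rightarrow> real) \<Rightarrow> 'a \<Rightarrow> 'a" where
  "grad u x = (\<Sum>b\<in>Basis. pd u b x *\<^sub>R b)"

definition laplacian :: "('a::euclidean_space \<Rightarrow> real) \<Rightarrow> 'a \<Rightarrow> real" where
  "laplacian u x = (\<Sum>b\<in>Basis. pd (pd u b) b x)"

definition stable :: "(real \<Rightarrow> real) \<Rightarrow> ('a::euclidean_space \<Rightarrow> real) \<Rightarrow> bool" where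
  "stable f u \<longleftrightarrow> (\<forall>\<phi>. test_fun \<phi> \<longrightarrow>
     (\<integral>x. (norm (grad \<phi> x))\<^sup>2 - deriv f (u x) * (\<phi> x)\<^sup>2 \<partial>lborel) \<ge> 0)"

end

theory Submission
  imports Defs
begin

text \<open>
  Fix a coordinate direction \<open>e\<close> and put \<open>w = \<partial>\<^sub>e u\<close>, \<open>V = f'(u)\<close>, so that \<open>\<Delta>w + V w = 0\<close> weakly.
  Where \<open>\<bar>u\<bar> < \<delta>\<close> we have \<open>f(u) u \<le> 0\<close>, so \<open>\<bar>u\<bar>\<close> is subharmonic near infinity; comparison
  with a power of \<open>1 + \<bar>x\<bar>\<^sup>2\<close> and a Caccioppoli estimate give a bound, uniform in \<open>R\<close>, for the energy
  \<open>\<integral> \<bar>\<nabla>u\<bar>\<^sup>2\<close> over the annulus \<open>R < \<bar>x\<bar> < 2 R\<close>. Let \<open>\<eta>\<^sub>R\<close> be a cutoff at scale \<open>R\<close>. Testing the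
  linearized equation, the stability form at \<open>w\<^sup>+ \<eta>\<^sub>R\<close> equals \<open>\<integral> (w\<^sup>+)\<^sup>2 \<bar>\<nabla>\<eta>\<^sub>R\<bar>\<^sup>2 = O(R\<^sup>-\<^sup>2)\<close>. Hence
  \<open>w\<^sup>+\<close> minimises the nonnegative stability form and is itself a weak solution of the
  linearized equation. By the strong maximum principle either \<open>w\<^sup>+ = 0\<close> or \<open>w\<^sup>+ > 0\<close> everywhere.
  In both cases \<open>u\<close> is monotone along \<open>e\<close>, and as it vanishes at both ends of every line, \<open>u = 0\<close>.
\<close>

section \<open>Partial derivatives and integration by parts\<close>

text \<open>As \<open>u\<close> is only C^2, \<open>w\<close> is only C^1: the linearized equation
  has no pointwise meaning, and the positive part of \<open>w\<close> is merely Lipschitz. Weak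
  derivatives are avoided by working with regularisations \<open>smooth_pos\<close> of the positive
  part and by stating its equation with all derivatives on the test function. The minimisation is a
  first variation. If \<eta>_R = 1 on the support of \<zeta>, the form at w^+ \<eta>_R + t \<zeta>
  is nonnegative and equals O(R^-2) - 2 t J + t^2 D, where J pairs w^+ with \<Delta>\<zeta> + V
  \<zeta> and D is the form at \<zeta>. Letting R tend to infinity, dividing by t and letting t tend
  to 0 gives J <= 0. The O(R^-2) is a count of exponents. The Caccioppoli estimate with weight |grad
  \<eta>_R|^2 costs the Laplacian of that weight, of size R^-4; with u^2 = O(R^(-4m)) on a region of
  volume O(R^N) the result is O(R^(N - 4 - 4m)). So 4m >= N - 2 is what is required, and in
  dimensions one and two boundedness of \<open>u\<close> suffices.\<close>

definition has_pd :: "('a::euclidean_space \<Rightarrow> real) \<Rightarrow> 'a \<Rightarrow> ('a \<Rightarrow> real) \<Rightarrow> bool" where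
  "has_pd g b g' \<longleftrightarrow> (\<forall>x. ((\<lambda>t. g (x + t *\<^sub>R b)) has_real_derivative g' x) (at 0))"

lemma has_pd_imp_pd: "has_pd g b g' \<Longrightarrow> pd g b = g'"
  unfolding has_pd_def pd_def by (auto intro!: DERIV_imp_deriv)

text \<open>\<open>has_pd\<close> speaks of parameter 0 at every base point; moving the base point
  along the line gives every parameter, the form in which the mean value theorem can be
  applied.\<close>

lemma has_pd_line:
  assumes "has_pd g b g'"
  shows "((\<lambda>t. g (x + t *\<^sub>R b)) has_real_derivative g' (x + s *\<^sub>R b)) (at s)"
proof -
  have "((\<lambda>t. g ((x + s *\<^sub>R b) + t *\<^sub>R b)) has_real_derivative g' (x + s *\<^sub>R b)) (at 0)"
    using assms by (auto simp: has_pd_def)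
  then have "((\<lambda>t. g ((x + s *\<^sub>R b) + (t - s) *\<^sub>R b)) has_real_derivative g' (x + s *\<^sub>R b)) (at s)"
    using DERIV_shift[of "\<lambda>t. g ((x + s *\<^sub>R b) + (t - s) *\<^sub>R b)" _ 0 s] by simp
  then show ?thesis by (simp add: algebra_simps)
qed

lemma has_pd_const: "has_pd (\<lambda>x. c) b (\<lambda>x. 0)"
  by (auto simp: has_pd_def)

lemma has_pd_add:
  assumes "has_pd g b g'" "has_pd h b h'"
  shows "has_pd (\<lambda>x. g x + h x) b (\<lambda>x. g' x + h' x)"
  using assms by (auto simp: has_pd_def intro!: derivative_eq_intros)

lemma has_pd_mult:
  assumes "has_pd g b g'" "has_pd h b h'"
  shows "has_pd (\<lambda>x. g x * h x) b (\<lambda>x. g' x * h x + g x * h' x)"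
  using assms by (auto simp: has_pd_def intro!: derivative_eq_intros)

lemma has_pd_cmult:
  assumes "has_pd g b g'"
  shows "has_pd (\<lambda>x. c * g x) b (\<lambda>x. c * g' x)"
  using assms by (auto simp: has_pd_def intro!: derivative_eq_intros)

lemma has_pd_compose:
  assumes "has_pd g b g'" "\<And>x. (F has_real_derivative F' (g x)) (at (g x))"
  shows "has_pd (\<lambda>x. F (g x)) b (\<lambda>x. F' (g x) * g' x)"
  unfolding has_pd_def
proof
  fix x
  show "((\<lambda>t. F (g (x + t *\<^sub>R b))) has_real_derivative F' (g x) * g' x) (at 0)"
    by (rule DERIV_chain2) (use assms in \<open>auto simp: has_pd_def\<close>)
qed

lemma has_pd_inner: "has_pd (\<lambda>x. (x - c) \<bullet> a) b (\<lambda>x. b \<bullet> a)"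
  by (auto simp: has_pd_def inner_simps intro!: derivative_eq_intros)

lemma has_pd_sqdist:
  "has_pd (\<lambda>x. (x - c) \<bullet> (x - c)) b (\<lambda>x. 2 * ((x - c) \<bullet> b))"
  by (auto simp: has_pd_def inner_simps inner_commute algebra_simps intro!: derivative_eq_intros)

lemma has_pd_shift:
  assumes "has_pd g b g'"
  shows "has_pd (\<lambda>x. g (x + c)) b (\<lambda>x. g' (x + c))"
  unfolding has_pd_def
proof
  fix x
  have "((\<lambda>t. g ((x + c) + t *\<^sub>R b)) has_real_derivative g' (x + c)) (at 0)"
    using assms unfolding has_pd_def by blast
  then show "((\<lambda>t. g (x + t *\<^sub>R b + c)) has_real_derivative g' (x + c)) (at 0)"
    by (simp add: algebra_simps)
qed

text \<open>The exterior of the ball is open, so \<open>g\<close> vanishes on a whole parameter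
  interval around 0.\<close>

lemma has_pd_zero_outside:
  assumes "has_pd g b g'" "\<And>x. R < norm x \<Longrightarrow> g x = 0" "R < norm x"
  shows "g' x = 0"
proof -
  have "((\<lambda>t. norm (x + t *\<^sub>R b)) \<longlongrightarrow> norm (x + 0 *\<^sub>R b)) (at 0)"
    by (intro tendsto_intros)
  then have "\<forall>\<^sub>F t in at 0. R < norm (x + t *\<^sub>R b)"
    using assms(3) by (intro order_tendstoD) auto
  then have "\<forall>\<^sub>F t in at 0. 0 = g (x + t *\<^sub>R b)"
    by eventually_elim (use assms(2) in auto)
  then have "\<forall>\<^sub>F t in nhds 0. 0 = g (x + t *\<^sub>R b)"
    using assms(2,3) by (simp add: eventually_nhds_conv_at)
  moreover have "((\<lambda>t. 0) has_real_derivative 0) (at (0::real))" by simp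
  ultimately have "((\<lambda>t. g (x + t *\<^sub>R b)) has_real_derivative 0) (at 0)"
    by (subst (asm) DERIV_cong_ev[OF refl _ refl]) auto
  moreover have "((\<lambda>t. g (x + t *\<^sub>R b)) has_real_derivative g' x) (at 0)"
    using assms(1) by (auto simp: has_pd_def)
  ultimately show ?thesis using DERIV_unique by blast
qed

section \<open>Continuous functions with compact support and their integrals\<close>

definition cc :: "('a::euclidean_space \<Rightarrow> real) \<Rightarrow> bool" where
  "cc g \<longleftrightarrow> continuous_on UNIV g \<and> (\<exists>R. \<forall>x. R < norm x \<longrightarrow> g x = 0)"

lemma cc_continuous: "cc g \<Longrightarrow> continuous_on UNIV g"
  by (simp add: cc_def)

lemma ccI: "continuous_on UNIV g \<Longrightarrow> (\<And>x. R < norm x \<Longrightarrow> g x = 0) \<Longrightarrow> cc g"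
  by (auto simp: cc_def)

lemma cc_mult:
  assumes "continuous_on UNIV h" "cc g"
  shows "cc (\<lambda>x. h x * g x)" "cc (\<lambda>x. g x * h x)"
  using assms by (auto simp: cc_def intro!: continuous_intros)

lemma cc_add:
  assumes "cc g" "cc h"
  shows "cc (\<lambda>x. g x + h x)"
proof -
  obtain R S where "\<forall>x. R < norm x \<longrightarrow> g x = 0" "\<forall>x. S < norm x \<longrightarrow> h x = 0"
    using assms by (auto simp: cc_def)
  then show ?thesis
    using assms by (intro ccI[where R="max R S"]) (auto simp: cc_def intro!: continuous_intros)
qed

lemma cc_cmult: "cc g \<Longrightarrow> cc (\<lambda>x. c * g x)"
  by (auto simp: cc_def intro!: continuous_intros)

lemma cc_zero: "cc (\<lambda>x. 0)"
  by (auto simp: cc_def)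

lemma cc_diff: "cc g \<Longrightarrow> cc h \<Longrightarrow> cc (\<lambda>x. g x - h x)"
  using cc_add[of g "\<lambda>x. (-1) * h x"] cc_cmult[of h "-1"] by simp

lemma cc_sum: "finite A \<Longrightarrow> (\<And>i. i \<in> A \<Longrightarrow> cc (g i)) \<Longrightarrow> cc (\<lambda>x. \<Sum>i\<in>A. g i x)"
  by (induction A rule: finite_induct) (auto intro: cc_zero cc_add)

lemma cc_integrable:
  assumes "cc g"
  shows "integrable lborel g"
proof -
  obtain R where R: "\<And>x. R < norm x \<Longrightarrow> g x = 0" using assms by (auto simp: cc_def)
  have "integrable lborel (\<lambda>x. indicator (cball 0 R) x *\<^sub>R g x)"
    using assms by (intro borel_integrable_compact) (auto simp: cc_def intro: continuous_on_subset)
  moreover have "(\<lambda>x. indicator (cball 0 R) x *\<^sub>R g x) = g"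
    using R by (force simp: indicator_def)
  ultimately show ?thesis by simp
qed

text \<open>Passes to the gauge integral over a box, where the Leibniz rule and continuity in a
  parameter are applied.\<close>

lemma integral_eq_integral_cbox:
  fixes g :: "'a::euclidean_space \<Rightarrow> real"
  assumes "continuous_on UNIV g" "\<And>x. x \<notin> cbox p q \<Longrightarrow> g x = 0"
  shows "(\<integral>x. g x \<partial>lborel) = integral (cbox p q) g"
proof -
  obtain R where R: "cbox p q \<subseteq> cball 0 R"
    using bounded_cbox[of p q] by (auto simp: bounded_iff subset_eq)
  have "g x = 0" if "R < norm x" for x
    using that assms(2)[of x] R by (cases "x \<in> cbox p q") auto
  then have "integrable lborel g"
    using assms(1) by (intro cc_integrable ccI[where R=R])
  then have "(\<integral>x. g x \<partial>lborel) = integral UNIV g" by (simp add: integral_lborel)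
  also have "\<dots> = integral UNIV (\<lambda>x. if x \<in> cbox p q then g x else 0)"
    using assms(2) by (intro arg_cong[where f="integral UNIV"]) auto
  finally show ?thesis by (simp add: integral_restrict_UNIV)
qed

text \<open>Only unit Jacobians occur: \<open>c = 1\<close> serves translations and
  \<open>c = -1\<close> the reflection inside a convolution.\<close>

lemma integral_lborel_isometry:
  fixes g :: "'a::euclidean_space \<Rightarrow> real"
  assumes "\<bar>c\<bar> = 1" "g \<in> borel_measurable borel"
  shows "(\<integral>x. g (a + c *\<^sub>R x) \<partial>lborel) = (\<integral>x. g x \<partial>lborel)"
proof -
  have "c \<noteq> 0" using assms(1) by auto
  then have "(lborel :: 'a measure) = density (distr lborel borel (\<lambda>x. a + c *\<^sub>R x)) (\<lambda>_. 1)"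
    using lborel_affine[of c a] assms(1) by simp
  then have "(lborel :: 'a measure) = distr lborel borel (\<lambda>x. a + c *\<^sub>R x)"
    by (simp add: density_1)
  then have "(\<integral>x. g x \<partial>lborel) = (\<integral>x. g x \<partial>(distr lborel borel (\<lambda>x. a + c *\<^sub>R x)))" by simp
  also have "\<dots> = (\<integral>x. g (a + c *\<^sub>R x) \<partial>lborel)"
    using assms(2) by (intro integral_distr) auto
  finally show ?thesis by simp
qed

lemma integral_lborel_shift:
  fixes g :: "'a::euclidean_space \<Rightarrow> real"
  assumes "continuous_on UNIV g"
  shows "(\<integral>x. g (x + a) \<partial>lborel) = (\<integral>x. g x \<partial>lborel)"
  using integral_lborel_isometry[of 1 g a] assms
  by (simp add: borel_measurable_continuous_onI add.commute)

text \<open>Either factor may carry the compact support: \<open>g\<close> when the integral of a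
  derivative is shown to vanish, \<open>z\<close> for convolutions and for differentiating the weak
  equation.\<close>

lemma leibniz_shift:
  fixes g g' z :: "'a::euclidean_space \<Rightarrow> real"
  assumes g: "has_pd g b g'" and cg: "continuous_on UNIV g" and cg': "continuous_on UNIV g'"
    and cz: "continuous_on UNIV z"
    and R: "(\<forall>x. R < norm x \<longrightarrow> g x = 0) \<or> (\<forall>x. R < norm x \<longrightarrow> z x = 0)"
  shows "((\<lambda>t. \<integral>y. g (y + t *\<^sub>R b) * z y \<partial>lborel) has_real_derivative
          (\<integral>y. g' y * z y \<partial>lborel)) (at 0)"
proof -
  have g'0: "(\<forall>x. R < norm x \<longrightarrow> g' x = 0) \<or> (\<forall>x. R < norm x \<longrightarrow> z x = 0)"
    using R has_pd_zero_outside[OF g] by blast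
  \<comment> \<open>The margin \<open>norm b\<close> lets one box contain the supports for all
    parameters \<open>t\<close> between -1 and 1.\<close>
  obtain p where p: "cball 0 (R + norm b) \<subseteq> cbox (-p) (p::'a)"
    using bounded_subset_cbox_symmetric bounded_cball by meson
  have out: "R < norm y \<and> R < norm (y + t *\<^sub>R b)" if "y \<notin> cbox (-p) p" "t \<in> {-1..1}" for y and t::real
  proof -
    have "R + norm b < norm y" using that(1) p by force
    moreover have "norm y \<le> norm (y + t *\<^sub>R b) + norm (t *\<^sub>R b)"
      by (metis add_diff_cancel_right' norm_triangle_ineq4)
    moreover have "norm (t *\<^sub>R b) \<le> norm b" using that(2) by (auto intro: mult_left_le_one_le)
    moreover have "0 \<le> norm b" by simp
    ultimately show ?thesis by linarith
  qed
  have comp: "continuous_on UNIV (\<lambda>y. h (y + t *\<^sub>R b))" if "continuous_on UNIV h"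
    for h :: "'a \<Rightarrow> real" and t
    by (rule continuous_on_compose2[OF that]) (auto intro!: continuous_intros)
  have eq: "(\<integral>y. h (y + t *\<^sub>R b) * z y \<partial>lborel) = integral (cbox (-p) p) (\<lambda>y. h (y + t *\<^sub>R b) * z y)"
    if "t \<in> {-1..1}" "continuous_on UNIV h"
      "(\<forall>x. R < norm x \<longrightarrow> h x = 0) \<or> (\<forall>x. R < norm x \<longrightarrow> z x = 0)" for t and h :: "'a \<Rightarrow> real"
    using out[OF _ that(1)] that(3)
    by (intro integral_eq_integral_cbox continuous_intros comp that cz) auto
  have "((\<lambda>t. integral (cbox (-p) p) (\<lambda>y. g (y + t *\<^sub>R b) * z y)) has_real_derivative
      integral (cbox (-p) p) (\<lambda>y. g' (y + 0 *\<^sub>R b) * z y)) (at 0 within {-1..1})"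
  proof (rule leibniz_rule_field_derivative)
    fix t :: real and y
    show "((\<lambda>t. g (y + t *\<^sub>R b) * z y) has_real_derivative g' (y + t *\<^sub>R b) * z y) (at t within {-1..1})"
      by (rule has_field_derivative_at_within)
        (use has_pd_line[OF g] in \<open>auto intro!: derivative_eq_intros\<close>)
    show "(\<lambda>y. g (y + t *\<^sub>R b) * z y) integrable_on cbox (-p) p"
      by (intro integrable_continuous continuous_intros continuous_on_subset[OF comp[OF cg]]
          continuous_on_subset[OF cz] subset_UNIV)
  next
    show "continuous_on ({-1..1} \<times> cbox (-p) p) (\<lambda>(t, y). g' (y + t *\<^sub>R b) * z y)"
      unfolding split_beta
      by (intro continuous_intros continuous_on_compose2[OF cg'] continuous_on_compose2[OF cz]) auto
  qed auto
  then have "((\<lambda>t. integral (cbox (-p) p) (\<lambda>y. g (y + t *\<^sub>R b) * z y)) has_real_derivative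
      integral (cbox (-p) p) (\<lambda>y. g' (y + 0 *\<^sub>R b) * z y)) (at 0 within {-1<..<1})"
    by (rule has_field_derivative_subset) auto
  then have "((\<lambda>t. \<integral>y. g (y + t *\<^sub>R b) * z y \<partial>lborel) has_real_derivative
      (\<integral>y. g' (y + 0 *\<^sub>R b) * z y \<partial>lborel)) (at 0 within {-1<..<1})"
    using eq[of _ g, OF _ cg R] eq[of 0 g, OF _ cg R] eq[of 0 g', OF _ cg' g'0]
    by (subst has_field_derivative_cong_eventually[where g="\<lambda>t. integral (cbox (-p) p) (\<lambda>y. g (y + t *\<^sub>R b) * z y)"])
       (auto simp: eventually_at_filter)
  then show ?thesis using at_within_open[of 0 "{-1<..<1::real}"] by simp
qed

text \<open>The integral of a translate does not depend on the translation, and its derivative in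
  the translation parameter is the integral of \<open>g'\<close>.\<close>

lemma integral_pd_zero:
  assumes g: "has_pd g b g'" and "cc g" "continuous_on UNIV g'"
  shows "(\<integral>x. g' x \<partial>lborel) = 0"
proof -
  obtain R where "\<forall>x. R < norm x \<longrightarrow> g x = 0" using assms by (auto simp: cc_def)
  then have "((\<lambda>t. \<integral>y. g (y + t *\<^sub>R b) * 1 \<partial>lborel) has_real_derivative
          (\<integral>y. g' y * 1 \<partial>lborel)) (at 0)"
    using assms by (intro leibniz_shift) (auto simp: cc_def)
  then have "((\<lambda>t. \<integral>y. g y \<partial>lborel) has_real_derivative (\<integral>y. g' y \<partial>lborel)) (at 0)"
    using integral_lborel_shift[of g] assms(2) by (simp add: cc_def)
  then show ?thesis using DERIV_unique DERIV_const by blast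
qed

lemma has_pd_cc:
  assumes "has_pd g b g'" "cc g" "continuous_on UNIV g'"
  shows "cc g'"
  using assms has_pd_zero_outside[OF assms(1)] unfolding cc_def by blast

lemma integration_by_parts_pd:
  assumes "has_pd g b g'" "has_pd h b h'" "continuous_on UNIV g" "continuous_on UNIV g'"
    "cc h" "continuous_on UNIV h'"
  shows "(\<integral>x. g' x * h x \<partial>lborel) = - (\<integral>x. g x * h' x \<partial>lborel)"
proof -
  have h': "cc h'" using has_pd_cc assms by blast
  have "(\<integral>x. g' x * h x + g x * h' x \<partial>lborel) = 0"
    using assms by (intro integral_pd_zero[OF has_pd_mult] cc_mult continuous_intros) (auto simp: cc_def)
  moreover have "(\<integral>x. g' x * h x + g x * h' x \<partial>lborel) = (\<integral>x. g' x * h x \<partial>lborel) + (\<integral>x. g x * h' x \<partial>lborel)"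
    using assms h' by (intro Bochner_Integration.integral_add cc_integrable cc_mult)
  ultimately show ?thesis by simp
qed

section \<open>Mollification\<close>

text \<open>Smoothness quantifies over all iterated derivatives. An invariant set closed under
  partial differentiation does the induction on their order once; it will be the set of convolutions
  with kernels from \<open>bump_algebra\<close>.\<close>

lemma smooth_coinduct:
  assumes "g \<in> P"
    and cont: "\<And>g. g \<in> P \<Longrightarrow> continuous_on UNIV g"
    and step: "\<And>g b. g \<in> P \<Longrightarrow> b \<in> Basis \<Longrightarrow> \<exists>g'\<in>P. has_pd g b g'"
  shows "smooth g"
proof -
  have *: "pds g bs \<in> P" if "set bs \<subseteq> Basis" for bs
    using that
  proof (induction bs)
    case (Cons b bs)
    then obtain g' where "g' \<in> P" "has_pd (pds g bs) b g'" using step[of "pds g bs" b] by auto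
    then show ?case by (simp add: has_pd_imp_pd)
  qed (use assms(1) in auto)
  show ?thesis
    unfolding smooth_def Ck_def
  proof (intro allI impI conjI ballI)
    fix k and bs :: "'a list" and b x :: 'a assume "set bs \<subseteq> Basis \<and> length bs \<le> k"
    then have "pds g bs \<in> P" using * by blast
    then show "continuous_on UNIV (pds g bs)" by (rule cont)
    assume "b \<in> Basis"
    then obtain g' where "has_pd (pds g bs) b g'" using step[OF \<open>pds g bs \<in> P\<close>] by auto
    then show "(\<lambda>t. pds g bs (x + t *\<^sub>R b)) differentiable (at 0)"
      unfolding has_pd_def using real_differentiable_def by blast
  qed
qed

text \<open>The polynomial factor makes the family generated by exp (-1/t) closed under
  differentiation.\<close>

definition flat :: "real poly \<Rightarrow> real \<Rightarrow> real" where
  "flat p t = (if t > 0 then poly p (1 / t) * exp (- (1 / t)) else 0)"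

lemma poly_times_exp_tendsto_0: "((\<lambda>y. poly p y * exp (- y)) \<longlongrightarrow> (0::real)) at_top"
proof -
  have "((\<lambda>y. \<Sum>i\<le>degree p. coeff p i * (y ^ i / exp y)) \<longlongrightarrow> (\<Sum>i\<le>degree p. coeff p i * 0)) at_top"
    by (intro tendsto_intros tendsto_power_div_exp_0)
  then show ?thesis by (simp add: poly_altdef exp_minus divide_inverse sum_distrib_right mult.assoc)
qed

lemma flat_tendsto_0: "(flat p \<longlongrightarrow> 0) (at 0)"
proof -
  have "((\<lambda>t. poly p (inverse t) * exp (- inverse t)) \<longlongrightarrow> 0) (at_right 0)"
    using poly_times_exp_tendsto_0 filterlim_inverse_at_top_right by (rule filterlim_compose)
  then have "(flat p \<longlongrightarrow> 0) (at_right 0)"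
    by (rule Lim_transform_eventually)
      (auto simp: flat_def eventually_at_filter inverse_eq_divide)
  moreover have "(flat p \<longlongrightarrow> 0) (at_left 0)"
    by (rule Lim_transform_eventually[of "\<lambda>_. 0"]) (auto simp: flat_def eventually_at_filter)
  ultimately show ?thesis by (simp add: filterlim_at_split)
qed

text \<open>In the variable y = 1/t, d/dt is -y^2 d/dy, and this sends p(y) exp (-y) to y^2 (p -
  p')(y) exp (-y).\<close>

lemma flat_deriv: "(flat p has_real_derivative flat ([:0,0,1:] * (p - pderiv p)) t) (at t)"
proof -
  consider "t < 0" | "t = 0" | "t > 0" by linarith
  then show ?thesis
  proof cases
    case 1
    then have "\<forall>\<^sub>F x in nhds t. flat p x = 0"
      using eventually_nhds_in_open[of "{..<0}" t] by (auto simp: flat_def elim!: eventually_mono)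
    then show ?thesis
      using 1 by (subst DERIV_cong_ev[OF refl _ refl]) (auto simp: flat_def)
  next
    case 2
    \<comment> \<open>Division by \<open>h\<close> multiplies \<open>p\<close> by its variable, so
      the difference quotient at 0 is again a \<open>flat\<close> function.\<close>
    have "(\<lambda>h. (flat p (0 + h) - flat p 0) / h) = flat ([:0, 1:] * p)"
      by (auto simp: flat_def)
    then show ?thesis using flat_tendsto_0[of "[:0,1:] * p"] 2
      by (simp add: DERIV_def flat_def)
  next
    case 3
    then have "\<forall>\<^sub>F x in nhds t. flat p x = poly p (1 / x) * exp (- (1 / x))"
      using eventually_nhds_in_open[of "{0<..}" t] by (auto simp: flat_def elim!: eventually_mono)
    moreover have "((\<lambda>x. poly p (1 / x) * exp (- (1 / x))) has_real_derivative
        flat ([:0,0,1:] * (p - pderiv p)) t) (at t)"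
      using 3 by (auto intro!: derivative_eq_intros simp: flat_def field_simps power2_eq_square)
    ultimately show ?thesis by (subst DERIV_cong_ev[OF refl _ refl]) auto
  qed
qed

text \<open>An algebra of smooth functions containing the bump \<open>exp (- 1 / (r - \<bar>x\<bar>\<^sup>2))\<close> and closed under
  partial derivatives.\<close>

inductive bump_algebra :: "real \<Rightarrow> ('a::euclidean_space \<Rightarrow> real) \<Rightarrow> bool" for r where
  const: "bump_algebra r (\<lambda>x. c)"
| coord: "bump_algebra r (\<lambda>x. x \<bullet> b)"
| bump: "bump_algebra r (\<lambda>x. flat p (r - x \<bullet> x))"
| add: "bump_algebra r g \<Longrightarrow> bump_algebra r h \<Longrightarrow> bump_algebra r (\<lambda>x. g x + h x)"
| mult: "bump_algebra r g \<Longrightarrow> bump_algebra r h \<Longrightarrow> bump_algebra r (\<lambda>x. g x * h x)"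

lemma bump_algebra_continuous: "bump_algebra r g \<Longrightarrow> continuous_on UNIV g"
proof (induction rule: bump_algebra.induct)
  case (bump p)
  have "continuous_on UNIV (flat p)"
    using flat_deriv DERIV_isCont continuous_at_imp_continuous_on by blast
  then show ?case
    by (rule continuous_on_compose2) (auto intro!: continuous_intros)
qed (auto intro!: continuous_intros)

lemma bump_algebra_pd: "bump_algebra r g \<Longrightarrow> \<exists>g'. bump_algebra r g' \<and> has_pd g b g'"
proof (induction rule: bump_algebra.induct)
  case (const c)
  then show ?case using has_pd_const bump_algebra.const by blast
next
  case (coord a)
  then show ?case using has_pd_inner[of 0 a b] bump_algebra.const by auto
next
  case (bump p)
  let ?q = "[:0,0,1:] * (p - pderiv p)"
  have "has_pd (\<lambda>x. r + (-1) * ((x - 0) \<bullet> (x - 0))) b (\<lambda>x. 0 + (-1) * (2 * ((x - 0) \<bullet> b)))"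
    by (intro has_pd_add has_pd_cmult has_pd_const has_pd_sqdist)
  then have "has_pd (\<lambda>x. r - x \<bullet> x) b (\<lambda>x. -2 * (x \<bullet> b))" by simp
  from has_pd_compose[OF this flat_deriv]
  have "has_pd (\<lambda>x. flat p (r - x \<bullet> x)) b (\<lambda>x. flat ?q (r - x \<bullet> x) * (-2 * (x \<bullet> b)))" .
  moreover have "bump_algebra r (\<lambda>x. flat ?q (r - x \<bullet> x) * (-2 * (x \<bullet> b)))"
    by (intro bump_algebra.intros)
  ultimately show ?case by blast
next
  case (add g h)
  then obtain g' h' where "bump_algebra r g'" "has_pd g b g'" "bump_algebra r h'" "has_pd h b h'"
    by blast
  then show ?case by (intro exI[of _ "\<lambda>x. g' x + h' x"]) (simp add: bump_algebra.add has_pd_add)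
next
  case (mult g h)
  then obtain g' h' where "bump_algebra r g'" "has_pd g b g'" "bump_algebra r h'" "has_pd h b h'"
    by blast
  with mult.hyps show ?case
    by (intro exI[of _ "\<lambda>x. g' x * h x + g x * h' x"])
      (simp add: bump_algebra.add bump_algebra.mult has_pd_mult)
qed

section \<open>Convolution and uniform C^1 approximation by test functions\<close>

definition conv :: "('a::euclidean_space \<Rightarrow> real) \<Rightarrow> ('a \<Rightarrow> real) \<Rightarrow> 'a \<Rightarrow> real" where
  "conv \<phi> k x = (\<integral>y. k (x - y) * \<phi> y \<partial>lborel)"

lemma continuous_on_reflect:
  fixes k :: "'a::euclidean_space \<Rightarrow> real"
  shows "continuous_on UNIV k \<Longrightarrow> continuous_on UNIV (\<lambda>y. k (x - y))"
  by (rule continuous_on_compose2) (auto intro!: continuous_intros)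

lemma has_pd_reflect:
  assumes "has_pd k b k'"
  shows "has_pd (\<lambda>y. k (x - y)) (- b) (\<lambda>y. k' (x - y))"
  unfolding has_pd_def
proof
  fix y
  have "((\<lambda>t. k ((x - y) + t *\<^sub>R b)) has_real_derivative k' (x - y)) (at 0)"
    using assms unfolding has_pd_def by blast
  then show "((\<lambda>t. k (x - (y + t *\<^sub>R - b))) has_real_derivative k' (x - y)) (at 0)"
    by (simp add: algebra_simps)
qed

lemma conv_continuous:
  assumes "cc \<phi>" "continuous_on UNIV k"
  shows "continuous_on UNIV (conv \<phi> k)"
proof -
  obtain R where R: "\<And>x. R < norm x \<Longrightarrow> \<phi> x = 0" using assms by (auto simp: cc_def)
  obtain p where p: "cball 0 R \<subseteq> cbox (-p) (p::'a)"
    using bounded_subset_cbox_symmetric bounded_cball by meson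
  have out: "\<phi> y = 0" if "y \<notin> cbox (-p) p" for y
    using that p R[of y] by force
  have "conv \<phi> k x = integral (cbox (-p) p) (\<lambda>y. k (x - y) * \<phi> y)" for x
    unfolding conv_def using out assms
    by (intro integral_eq_integral_cbox) (auto simp: cc_def intro!: continuous_intros continuous_on_reflect)
  moreover have "continuous_on UNIV (\<lambda>x. integral (cbox (-p) p) (\<lambda>y. k (x - y) * \<phi> y))"
    using assms by (intro integral_continuous_on_param)
      (auto simp: cc_def split_beta intro!: continuous_intros
         continuous_on_compose2[OF assms(2)] continuous_on_compose2[OF cc_continuous[OF assms(1)]])
  ultimately show ?thesis by presburger
qed

text \<open>The derivative falls on the kernel, so continuity of \<open>\<phi>\<close> is enough.
  Moving \<open>x\<close> by \<open>t\<close> in direction \<open>b\<close> amounts to moving the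
  integration variable in direction \<open>- b\<close>, hence the reflected derivative.\<close>

lemma conv_has_pd:
  assumes "cc \<phi>" "continuous_on UNIV k" "continuous_on UNIV k'" "has_pd k b k'"
  shows "has_pd (conv \<phi> k) b (conv \<phi> k')"
  unfolding has_pd_def
proof
  fix x
  obtain R where R: "\<forall>x. R < norm x \<longrightarrow> \<phi> x = 0" using assms by (auto simp: cc_def)
  have "((\<lambda>t. \<integral>y. k (x - (y + t *\<^sub>R (- b))) * \<phi> y \<partial>lborel) has_real_derivative
          (\<integral>y. k' (x - y) * \<phi> y \<partial>lborel)) (at 0)"
    using assms R by (intro leibniz_shift has_pd_reflect continuous_on_reflect) (auto simp: cc_def)
  then show "((\<lambda>t. conv \<phi> k (x + t *\<^sub>R b)) has_real_derivative conv \<phi> k' x) (at 0)"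
    by (simp add: conv_def algebra_simps)
qed

text \<open>Integration by parts returns the derivative from the kernel to \<open>\<phi>\<close>:
  the gradient of a mollified function is the mollified gradient and is therefore uniformly close to
  the original one.\<close>

lemma conv_pd_swap:
  assumes "cc \<phi>" "has_pd \<phi> b \<phi>'" "continuous_on UNIV \<phi>'"
    "continuous_on UNIV k" "continuous_on UNIV k'" "has_pd k b k'"
  shows "conv \<phi> k' x = conv \<phi>' k x"
proof -
  have "has_pd (\<lambda>y. k (x - y)) b (\<lambda>y. - k' (x - y))"
  proof -
    have "((\<lambda>t. k (x - (y + t *\<^sub>R b))) has_real_derivative - k' (x - y)) (at 0)" for y
    proof -
      have "((\<lambda>t. k (x - y + t *\<^sub>R b)) has_real_derivative k' (x - y)) (at (- 0))"
        using assms(6) by (auto simp: has_pd_def)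
      from DERIV_mirror[THEN iffD1, OF this] show ?thesis by (simp add: algebra_simps)
    qed
    then show ?thesis by (simp add: has_pd_def)
  qed
  then have "(\<integral>y. - k' (x - y) * \<phi> y \<partial>lborel) = - (\<integral>y. k (x - y) * \<phi>' y \<partial>lborel)"
    using assms by (intro integration_by_parts_pd continuous_on_reflect continuous_on_minus) auto
  then show ?thesis by (simp add: conv_def)
qed

lemma conv_flip:
  assumes "continuous_on UNIV \<phi>" "continuous_on UNIV k"
  shows "conv \<phi> k x = (\<integral>y. k y * \<phi> (x - y) \<partial>lborel)"
proof -
  have "(\<lambda>y. k (x - y) * \<phi> y) \<in> borel_measurable borel"
    using assms by (intro borel_measurable_continuous_onI continuous_intros continuous_on_reflect)
  from integral_lborel_isometry[OF _ this, of "-1" x] show ?thesis by (simp add: conv_def)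
qed

lemma conv_smooth:
  assumes "cc \<phi>" "bump_algebra r k"
  shows "smooth (conv \<phi> k)"
proof (rule smooth_coinduct[where P="{conv \<phi> k |k. bump_algebra r k}"])
  fix g :: "'a \<Rightarrow> real" and b :: 'a assume "g \<in> {conv \<phi> k |k. bump_algebra r k}"
  then obtain k where k: "bump_algebra r k" "g = conv \<phi> k" by auto
  then show "continuous_on UNIV g" using conv_continuous bump_algebra_continuous assms by blast
  obtain k' where "bump_algebra r k'" "has_pd k b k'" using bump_algebra_pd k(1) by blast
  then show "\<exists>g'\<in>{conv \<phi> k |k. bump_algebra r k}. has_pd g b g'"
    using k conv_has_pd assms(1) bump_algebra_continuous by blast
qed (use assms in auto)

lemma cc_uniform:
  assumes "cc g" "e > 0"
  shows "\<forall>\<^sub>F r in at_right 0. \<forall>x y. norm y \<le> r \<longrightarrow> \<bar>g (x - y) - g x\<bar> \<le> e"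
proof -
  obtain R where R: "\<And>x. R < norm x \<Longrightarrow> g x = 0" using assms by (auto simp: cc_def)
  \<comment> \<open>For shifts shorter than 1, either both points lie in this ball or
    \<open>norm x > R + 1\<close> and both values vanish.\<close>
  have "uniformly_continuous_on (cball 0 (R+2)) g"
    using assms(1) by (intro compact_uniformly_continuous) (auto simp: cc_def intro: continuous_on_subset)
  then obtain d where d: "d > 0" "\<And>x y. x \<in> cball 0 (R+2) \<Longrightarrow> y \<in> cball 0 (R+2) \<Longrightarrow> dist y x < d \<Longrightarrow> dist (g y) (g x) < e"
    using assms(2) unfolding uniformly_continuous_on_def by metis
  have *: "\<bar>g (x - y) - g x\<bar> \<le> e" if "norm y \<le> r" "r < min d 1" for x y r
  proof (cases "R + 1 < norm x")
    case True
    have "norm x \<le> norm (x - y) + norm y" by (metis diff_add_cancel norm_triangle_ineq)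
    then show ?thesis using True R[of x] R[of "x - y"] that assms(2) by auto
  next
    case False
    have "norm (x - y) \<le> norm x + norm y" by (rule norm_triangle_ineq4)
    then show ?thesis
      using False that d(2)[of x "x - y"] by (auto simp: dist_norm norm_minus_commute)
  qed
  have "\<forall>\<^sub>F r in at_right 0. r < min d 1"
    using d(1) eventually_at_right_field[of "\<lambda>r. r < min d 1" 0] by (metis dual_order.strict_trans min_less_iff_conj zero_less_one)
  then show ?thesis by eventually_elim (use * in blast)
qed

text \<open>Stability is given for smooth functions, but those tested later are only C^1. The
  support grows by at most a fixed amount, so that dominated convergence can be applied.\<close>

lemma test_fun_approx:
  fixes \<phi> :: "'a::euclidean_space \<Rightarrow> real"
  assumes \<phi>: "continuous_on UNIV \<phi>" "\<And>x. R < norm x \<Longrightarrow> \<phi> x = 0"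
    and \<phi>': "\<And>b. b \<in> Basis \<Longrightarrow> has_pd \<phi> b (\<phi>' b)" "\<And>b. b \<in> Basis \<Longrightarrow> continuous_on UNIV (\<phi>' b)"
    and e: "e > 0"
  obtains \<psi> where "test_fun \<psi>" "\<And>x. R + 1 < norm x \<Longrightarrow> \<psi> x = 0"
    "\<And>x. \<bar>\<psi> x - \<phi> x\<bar> \<le> e"
    "\<And>b x. b \<in> Basis \<Longrightarrow> \<bar>pd \<psi> b x - \<phi>' b x\<bar> \<le> e"
proof -
  have cc\<phi>: "cc \<phi>" using \<phi> by (rule ccI)
  have cc\<phi>': "cc (\<phi>' b)" if "b \<in> Basis" for b
    using has_pd_cc cc\<phi> \<phi>' that by blast
  have "\<forall>\<^sub>F r in at_right 0. 0 < r \<and> r < (1::real)"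
    by (simp add: eventually_at_right_field) (meson zero_less_one)
  moreover have "\<forall>\<^sub>F r in at_right 0. \<forall>x y. norm y \<le> r \<longrightarrow> \<bar>\<phi> (x - y) - \<phi> x\<bar> \<le> e"
    by (rule cc_uniform[OF cc\<phi> e])
  moreover have "\<forall>\<^sub>F r in at_right 0. \<forall>b\<in>Basis. \<forall>x y. norm y \<le> r \<longrightarrow> \<bar>\<phi>' b (x - y) - \<phi>' b x\<bar> \<le> e"
    using cc_uniform[OF cc\<phi>' e] by (intro eventually_ball_finite) auto
  ultimately have "\<forall>\<^sub>F r in at_right (0::real). 0 < r \<and> r < 1 \<and> (\<forall>x y. norm y \<le> r \<longrightarrow> \<bar>\<phi> (x - y) - \<phi> x\<bar> \<le> e)
      \<and> (\<forall>b\<in>Basis. \<forall>x y. norm y \<le> r \<longrightarrow> \<bar>\<phi>' b (x - y) - \<phi>' b x\<bar> \<le> e)"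
    by eventually_elim auto
  then obtain r where r: "0 < r" "r < 1" "\<And>x y. norm y \<le> r \<Longrightarrow> \<bar>\<phi> (x - y) - \<phi> x\<bar> \<le> e"
    "\<And>b x y. b \<in> Basis \<Longrightarrow> norm y \<le> r \<Longrightarrow> \<bar>\<phi>' b (x - y) - \<phi>' b x\<bar> \<le> e"
    using eventually_happens'[OF trivial_limit_at_right_real] by blast
  define k :: "'a \<Rightarrow> real" where "k x = flat 1 (r\<^sup>2 - x \<bullet> x)" for x
  have bk: "bump_algebra (r\<^sup>2) k" unfolding k_def by (rule bump_algebra.bump)
  have ck: "continuous_on UNIV k" using bump_algebra_continuous[OF bk] .
  have k0: "0 \<le> k x" for x by (simp add: k_def flat_def)
  have kout: "k x = 0" if "r \<le> norm x" for x
    using power_mono[OF that less_imp_le[OF r(1)], of 2] by (simp add: k_def flat_def dot_square_norm)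
  have cck: "cc k" using ck kout by (intro ccI[where R=r]) auto
  define I where "I = (\<integral>x. k x \<partial>lborel)"
  have Ipos: "I > 0"
  proof -
    have "k 0 \<noteq> 0" using r(1) by (simp add: k_def flat_def)
    have "integral\<^sup>N lborel (\<lambda>x. ennreal (k x)) \<noteq> 0"
    proof
      assume "integral\<^sup>N lborel (\<lambda>x. ennreal (k x)) = 0"
      then have "AE x in lborel. ennreal (k x) = 0"
        using cc_integrable[OF cck] by (subst (asm) nn_integral_0_iff_AE) auto
      then have "AE x in lborel. x \<notin> {x. k x \<noteq> 0}"
        using k0 by (auto elim!: eventually_mono simp: ennreal_eq_0_iff intro: antisym)
      moreover have op: "open {x. k x \<noteq> 0}"
        using ck by (intro open_Collect_neq) auto
      ultimately have "emeasure lborel {x. k x \<noteq> 0} = 0"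
        by (subst AE_iff_measurable[symmetric, of _ _ "\<lambda>x. x \<notin> {x. k x \<noteq> 0}"]) auto
      then have "negligible {x. k x \<noteq> 0}"
        using op by (auto simp: negligible_iff_emeasure0)
      then show False using open_not_negligible[OF op] \<open>k 0 \<noteq> 0\<close> by blast
    qed
    then have "integral\<^sup>L lborel k \<noteq> 0"
      using nn_integral_eq_integral[OF cc_integrable[OF cck]] k0 by auto
    moreover have "0 \<le> integral\<^sup>L lborel k" using k0 by (rule Bochner_Integration.integral_nonneg)
    ultimately show ?thesis unfolding I_def by linarith
  qed
  define \<psi> where "\<psi> = conv (\<lambda>x. (1 / I) * \<phi> x) k"
  \<comment> \<open>Used for \<open>\<phi>\<close> and for each partial derivative:
    \<open>k / I\<close> is a probability density living on \<open>norm y \<le> r\<close>, so the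
    average stays within \<open>e\<close> of the value at \<open>x\<close>.\<close>
  have close: "\<bar>conv (\<lambda>x. (1 / I) * g x) k x - g x\<bar> \<le> e"
    if g: "cc g" "\<And>x y. norm y \<le> r \<Longrightarrow> \<bar>g (x - y) - g x\<bar> \<le> e" for g x
  proof -
    have cg: "continuous_on UNIV (\<lambda>y. (1 / I) * g (x - y))"
      using g by (intro continuous_intros continuous_on_reflect) (auto simp: cc_def)
    have "conv (\<lambda>x. (1 / I) * g x) k x - g x =
       (\<integral>y. k y * ((1 / I) * g (x - y)) \<partial>lborel) - (\<integral>y. k y * (g x / I) \<partial>lborel)"
      using conv_flip[of "\<lambda>x. (1 / I) * g x" k x] ck g Ipos
      by (simp add: cc_def continuous_intros I_def)
    also have "\<dots> = (\<integral>y. k y * ((1 / I) * g (x - y)) - k y * (g x / I) \<partial>lborel)"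
      by (intro Bochner_Integration.integral_diff[symmetric] cc_integrable cc_mult(2)[OF _ cck] cg continuous_on_const)
    finally have eq: "conv (\<lambda>x. (1 / I) * g x) k x - g x =
        (\<integral>y. k y * ((1 / I) * g (x - y)) - k y * (g x / I) \<partial>lborel)" .
    have "norm (\<integral>y. k y * ((1 / I) * g (x - y)) - k y * (g x / I) \<partial>lborel) \<le> (\<integral>y. k y * (e / I) \<partial>lborel)"
    proof (rule Bochner_Integration.integral_norm_bound_integral)
      show "integrable lborel (\<lambda>y. k y * (1 / I * g (x - y)) - k y * (g x / I))"
        by (intro cc_integrable cc_diff cc_mult(2)[OF _ cck] cg continuous_on_const)
      show "integrable lborel (\<lambda>y. k y * (e / I))"
        by (intro cc_integrable cc_mult(2)[OF _ cck] continuous_on_const)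
      fix y
      show "norm (k y * (1 / I * g (x - y)) - k y * (g x / I)) \<le> k y * (e / I)"
      proof (cases "r \<le> norm y")
        case False
        have "k y * (1 / I * g (x - y)) - k y * (g x / I) = k y / I * (g (x - y) - g x)"
          by (simp add: algebra_simps diff_divide_distrib)
        then have "norm (k y * (1 / I * g (x - y)) - k y * (g x / I)) = k y / I * \<bar>g (x - y) - g x\<bar>"
          using k0[of y] Ipos by (simp add: abs_mult)
        also have "\<dots> \<le> k y / I * e"
          using g(2)[of y x] False k0[of y] Ipos by (intro mult_left_mono) auto
        finally show ?thesis by simp
      qed (simp add: kout)
    qed
    also have "\<dots> = e" using Ipos by (simp add: I_def)
    finally show ?thesis unfolding eq real_norm_def .
  qed
  have cc1: "cc (\<lambda>x. (1 / I) * \<phi> x)" using cc\<phi> by (rule cc_cmult)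
  have sm: "smooth \<psi>" unfolding \<psi>_def using conv_smooth[OF cc1 bk] .
  have out: "\<psi> x = 0" if "R + 1 < norm x" for x
  proof -
    have "k (x - y) * ((1 / I) * \<phi> y) = 0" for y
    proof (cases "R < norm y")
      case False
      have "norm x \<le> norm (x - y) + norm y" by (metis diff_add_cancel norm_triangle_ineq)
      then show ?thesis using kout[of "x - y"] False that r by auto
    qed (use \<phi> in auto)
    then show ?thesis unfolding \<psi>_def conv_def by (simp only: integral_zero)
  qed
  have pdpsi: "pd \<psi> b = conv (\<lambda>x. (1 / I) * \<phi>' b x) k" if b: "b \<in> Basis" for b
  proof -
    obtain k' where k': "bump_algebra (r\<^sup>2) k'" "has_pd k b k'" using bump_algebra_pd[OF bk] by blast
    note ck' = bump_algebra_continuous[OF k'(1)]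
    have "has_pd \<psi> b (conv (\<lambda>x. (1 / I) * \<phi> x) k')"
      unfolding \<psi>_def by (intro conv_has_pd cc1 ck ck' k')
    moreover have "conv (\<lambda>x. (1 / I) * \<phi> x) k' = conv (\<lambda>x. (1 / I) * \<phi>' b x) k"
      by (intro ext conv_pd_swap[where b=b] cc1 ck ck' k' has_pd_cmult \<phi>' b continuous_intros)
    ultimately show ?thesis using has_pd_imp_pd by metis
  qed
  show ?thesis
  proof (rule that[of \<psi>])
    have "{x. \<psi> x \<noteq> 0} \<subseteq> cball 0 (R + 1)"
    proof
      fix x assume "x \<in> {x. \<psi> x \<noteq> 0}"
      then show "x \<in> cball 0 (R + 1)" using out[of x] by (cases "R + 1 < norm x") auto
    qed
    then have "bounded {x. \<psi> x \<noteq> 0}" by (rule bounded_subset[OF bounded_cball])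
    then show "test_fun \<psi>" using sm by (simp add: test_fun_def)
    show "\<bar>\<psi> x - \<phi> x\<bar> \<le> e" for x unfolding \<psi>_def using close[OF cc\<phi> r(3)] .
    show "\<bar>pd \<psi> b x - \<phi>' b x\<bar> \<le> e" if "b \<in> Basis" for b x
      unfolding pdpsi[OF that] using close[OF cc\<phi>'[OF that] r(4)[OF that]] .
    show "\<psi> x = 0" if "R + 1 < norm x" for x using out[OF that] .
  qed
qed

section \<open>Weak form of the linearized equation\<close>

lemma Ck_2_has_pd:
  assumes "Ck 2 u"
  shows "continuous_on UNIV u"
    and "b \<in> Basis \<Longrightarrow> has_pd u b (pd u b)"
    and "b \<in> Basis \<Longrightarrow> continuous_on UNIV (pd u b)"
    and "b \<in> Basis \<Longrightarrow> c \<in> Basis \<Longrightarrow> has_pd (pd u b) c (pd (pd u b) c)"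
    and "b \<in> Basis \<Longrightarrow> c \<in> Basis \<Longrightarrow> continuous_on UNIV (pd (pd u b) c)"
proof -
  have *: "set bs \<subseteq> Basis \<Longrightarrow> length bs \<le> 2 \<Longrightarrow> continuous_on UNIV (pds u bs)" for bs
    using assms by (simp add: Ck_def)
  have **: "has_pd (pds u bs) c (pd (pds u bs) c)" if "set bs \<subseteq> Basis" "length bs < 2" "c \<in> Basis" for bs c
    unfolding has_pd_def
  proof
    fix x
    have "(\<lambda>t. pds u bs (x + t *\<^sub>R c)) differentiable (at 0)"
      using assms that by (simp add: Ck_def)
    then show "((\<lambda>t. pds u bs (x + t *\<^sub>R c)) has_real_derivative pd (pds u bs) c x) (at 0)"
      by (simp add: pd_def DERIV_deriv_iff_real_differentiable)
  qed
  show "continuous_on UNIV u" using *[of "[]"] by simp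
  show "b \<in> Basis \<Longrightarrow> has_pd u b (pd u b)" using **[of "[]" b] by simp
  show "b \<in> Basis \<Longrightarrow> continuous_on UNIV (pd u b)" using *[of "[b]"] by simp
  show "b \<in> Basis \<Longrightarrow> c \<in> Basis \<Longrightarrow> has_pd (pd u b) c (pd (pd u b) c)"
    using **[of "[b]" c] by simp
  show "b \<in> Basis \<Longrightarrow> c \<in> Basis \<Longrightarrow> continuous_on UNIV (pd (pd u b) c)"
    \<comment> \<open>The head of the list is the derivative taken last.\<close>
    using *[of "[c,b]"] by simp
qed

text \<open>Mean value theorem twice: along \<open>a\<close> for the increment of \<open>g\<close>
  in direction \<open>b\<close>, then along \<open>b\<close> for \<open>ga\<close>.\<close>

lemma second_difference_mvt:
  assumes "has_pd g a ga" "has_pd ga b gab" "h > 0"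
  shows "\<exists>s t. 0 < s \<and> s < h \<and> 0 < t \<and> t < h \<and>
    g (x + h *\<^sub>R a + h *\<^sub>R b) - g (x + h *\<^sub>R a) - g (x + h *\<^sub>R b) + g x = h * (h * gab (x + s *\<^sub>R a + t *\<^sub>R b))"
proof -
  define F where "F t = g ((x + h *\<^sub>R b) + t *\<^sub>R a) - g (x + t *\<^sub>R a)" for t
  have "(F has_real_derivative (ga ((x + h *\<^sub>R b) + t *\<^sub>R a) - ga (x + t *\<^sub>R a))) (at t)" for t
    unfolding F_def by (intro DERIV_diff has_pd_line[OF assms(1)])
  then obtain s where s: "0 < s" "s < h" "F h - F 0 = (h - 0) * (ga ((x + h *\<^sub>R b) + s *\<^sub>R a) - ga (x + s *\<^sub>R a))"
    using MVT2[OF assms(3), of F "\<lambda>t. ga ((x + h *\<^sub>R b) + t *\<^sub>R a) - ga (x + t *\<^sub>R a)"] by blast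
  have "((\<lambda>t. ga ((x + s *\<^sub>R a) + t *\<^sub>R b)) has_real_derivative gab ((x + s *\<^sub>R a) + t *\<^sub>R b)) (at t)" for t
    by (rule has_pd_line[OF assms(2)])
  then obtain t where t: "0 < t" "t < h" "ga ((x + s *\<^sub>R a) + h *\<^sub>R b) - ga ((x + s *\<^sub>R a) + 0 *\<^sub>R b) = (h - 0) * gab ((x + s *\<^sub>R a) + t *\<^sub>R b)"
    using MVT2[OF assms(3), of "\<lambda>t. ga ((x + s *\<^sub>R a) + t *\<^sub>R b)" "\<lambda>t. gab ((x + s *\<^sub>R a) + t *\<^sub>R b)"] by blast
  have "g (x + h *\<^sub>R a + h *\<^sub>R b) - g (x + h *\<^sub>R a) - g (x + h *\<^sub>R b) + g x = F h - F 0"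
    by (simp add: F_def algebra_simps)
  also have "\<dots> = h * (h * gab (x + s *\<^sub>R a + t *\<^sub>R b))"
    using s(3) t(3) by (simp add: algebra_simps)
  finally show ?thesis using s t by blast
qed

text \<open>The second difference is symmetric in \<open>a\<close> and \<open>b\<close>, so the two
  mixed derivatives take equal values at points converging to \<open>x\<close>. Needed because
  differentiating the weak equation produces \<open>pd (pd u b) e\<close> instead of
  \<open>pd (pd u e) b\<close>.\<close>

lemma mixed_pd_commute:
  assumes "has_pd g a ga" "has_pd ga b gab" "has_pd g b gb" "has_pd gb a gba"
    "continuous_on UNIV gab" "continuous_on UNIV gba"
  shows "gab x = gba x"
proof -
  define h :: "nat \<Rightarrow> real" where "h n = 1 / (real n + 1)" for n
  have h0: "h n > 0" for n by (simp add: h_def)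
  have hlim: "h \<longlonglongrightarrow> 0" unfolding h_def using LIMSEQ_inverse_real_of_nat by (simp add: inverse_eq_divide add.commute)
  have "\<exists>s t s' t'. 0 < s \<and> s < h n \<and> 0 < t \<and> t < h n \<and> 0 < s' \<and> s' < h n \<and> 0 < t' \<and> t' < h n \<and>
     gab (x + s *\<^sub>R a + t *\<^sub>R b) = gba (x + s' *\<^sub>R b + t' *\<^sub>R a)" for n
  proof -
    obtain s t where 1: "0 < s" "s < h n" "0 < t" "t < h n"
      "g (x + h n *\<^sub>R a + h n *\<^sub>R b) - g (x + h n *\<^sub>R a) - g (x + h n *\<^sub>R b) + g x = h n * (h n * gab (x + s *\<^sub>R a + t *\<^sub>R b))"
      using second_difference_mvt[OF assms(1,2) h0, of n x] by blast
    obtain s' t' where 2: "0 < s'" "s' < h n" "0 < t'" "t' < h n"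
      "g (x + h n *\<^sub>R b + h n *\<^sub>R a) - g (x + h n *\<^sub>R b) - g (x + h n *\<^sub>R a) + g x = h n * (h n * gba (x + s' *\<^sub>R b + t' *\<^sub>R a))"
      using second_difference_mvt[OF assms(3,4) h0, of n x] by blast
    have "h n * (h n * gab (x + s *\<^sub>R a + t *\<^sub>R b)) = h n * (h n * gba (x + s' *\<^sub>R b + t' *\<^sub>R a))"
      unfolding 1(5)[symmetric] 2(5)[symmetric] by (simp add: algebra_simps)
    then have "gab (x + s *\<^sub>R a + t *\<^sub>R b) = gba (x + s' *\<^sub>R b + t' *\<^sub>R a)"
      using h0[of n] by simp
    with 1 2 show ?thesis by blast
  qed
  then obtain s t s' t' where st: "\<And>n. 0 < s n \<and> s n < h n" "\<And>n. 0 < t n \<and> t n < h n"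
    "\<And>n. 0 < s' n \<and> s' n < h n" "\<And>n. 0 < t' n \<and> t' n < h n"
    "\<And>n. gab (x + s n *\<^sub>R a + t n *\<^sub>R b) = gba (x + s' n *\<^sub>R b + t' n *\<^sub>R a)"
    by metis
  have lim0: "r \<longlonglongrightarrow> 0" if "\<And>n. 0 < r n \<and> r n < h n" for r
    by (rule tendsto_sandwich[OF _ _ tendsto_const hlim]) (use that in \<open>auto simp: less_imp_le\<close>)
  have c: "isCont gab x" "isCont gba x"
    using assms(5,6) by (simp_all add: continuous_on_eq_continuous_at)
  have "(\<lambda>n. x + s n *\<^sub>R a + t n *\<^sub>R b) \<longlonglongrightarrow> x + 0 *\<^sub>R a + 0 *\<^sub>R b"
    by (intro tendsto_intros lim0 st)
  then have 1: "(\<lambda>n. gab (x + s n *\<^sub>R a + t n *\<^sub>R b)) \<longlonglongrightarrow> gab x"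
    using isCont_tendsto_compose[OF c(1)] by simp
  have "(\<lambda>n. x + s' n *\<^sub>R b + t' n *\<^sub>R a) \<longlonglongrightarrow> x + 0 *\<^sub>R b + 0 *\<^sub>R a"
    by (intro tendsto_intros lim0 st)
  then have 2: "(\<lambda>n. gba (x + s' n *\<^sub>R b + t' n *\<^sub>R a)) \<longlonglongrightarrow> gba x"
    using isCont_tendsto_compose[OF c(2)] by simp
  show ?thesis using LIMSEQ_unique[OF 1] 2 unfolding st(5) by blast
qed

text \<open>Divergence theorem for the field with components \<open>v'\<close>; only the derivative
  of each component along its own axis enters.\<close>

lemma green_identity:
  fixes v \<zeta> :: "'a::euclidean_space \<Rightarrow> real"
  assumes v: "\<And>b. b \<in> Basis \<Longrightarrow> has_pd (v' b) b (v'' b)"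
    "\<And>b. b \<in> Basis \<Longrightarrow> continuous_on UNIV (v' b)" "\<And>b. b \<in> Basis \<Longrightarrow> continuous_on UNIV (v'' b)"
    and z: "cc \<zeta>" "\<And>b. b \<in> Basis \<Longrightarrow> has_pd \<zeta> b (\<zeta>' b)" "\<And>b. b \<in> Basis \<Longrightarrow> continuous_on UNIV (\<zeta>' b)"
  shows "(\<integral>x. (\<Sum>b\<in>Basis. v' b x * \<zeta>' b x) \<partial>lborel) = - (\<integral>x. (\<Sum>b\<in>Basis. v'' b x) * \<zeta> x \<partial>lborel)"
proof -
  have z': "cc (\<zeta>' b)" if "b \<in> Basis" for b using has_pd_cc z that by blast
  have "(\<integral>x. (\<Sum>b\<in>Basis. v' b x * \<zeta>' b x) \<partial>lborel) = (\<Sum>b\<in>Basis. \<integral>x. v' b x * \<zeta>' b x \<partial>lborel)"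
    by (intro Bochner_Integration.integral_sum cc_integrable cc_mult(1) v z')
  also have "\<dots> = (\<Sum>b\<in>Basis. - (\<integral>x. v'' b x * \<zeta> x \<partial>lborel))"
    using integration_by_parts_pd[OF v(1) z(2) v(2,3) z(1,3)] by (intro sum.cong) auto
  also have "\<dots> = - (\<Sum>b\<in>Basis. (\<integral>x. v'' b x * \<zeta> x \<partial>lborel))" by (simp add: sum_negf)
  also have "(\<Sum>b\<in>Basis. (\<integral>x. v'' b x * \<zeta> x \<partial>lborel)) = (\<integral>x. (\<Sum>b\<in>Basis. v'' b x * \<zeta> x) \<partial>lborel)"
    by (intro Bochner_Integration.integral_sum[symmetric] cc_integrable cc_mult(1) v z)
  finally show ?thesis by (simp add: sum_distrib_right)
qed

text \<open>The functions put into the stability form below are built from \<open>pd u e\<close>,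
  which is only C^1. Approximants with errors 1/(n+1), all supported in one ball, permit dominated
  convergence.\<close>

lemma stable_C1:
  fixes u \<phi> :: "'a::euclidean_space \<Rightarrow> real"
  assumes stab: "stable f u" and V: "continuous_on UNIV (\<lambda>x. deriv f (u x))"
    and \<phi>: "cc \<phi>" "\<And>b. b \<in> Basis \<Longrightarrow> has_pd \<phi> b (\<phi>' b)" "\<And>b. b \<in> Basis \<Longrightarrow> continuous_on UNIV (\<phi>' b)"
  shows "0 \<le> (\<integral>x. (\<Sum>b\<in>Basis. (\<phi>' b x)\<^sup>2) - deriv f (u x) * (\<phi> x)\<^sup>2 \<partial>lborel)"
proof -
  obtain R where R: "\<And>x. R < norm x \<Longrightarrow> \<phi> x = 0" using \<phi>(1) by (auto simp: cc_def)
  have "\<exists>\<psi>. test_fun \<psi> \<and> (\<forall>x. R + 1 < norm x \<longrightarrow> \<psi> x = 0) \<and> (\<forall>x. \<bar>\<psi> x - \<phi> x\<bar> \<le> inverse (real (Suc n))) \<and>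
    (\<forall>b\<in>Basis. \<forall>x. \<bar>pd \<psi> b x - \<phi>' b x\<bar> \<le> inverse (real (Suc n)))" for n
  proof -
    have pos: "0 < inverse (real (Suc n))" by simp
    show ?thesis
      by (rule test_fun_approx[OF cc_continuous[OF \<phi>(1)] R \<phi>(2,3) pos]) (assumption, assumption, assumption, blast)
  qed
  then obtain \<psi> where \<psi>: "\<And>n. test_fun (\<psi> n)" "\<And>n x. R + 1 < norm x \<Longrightarrow> \<psi> n x = 0"
    "\<And>n x. \<bar>\<psi> n x - \<phi> x\<bar> \<le> inverse (real (Suc n))"
    "\<And>n b x. b \<in> Basis \<Longrightarrow> \<bar>pd (\<psi> n) b x - \<phi>' b x\<bar> \<le> inverse (real (Suc n))"
    by metis
  have Ck: "Ck 2 (\<psi> n)" for n using \<psi>(1) by (auto simp: test_fun_def smooth_def)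
  note \<psi>C = Ck_2_has_pd[OF Ck]
  define G where "G \<psi> \<psi>' x = (\<Sum>b\<in>Basis. (\<psi>' b x)\<^sup>2) - deriv f (u x) * (\<psi> x)\<^sup>2"
    for \<psi> :: "'a \<Rightarrow> real" and \<psi>' :: "'a \<Rightarrow> 'a \<Rightarrow> real" and x
  have grad: "(norm (grad v x))\<^sup>2 = (\<Sum>b\<in>Basis. (pd v b x)\<^sup>2)" for v :: "'a \<Rightarrow> real" and x
    unfolding power2_norm_eq_inner
    by (subst euclidean_inner) (simp add: grad_def power2_eq_square inner_sum_left inner_Basis if_distrib cong: if_cong)
  have nonneg: "0 \<le> (\<integral>x. G (\<psi> n) (pd (\<psi> n)) x \<partial>lborel)" for n
    using stab \<psi>(1)[of n] by (simp add: stable_def G_def grad)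
  have lim: "(\<lambda>n. X n) \<longlonglongrightarrow> l" if "\<And>n. \<bar>X n - l\<bar> \<le> inverse (real (Suc n))" for X and l :: real
    by (rule LIM_zero_cancel, rule Lim_null_comparison[OF _ LIMSEQ_inverse_real_of_nat]) (use that in auto)
  have pt: "(\<lambda>n. G (\<psi> n) (pd (\<psi> n)) x) \<longlonglongrightarrow> G \<phi> \<phi>' x" for x
    unfolding G_def by (intro tendsto_intros lim \<psi>)
  have cont: "continuous_on UNIV (G \<psi> \<psi>')" if "continuous_on UNIV \<psi>" "\<And>b. b \<in> Basis \<Longrightarrow> continuous_on UNIV (\<psi>' b)" for \<psi> \<psi>'
    unfolding G_def by (intro continuous_intros V that)
  have meas: "G (\<psi> n) (pd (\<psi> n)) \<in> borel_measurable lborel" "G \<phi> \<phi>' \<in> borel_measurable lborel" for n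
    using borel_measurable_continuous_onI[OF cont[OF \<psi>C(1,3)]] borel_measurable_continuous_onI[OF cont[OF cc_continuous[OF \<phi>(1)] \<phi>(3)]]
    by simp_all
  \<comment> \<open>All approximation errors are at most 1, so adding 1 to
    \<open>\<bar>\<phi>\<bar>\<close> and to its partial derivatives dominates every approximant on
    the ball of radius \<open>R + 1\<close>.\<close>
  define H where "H x = (\<Sum>b\<in>Basis. (\<bar>\<phi>' b x\<bar> + 1)\<^sup>2) + \<bar>deriv f (u x)\<bar> * (\<bar>\<phi> x\<bar> + 1)\<^sup>2" for x
  have cH: "continuous_on UNIV H"
    unfolding H_def by (intro continuous_intros V \<phi> cc_continuous[OF \<phi>(1)])
  have int: "integrable lborel (\<lambda>x. indicator (cball 0 (R+1)) x *\<^sub>R H x)"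
    by (intro borel_integrable_compact continuous_on_subset[OF cH]) auto
  have sq: "a\<^sup>2 \<le> (\<bar>c\<bar> + 1)\<^sup>2" if "\<bar>a - c\<bar> \<le> inverse (real (Suc n))" for a c :: real and n
  proof -
    have "inverse (real (Suc n)) \<le> 1" by (simp add: field_simps)
    then have "\<bar>a\<bar> \<le> \<bar>c\<bar> + 1" using that by linarith
    then show ?thesis using power_mono[of "\<bar>a\<bar>" "\<bar>c\<bar> + 1" 2] by simp
  qed
  have dom: "norm (G (\<psi> n) (pd (\<psi> n)) x) \<le> indicator (cball 0 (R+1)) x *\<^sub>R H x" for n x
  proof (cases "R + 1 < norm x")
    case True
    have "pd (\<psi> n) b x = 0" if "b \<in> Basis" for b
      using has_pd_zero_outside[OF \<psi>C(2)[OF that] \<psi>(2) True] by simp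
    then show ?thesis using \<psi>(2)[OF True] True by (simp add: G_def)
  next
    case False
    have "norm (G (\<psi> n) (pd (\<psi> n)) x) \<le> (\<Sum>b\<in>Basis. (pd (\<psi> n) b x)\<^sup>2) + \<bar>deriv f (u x)\<bar> * (\<psi> n x)\<^sup>2"
      unfolding G_def real_norm_def
      by (rule order_trans[OF abs_triangle_ineq4]) (simp add: abs_mult sum_nonneg)
    also have "\<dots> \<le> H x"
      unfolding H_def by (intro add_mono sum_mono mult_left_mono sq[OF \<psi>(4)] sq[OF \<psi>(3)]) auto
    finally show ?thesis using False by simp
  qed
  have "(\<lambda>n. \<integral>x. G (\<psi> n) (pd (\<psi> n)) x \<partial>lborel) \<longlonglongrightarrow> (\<integral>x. G \<phi> \<phi>' x \<partial>lborel)"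
    by (rule integral_dominated_convergence[OF meas(2,1) int]) (use pt dom in auto)
  then have "0 \<le> (\<integral>x. G \<phi> \<phi>' x \<partial>lborel)"
    using nonneg by (intro LIMSEQ_le_const) auto
  then show ?thesis by (simp add: G_def)
qed

locale semilinear =
  fixes f :: "real \<Rightarrow> real" and u :: "'a::euclidean_space \<Rightarrow> real"
  assumes f_diff: "\<forall>s. f differentiable (at s)" and f'_cont: "continuous_on UNIV (deriv f)"
    and u_C2: "Ck 2 u"
    and eq: "\<forall>x. laplacian u x + f (u x) = 0"
begin

lemmas u = Ck_2_has_pd[OF u_C2]

lemma f_deriv: "(f has_real_derivative deriv f s) (at s)"
  using f_diff by (simp add: DERIV_deriv_iff_real_differentiable)

lemma fu_cont: "continuous_on UNIV (\<lambda>x. f (u x))"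
proof -
  have "continuous_on UNIV f"
    using f_deriv DERIV_isCont continuous_at_imp_continuous_on by blast
  then show ?thesis by (rule continuous_on_compose2) (auto intro: u)
qed

lemma V_cont: "continuous_on UNIV (\<lambda>x. deriv f (u x))"
  by (rule continuous_on_compose2[OF f'_cont]) (auto intro: u)

lemma pd_commute: "b \<in> Basis \<Longrightarrow> c \<in> Basis \<Longrightarrow> pd (pd u b) c = pd (pd u c) b"
  by (intro ext mixed_pd_commute) (auto intro: u)

text \<open>Translating the solution under a fixed test function provides a parameter in which the
  weak equation can be differentiated.\<close>

lemma weak_eq_shifted:
  assumes z: "cc \<zeta>" "\<And>b. b \<in> Basis \<Longrightarrow> has_pd \<zeta> b (\<zeta>' b)" "\<And>b. b \<in> Basis \<Longrightarrow> continuous_on UNIV (\<zeta>' b)"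
  shows "(\<integral>x. (\<Sum>b\<in>Basis. pd u b (x + a) * \<zeta>' b x) \<partial>lborel) = (\<integral>x. f (u (x + a)) * \<zeta> x \<partial>lborel)"
proof -
  have sh: "continuous_on UNIV (\<lambda>x. g (x + a))" if "continuous_on UNIV g" for g :: "'a \<Rightarrow> real"
    by (rule continuous_on_compose2[OF that]) (auto intro!: continuous_intros)
  have "(\<integral>x. (\<Sum>b\<in>Basis. pd u b (x + a) * \<zeta>' b x) \<partial>lborel) =
      - (\<integral>x. (\<Sum>b\<in>Basis. pd (pd u b) b (x + a)) * \<zeta> x \<partial>lborel)"
    by (intro green_identity has_pd_shift sh u z)
  moreover have "(\<Sum>b\<in>Basis. pd (pd u b) b (x + a)) = - f (u (x + a))" for x
    using eq[rule_format, of "x + a"] by (simp add: laplacian_def)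
  ultimately show ?thesis by simp
qed

lemma weak_eq:
  assumes z: "cc \<zeta>" "\<And>b. b \<in> Basis \<Longrightarrow> has_pd \<zeta> b (\<zeta>' b)" "\<And>b. b \<in> Basis \<Longrightarrow> continuous_on UNIV (\<zeta>' b)"
  shows "(\<integral>x. (\<Sum>b\<in>Basis. pd u b x * \<zeta>' b x) \<partial>lborel) = (\<integral>x. f (u x) * \<zeta> x \<partial>lborel)"
  using weak_eq_shifted[OF z, of 0] by simp

text \<open>A pointwise derivative of the equation would involve third derivatives of
  \<open>u\<close>. Instead both sides of the translated weak equation are differentiated at
  translation 0 in direction \<open>e\<close>, which takes two derivatives of \<open>u\<close> and
  one of \<open>f\<close>.\<close>

lemma linearized_weak_eq:
  assumes e: "e \<in> Basis"
    and z: "cc \<zeta>" "\<And>b. b \<in> Basis \<Longrightarrow> has_pd \<zeta> b (\<zeta>' b)" "\<And>b. b \<in> Basis \<Longrightarrow> continuous_on UNIV (\<zeta>' b)"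
  shows "(\<integral>x. (\<Sum>b\<in>Basis. pd (pd u e) b x * \<zeta>' b x) \<partial>lborel) =
    (\<integral>x. deriv f (u x) * pd u e x * \<zeta> x \<partial>lborel)"
proof -
  obtain R where R: "\<forall>x. R < norm x \<longrightarrow> \<zeta> x = 0" using z(1) by (auto simp: cc_def)
  have R': "\<forall>x. R < norm x \<longrightarrow> \<zeta>' b x = 0" if "b \<in> Basis" for b
    using has_pd_zero_outside[OF z(2)[OF that]] R by blast
  have z': "cc (\<zeta>' b)" if "b \<in> Basis" for b using has_pd_cc z that by blast
  have sh: "continuous_on UNIV (\<lambda>x. g (x + a))" if "continuous_on UNIV g" for g :: "'a \<Rightarrow> real" and a
    by (rule continuous_on_compose2[OF that]) (auto intro!: continuous_intros)
  have eq: "(\<Sum>b\<in>Basis. \<integral>x. pd u b (x + t *\<^sub>R e) * \<zeta>' b x \<partial>lborel) = (\<integral>x. f (u (x + t *\<^sub>R e)) * \<zeta> x \<partial>lborel)" for t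
  proof -
    have "(\<Sum>b\<in>Basis. \<integral>x. pd u b (x + t *\<^sub>R e) * \<zeta>' b x \<partial>lborel) =
        (\<integral>x. (\<Sum>b\<in>Basis. pd u b (x + t *\<^sub>R e) * \<zeta>' b x) \<partial>lborel)"
      by (intro Bochner_Integration.integral_sum[symmetric] cc_integrable cc_mult(1) sh u z')
    also have "\<dots> = (\<integral>x. f (u (x + t *\<^sub>R e)) * \<zeta> x \<partial>lborel)"
      by (rule weak_eq_shifted[OF z])
    finally show ?thesis .
  qed
  have "((\<lambda>t. \<Sum>b\<in>Basis. \<integral>x. pd u b (x + t *\<^sub>R e) * \<zeta>' b x \<partial>lborel) has_real_derivative
     (\<Sum>b\<in>Basis. \<integral>x. pd (pd u b) e x * \<zeta>' b x \<partial>lborel)) (at 0)"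
    using R' by (intro DERIV_sum leibniz_shift u e z disjI2)
  moreover have "((\<lambda>t. \<integral>x. f (u (x + t *\<^sub>R e)) * \<zeta> x \<partial>lborel) has_real_derivative
     (\<integral>x. (deriv f (u x) * pd u e x) * \<zeta> x \<partial>lborel)) (at 0)"
    using R by (intro leibniz_shift[of "\<lambda>x. f (u x)"] has_pd_compose u e f_deriv fu_cont V_cont
        cc_continuous[OF z(1)] disjI2 continuous_on_mult)
  ultimately have "(\<Sum>b\<in>Basis. \<integral>x. pd (pd u b) e x * \<zeta>' b x \<partial>lborel) =
     (\<integral>x. (deriv f (u x) * pd u e x) * \<zeta> x \<partial>lborel)"
    unfolding eq by (rule DERIV_unique)
  moreover have "(\<Sum>b\<in>Basis. \<integral>x. pd (pd u b) e x * \<zeta>' b x \<partial>lborel) =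
      (\<integral>x. (\<Sum>b\<in>Basis. pd (pd u b) e x * \<zeta>' b x) \<partial>lborel)"
    by (intro Bochner_Integration.integral_sum[symmetric] cc_integrable cc_mult(1) u z' e)
  ultimately show ?thesis using pd_commute[OF _ e] by simp
qed

end

section \<open>Radial functions and decay at infinity\<close>

lemma continuous_on_sqdist: "continuous_on UNIV (\<lambda>x::'a::euclidean_space. (x - c) \<bullet> (x - c) + s)"
  by (intro continuous_intros)

text \<open>The squared distance keeps radial functions regular at the centre. The offset
  \<open>s\<close> is 1 in the decay comparison, 0 for cutoffs, and the regularisation parameter of
  the singular barrier.\<close>

lemma has_pd_radial:
  assumes "\<And>\<rho>. \<rho> \<ge> s \<Longrightarrow> (G has_real_derivative G' \<rho>) (at \<rho>)"
  shows "has_pd (\<lambda>x. G ((x - c) \<bullet> (x - c) + s)) b (\<lambda>x. G' ((x - c) \<bullet> (x - c) + s) * (2 * ((x - c) \<bullet> b)))"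
proof -
  have "has_pd (\<lambda>x. (x - c) \<bullet> (x - c) + s) b (\<lambda>x. 2 * ((x - c) \<bullet> b) + 0)"
    by (intro has_pd_add has_pd_sqdist has_pd_const)
  from has_pd_compose[OF this, of G G'] assms show ?thesis by simp
qed

lemma has_pd_radial2:
  assumes "\<And>\<rho>. \<rho> \<ge> s \<Longrightarrow> (G' has_real_derivative G'' \<rho>) (at \<rho>)" "b \<in> Basis"
  shows "has_pd (\<lambda>x. G' ((x - c) \<bullet> (x - c) + s) * (2 * ((x - c) \<bullet> b))) b
    (\<lambda>x. G'' ((x - c) \<bullet> (x - c) + s) * (4 * ((x - c) \<bullet> b)\<^sup>2) + 2 * G' ((x - c) \<bullet> (x - c) + s))"
proof -
  have "has_pd (\<lambda>x. G' ((x - c) \<bullet> (x - c) + s) * (2 * ((x - c) \<bullet> b))) b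
    (\<lambda>x. G'' ((x - c) \<bullet> (x - c) + s) * (2 * ((x - c) \<bullet> b)) * (2 * ((x - c) \<bullet> b)) + G' ((x - c) \<bullet> (x - c) + s) * (2 * (b \<bullet> b)))"
    by (intro has_pd_mult has_pd_radial has_pd_cmult has_pd_inner assms)
  then show ?thesis using assms(2) by (simp add: power2_eq_square algebra_simps)
qed

lemma sum_Basis_inner_sq: "(\<Sum>b\<in>Basis. ((x::'a::euclidean_space) \<bullet> b)\<^sup>2) = x \<bullet> x"
  by (simp add: euclidean_inner[of x x] power2_eq_square)

text \<open>With \<open>g1\<close> and \<open>g2\<close> the first two derivatives of a profile G,
  this is the Laplacian of G(|x - c|^2 + s).\<close>

lemma radial_laplacian:
  fixes x c :: "'a::euclidean_space"
  shows "(\<Sum>b\<in>Basis. g2 * (4 * ((x - c) \<bullet> b)\<^sup>2) + 2 * g1) = 4 * ((x - c) \<bullet> (x - c)) * g2 + 2 * real DIM('a) * g1"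
proof -
  have "(\<Sum>b\<in>Basis. g2 * (4 * ((x - c) \<bullet> b)\<^sup>2) + 2 * g1) = g2 * 4 * (\<Sum>b\<in>Basis. ((x - c) \<bullet> b)\<^sup>2) + real DIM('a) * (2 * g1)"
    by (simp add: sum.distrib sum_distrib_left mult.assoc)
  then show ?thesis unfolding sum_Basis_inner_sq by (simp add: algebra_simps)
qed

lemma continuous_on_radial:
  assumes "continuous_on {s..} G"
  shows "continuous_on UNIV (\<lambda>x::'a::euclidean_space. G ((x - c) \<bullet> (x - c) + s))"
  by (rule continuous_on_compose2[OF assms continuous_on_sqdist]) auto

text \<open>Were \<open>l\<close> positive, \<open>F'\<close> would be positive just to the right of
  its zero at 0, and \<open>F\<close> would exceed its maximum there.\<close>

lemma second_deriv_at_max: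
  assumes F: "\<And>t. (F has_real_derivative F' t) (at t)" and F': "(F' has_real_derivative l) (at 0)"
    and d: "d > 0" and max: "\<And>t. \<bar>t\<bar> < d \<Longrightarrow> F t \<le> F (0::real)"
  shows "l \<le> 0"
proof (rule ccontr)
  assume "\<not> l \<le> 0"
  then obtain d' where d': "d' > 0" "\<And>h. 0 < h \<Longrightarrow> h < d' \<Longrightarrow> F' 0 < F' (0 + h)"
    using DERIV_pos_inc_right[OF F'] by force
  have F'0: "F' 0 = 0" using DERIV_local_max[OF F d] max by auto
  define h where "h = min d d' / 2"
  have h: "0 < h" "h < d" "h < d'" using d d'(1) by (auto simp: h_def)
  obtain z where z: "0 < z" "z < h" "F h - F 0 = (h - 0) * F' z" using MVT2[OF h(1), of F F'] F by blast
  have "F' z > 0" using d'(2)[of z] z h F'0 by simp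
  then have "0 < (h - 0) * F' z" using h(1) by simp
  then have "F h > F 0" using z(3) by linarith
  then show False using max[of h] h by simp
qed

text \<open>Comparison with the superharmonic function \<open>(1 + \<bar>x\<bar>\<^sup>2) powr (- m)\<close>, which is admissible for every
  \<open>m \<le> (N - 2) / 2\<close>; half of that exponent is all that the energy estimate needs.\<close>

lemma exterior_decay:
  fixes v :: "'a::euclidean_space \<Rightarrow> real"
  assumes v: "continuous_on UNIV v" "\<And>b. b \<in> Basis \<Longrightarrow> has_pd v b (v' b)"
      "\<And>b. b \<in> Basis \<Longrightarrow> has_pd (v' b) b (v'' b)"
    and lim: "(v \<longlongrightarrow> 0) at_infinity" and m: "0 < m" "4 * m = real DIM('a) - 2"
    and sub: "\<And>x. R0 < norm x \<Longrightarrow> 0 < v x \<Longrightarrow> 0 \<le> (\<Sum>b\<in>Basis. v'' b x)"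
    and bd: "\<And>x. norm x = R0 \<Longrightarrow> v x \<le> M" and M: "0 < M" and R0: "0 \<le> R0"
    and x: "R0 \<le> norm x"
  shows "v x \<le> M * (R0\<^sup>2 + 1) powr m * (x \<bullet> x + 1) powr (- m)"
proof (rule ccontr)
  \<comment> \<open>This \<open>K\<close> makes the comparison function equal to \<open>M\<close> on
    the sphere \<open>norm x = R0\<close>.\<close>
  define K where "K = M * (R0\<^sup>2 + 1) powr m"
  have sq1: "0 < R0\<^sup>2 + 1" using zero_le_power2[of R0] by linarith
  have K: "K > 0" unfolding K_def using M sq1 by simp
  assume "\<not> v x \<le> M * (R0\<^sup>2 + 1) powr m * (x \<bullet> x + 1) powr (- m)"
  then have x1: "v x > K * (x \<bullet> x + 1) powr (- m)" by (simp add: K_def)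
  define G where "G \<rho> = (-K) * \<rho> powr (- m)" for \<rho> :: real
  define G' where "G' \<rho> = K * m * \<rho> powr (- m - 1)" for \<rho> :: real
  define G'' where "G'' \<rho> = K * m * (- m - 1) * \<rho> powr (- m - 2)" for \<rho> :: real
  have dG: "(G has_real_derivative G' \<rho>) (at \<rho>)" and dG': "(G' has_real_derivative G'' \<rho>) (at \<rho>)"
    if "\<rho> \<ge> 1" for \<rho>
    using that unfolding G_def[abs_def] G'_def[abs_def] G''_def
    by (auto intro!: derivative_eq_intros simp: algebra_simps)
  define h where "h y = v y + G ((y - 0) \<bullet> (y - 0) + 1)" for y
  have cG: "continuous_on {1..} G"
    using dG by (intro continuous_at_imp_continuous_on) (auto intro: DERIV_isCont)
  have ch: "continuous_on UNIV h"
    unfolding h_def by (intro continuous_intros v continuous_on_radial cG)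
  have hx: "h x > 0" using x1 by (simp add: h_def G_def)
  have Gle: "G ((y - 0) \<bullet> (y - 0) + 1) \<le> 0" for y using K by (simp add: G_def)
  \<comment> \<open>Far out \<open>h \<le> v < h x\<close>, so the supremum of \<open>h\<close> over
    the exterior domain is attained on a compact shell.\<close>
  have "\<forall>\<^sub>F y in at_infinity. v y < h x"
    using order_tendstoD(2)[OF lim hx] .
  then obtain R1 where R1: "\<And>y. R1 \<le> norm y \<Longrightarrow> v y < h x"
    by (auto simp: eventually_at_infinity)
  define S where "S = cball 0 (max R1 (norm x)) - ball (0::'a) R0"
  have "compact S" unfolding S_def by (intro compact_diff) auto
  moreover have xS: "x \<in> S" using x by (auto simp: S_def)
  ultimately obtain z where z: "z \<in> S" "\<And>y. y \<in> S \<Longrightarrow> h y \<le> h z"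
    using continuous_attains_sup[of S h] continuous_on_subset[OF ch] by blast
  have hz: "h z > 0" using z(2)[OF xS] hx by simp
  have zmax: "h y \<le> h z" if "R0 \<le> norm y" for y
  proof (cases "y \<in> S")
    case False
    then have "R1 \<le> norm y" using that by (auto simp: S_def)
    then have "h y < h x" using R1[of y] Gle[of y] by (simp add: h_def)
    then show ?thesis using z(2)[OF xS] by simp
  qed (use z in auto)
  have z0: "R0 < norm z"
  proof (rule ccontr)
    assume "\<not> R0 < norm z"
    then have nz: "norm z = R0" using z(1) by (auto simp: S_def)
    then have "(z - 0) \<bullet> (z - 0) + 1 = R0\<^sup>2 + 1" by (simp add: dot_square_norm)
    then have "h z = v z - K * (R0\<^sup>2 + 1) powr (- m)" unfolding h_def G_def by (simp only:)
    moreover have "(R0\<^sup>2 + 1) powr m * (R0\<^sup>2 + 1) powr (- m) = 1"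
      using sq1 by (simp add: powr_minus)
    then have "K * (R0\<^sup>2 + 1) powr (- m) = M" by (simp add: K_def mult.assoc)
    ultimately show False using bd[OF nz] hz by simp
  qed
  have vz: "v z > 0" using hz Gle[of z] by (simp add: h_def)
  let ?\<rho> = "(z - 0) \<bullet> (z - 0) + 1"
  have second: "v'' b z + (G'' ?\<rho> * (4 * ((z - 0) \<bullet> b)\<^sup>2) + 2 * G' ?\<rho>) \<le> 0" if b: "b \<in> Basis" for b
  proof -
    define H where "H x = v' b x + G' ((x - 0) \<bullet> (x - 0) + 1) * (2 * ((x - 0) \<bullet> b))" for x
    have h1: "has_pd h b H"
      unfolding h_def[abs_def] H_def[abs_def] by (intro has_pd_add has_pd_radial v b dG)
    have "has_pd H b (\<lambda>x. v'' b x + (G'' ((x - 0) \<bullet> (x - 0) + 1) * (4 * ((x - 0) \<bullet> b)\<^sup>2) + 2 * G' ((x - 0) \<bullet> (x - 0) + 1)))"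
      unfolding H_def[abs_def] by (intro has_pd_add has_pd_radial2 v b dG')
    then have h2: "((\<lambda>t. H (z + t *\<^sub>R b)) has_real_derivative v'' b z + (G'' ?\<rho> * (4 * ((z - 0) \<bullet> b)\<^sup>2) + 2 * G' ?\<rho>)) (at 0)"
      unfolding has_pd_def by blast
    have "R0 \<le> norm (z + t *\<^sub>R b)" if "\<bar>t\<bar> < norm z - R0" for t
      using norm_triangle_ineq2[of z "- (t *\<^sub>R b)"] b that by simp
    then show ?thesis
      using second_deriv_at_max[OF has_pd_line[OF h1] h2, of "norm z - R0"] z0 zmax by simp
  qed
  have "(\<Sum>b\<in>Basis. v'' b z) + (4 * ((z - 0) \<bullet> (z - 0)) * G'' ?\<rho> + 2 * real DIM('a) * G' ?\<rho>) \<le> 0"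
    using sum_nonpos[OF second] unfolding sum.distrib radial_laplacian[symmetric] by simp
  \<comment> \<open>With 4m = N - 2 this Laplacian is a positive multiple of (N - 2)|z|^2 + 2N; its
    strict positivity contradicts the maximum at \<open>z\<close>.\<close>
  moreover have "4 * ((z - 0) \<bullet> (z - 0)) * G'' ?\<rho> + 2 * real DIM('a) * G' ?\<rho> > 0"
  proof -
    have rho: "?\<rho> > 0" using inner_ge_zero[of "z - 0"] by linarith
    have expo: "(- m - 2) + 1 = - m - 1" by simp
    have "?\<rho> powr (- m - 1) = ?\<rho> powr (- m - 2) * ?\<rho>"
      using rho powr_add[of ?\<rho> "- m - 2" 1, unfolded expo] by simp
    then have "4 * ((z - 0) \<bullet> (z - 0)) * G'' ?\<rho> + 2 * real DIM('a) * G' ?\<rho> =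
        K * m * ?\<rho> powr (- m - 2) * (2 * real DIM('a) * ?\<rho> - 4 * (m + 1) * (z \<bullet> z))"
      by (simp add: G'_def G''_def algebra_simps)
    also have "2 * real DIM('a) * ?\<rho> - 4 * (m + 1) * (z \<bullet> z) = (real DIM('a) - 2) * (z \<bullet> z) + 2 * real DIM('a)"
    proof -
      have "real DIM('a) = 4 * m + 2" using m(2) by simp
      then show ?thesis by (simp add: algebra_simps)
    qed
    also have "K * m * ?\<rho> powr (- m - 2) * \<dots> > 0"
    proof (intro mult_pos_pos K m)
      show "0 < ?\<rho> powr (- m - 2)" using rho by simp
      have "0 \<le> (real DIM('a) - 2) * (z \<bullet> z)" using m by (intro mult_nonneg_nonneg) auto
      then show "0 < (real DIM('a) - 2) * (z \<bullet> z) + 2 * real DIM('a)" using DIM_positive[where 'a='a] by linarith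
    qed
    finally show ?thesis .
  qed
  ultimately show False using sub[OF z0 vz] by linarith
qed

text \<open>From the second power on, the positive part has a derivative across 0; the cutoff
  profile and the barrier take their smoothness from this.\<close>

lemma DERIV_pospart_power:
  "((\<lambda>t. max 0 t ^ Suc (Suc n)) has_real_derivative (real n + 2) * max 0 t ^ Suc n) (at (t::real))"
proof -
  consider "t < 0" | "t = 0" | "t > 0" by linarith
  then show ?thesis
  proof cases
    case 1
    then have "\<forall>\<^sub>F x in nhds t. max 0 x ^ Suc (Suc n) = 0"
      using eventually_nhds_in_open[of "{..<0}" t] by (auto elim!: eventually_mono)
    from DERIV_cong_ev[OF refl this refl] show ?thesis using 1 by simp
  next
    case 2
    have "((\<lambda>h. (max 0 h ^ Suc n :: real)) \<longlongrightarrow> max 0 0 ^ Suc n) (at 0)"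
      by (intro tendsto_intros)
    moreover have "(\<lambda>h. (max 0 (0 + h) ^ Suc (Suc n) - max 0 0 ^ Suc (Suc n)) / h) = (\<lambda>h::real. max 0 h ^ Suc n)"
      by (auto simp: max_def)
    ultimately show ?thesis using 2 by (simp add: DERIV_def)
  next
    case 3
    then have "\<forall>\<^sub>F x in nhds t. max 0 x ^ Suc (Suc n) = x ^ Suc (Suc n)"
      using eventually_nhds_in_open[of "{0<..}" t] by (auto elim!: eventually_mono)
    moreover have "((\<lambda>x. x ^ Suc (Suc n)) has_real_derivative (real n + 2) * max 0 t ^ Suc n) (at t)"
      using DERIV_pow[of "Suc (Suc n)" t] 3 by (simp add: algebra_simps)
    ultimately show ?thesis by (subst DERIV_cong_ev[OF refl _ refl]) auto
  qed
qed

lemma DERIV_integral_upper: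
  assumes "continuous_on {a..} (k :: real \<Rightarrow> real)" "a < t"
  shows "((\<lambda>x. integral {a..x} k) has_real_derivative k t) (at t)"
proof -
  have "((\<lambda>x. integral {a..x} k) has_real_derivative k t) (at t within {a..t+1})"
    using assms by (intro integral_has_real_derivative continuous_on_subset[OF assms(1)]) auto
  then show ?thesis using assms(2) by (simp add: at_within_Icc_at)
qed

section \<open>Cutoff functions\<close>

text \<open>\<open>\<kappa>'\<close> and \<open>\<kappa>''\<close> belong to the weight |grad
  \<eta>|^2, because that weight itself enters the Caccioppoli estimate and must be twice
  differentiable. The \<open>R ^ 4\<close> is the scaling of its Laplacian.\<close>

definition cutoff :: "real \<Rightarrow> real \<Rightarrow> ('a::euclidean_space \<Rightarrow> real) \<Rightarrow> ('a \<Rightarrow> 'a \<Rightarrow> real) \<Rightarrow>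
    ('a \<Rightarrow> 'a \<Rightarrow> real) \<Rightarrow> ('a \<Rightarrow> 'a \<Rightarrow> real) \<Rightarrow> bool" where
  "cutoff C R \<eta> \<eta>' \<kappa>' \<kappa>'' \<longleftrightarrow>
    cc \<eta> \<and> (\<forall>x. norm x \<le> R \<longrightarrow> \<eta> x = 1) \<and>
    (\<forall>b\<in>Basis. has_pd \<eta> b (\<eta>' b) \<and> continuous_on UNIV (\<eta>' b)) \<and>
    (\<forall>b\<in>Basis. has_pd (\<lambda>x. \<Sum>a\<in>Basis. (\<eta>' a x)\<^sup>2) b (\<kappa>' b) \<and> has_pd (\<kappa>' b) b (\<kappa>'' b) \<and>
       continuous_on UNIV (\<kappa>' b) \<and> continuous_on UNIV (\<kappa>'' b)) \<and>
    (\<forall>x. norm x < R \<or> 2 * R < norm x \<longrightarrow> (\<Sum>a\<in>Basis. (\<eta>' a x)\<^sup>2) = 0 \<and> (\<Sum>b\<in>Basis. \<kappa>'' b x) = 0) \<and>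
    (\<forall>x. \<bar>\<Sum>b\<in>Basis. \<kappa>'' b x\<bar> \<le> C / R ^ 4)"

text \<open>\<open>\<eta>\<close> is a profile \<open>E\<close> evaluated at |x|^2 / R^2, with E'
  proportional to the square of \<open>p\<close>; then |grad \<eta>|^2 contains the fourth power of
  \<open>p\<close>, which is C^2 across the endpoints 1 and 2. A compactness bound at scale 1 gives
  a \<open>C\<close> valid for every \<open>R\<close>.\<close>

lemma cutoff_exists:
  "\<exists>C\<ge>0. \<forall>R>0. \<exists>(\<eta>::'a::euclidean_space \<Rightarrow> real) \<eta>' \<kappa>' \<kappa>''. cutoff C R \<eta> \<eta>' \<kappa>' \<kappa>''"
proof -
  define p where "p t = max 0 ((t - 1) * (2 - t))" for t :: real
  define k where "k t = p t ^ 2" for t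
  \<comment> \<open>Starting at -1 rather than 0 makes \<open>K\<close> two-sidedly differentiable
    at 0, the image of the origin.\<close>
  define K where "K t = integral {-1..t} k" for t
  define c where "c = K 2"
  define E where "E t = 1 - K t / c" for t
  have p0: "p t = 0" if "t \<le> 1 \<or> t \<ge> 2" for t
    using that by (auto simp: p_def max_def mult_le_0_iff zero_le_mult_iff)
  have cp: "continuous_on A p" for A unfolding p_def by (intro continuous_intros)
  have ck: "continuous_on A k" for A unfolding k_def by (intro continuous_intros cp)
  have dK: "(K has_real_derivative k t) (at t)" if "t > -1" for t
    unfolding K_def[abs_def] by (rule DERIV_integral_upper[OF ck that])
  have K1: "K t = 0" if "t \<le> 1" for t
  proof -
    have "integral {-1..t} k = integral {-1..t} (\<lambda>_. 0)"
      by (rule Henstock_Kurzweil_Integration.integral_cong) (use that p0 in \<open>auto simp: k_def\<close>)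
    then show ?thesis by (simp add: K_def)
  qed
  have K2: "K t = c" if "t \<ge> 2" for t
  proof -
    have "integral {-1..2} k + integral {2..t} k = integral {-1..t} k"
      using that by (intro Henstock_Kurzweil_Integration.integral_combine integrable_continuous_real ck) auto
    moreover have "integral {2..t} k = integral {2..t} (\<lambda>_. 0)"
      by (rule Henstock_Kurzweil_Integration.integral_cong) (use that p0 in \<open>auto simp: k_def\<close>)
    ultimately show ?thesis by (simp add: K_def c_def)
  qed
  have cpos: "c > 0"
  proof -
    have "K 1 < K 2"
    proof (rule DERIV_pos_imp_increasing_open[where f=K])
      show "\<exists>y. (K has_real_derivative y) (at t) \<and> y > 0" if "1 < t" "t < 2" for t
        using that dK[of t] by (intro exI[of _ "k t"]) (auto simp: k_def p_def max_def)
      show "continuous_on {1..2} K"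
        by (intro continuous_at_imp_continuous_on ballI DERIV_isCont[OF dK]) auto
    qed auto
    then show ?thesis using K1[of 1] by (simp add: c_def)
  qed
  have dE: "(E has_real_derivative (- k t / c)) (at t)" if "t > -1" for t
    unfolding E_def[abs_def] using dK[OF that] cpos by (auto intro!: derivative_eq_intros)
  have dp: "((\<lambda>t. p t ^ Suc (Suc n)) has_real_derivative (real n + 2) * p t ^ Suc n * (3 - 2 * t)) (at t)" for n t
    unfolding p_def
    by (rule DERIV_chain2[OF DERIV_pospart_power]) (auto intro!: derivative_eq_intros simp: algebra_simps)
  \<comment> \<open>|grad \<eta>|^2 will be \<open>X (\<rho> / R\<^sup>2) / R\<^sup>2\<close> with
    \<rho> = |x|^2; \<open>X1\<close> and \<open>X2\<close> are the derivatives of \<open>X\<close>,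
    and \<open>Y\<close> below is the Laplacian at scale 1.\<close>
  define X where "X t = 4 * t * p t ^ 4 / c\<^sup>2" for t
  define X1 where "X1 t = (4 * p t ^ 4 + 16 * t * p t ^ 3 * (3 - 2 * t)) / c\<^sup>2" for t
  define X2 where "X2 t = (32 * p t ^ 3 * (3 - 2 * t) + 48 * t * p t ^ 2 * (3 - 2 * t)\<^sup>2 - 32 * t * p t ^ 3) / c\<^sup>2" for t
  have dp4: "((\<lambda>t. p t ^ 4) has_real_derivative 4 * p t ^ 3 * (3 - 2 * t)) (at t)" for t
    using dp[of 2 t] by (simp add: eval_nat_numeral)
  have dp3: "((\<lambda>t. p t ^ 3) has_real_derivative 3 * p t ^ 2 * (3 - 2 * t)) (at t)" for t
    using dp[of 1 t] by (simp add: eval_nat_numeral)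
  have dX: "(X has_real_derivative X1 t) (at t)" for t
    unfolding X_def[abs_def] X1_def
    by (rule derivative_eq_intros dp4 refl)+ (use cpos in \<open>auto simp: field_simps\<close>)
  have dX1: "(X1 has_real_derivative X2 t) (at t)" for t
    unfolding X1_def[abs_def] X2_def
    by (rule derivative_eq_intros dp4 dp3 refl)+ (use cpos in \<open>auto simp: field_simps power2_eq_square\<close>)
  have cX: "continuous_on A X" "continuous_on A X1" "continuous_on A X2" for A
    unfolding X_def X1_def X2_def using cpos by (auto intro!: continuous_intros cp)
  have X0: "X t = 0" "X1 t = 0" "X2 t = 0" if "t \<le> 1 \<or> t \<ge> 2" for t
    using p0[OF that] by (simp_all add: X_def X1_def X2_def)
  define Y where "Y t = 4 * t * X2 t + 2 * real DIM('a) * X1 t" for t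
  have "compact (Y ` {1..2})"
    unfolding Y_def by (intro compact_continuous_image continuous_intros cX) auto
  from compact_imp_bounded[OF this] obtain B where "\<forall>y\<in>Y ` {1..2}. norm y \<le> B"
    unfolding bounded_iff by blast
  then have B': "\<bar>Y t\<bar> \<le> B" if "t \<in> {1..2}" for t
    using that by simp
  have B: "\<bar>Y t\<bar> \<le> \<bar>B\<bar>" for t
  proof (cases "t \<in> {1..2}")
    case True
    then show ?thesis using B'[OF True] by linarith
  next
    case False
    then show ?thesis using X0[of t] by (auto simp: Y_def)
  qed
  show ?thesis
  proof (intro exI[of _ "\<bar>B\<bar>"] conjI allI impI)
    fix R :: real assume R: "R > 0"
    define G where "G \<rho> = X (\<rho> / R\<^sup>2) / R\<^sup>2" for \<rho>
    define G' where "G' \<rho> = X1 (\<rho> / R\<^sup>2) / R ^ 4" for \<rho>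
    define G'' where "G'' \<rho> = X2 (\<rho> / R\<^sup>2) / R ^ 6" for \<rho>
    define \<eta> where "\<eta> x = (\<lambda>\<rho>. E (\<rho> / R\<^sup>2)) ((x - 0) \<bullet> (x - 0) + 0)" for x :: 'a
    define \<eta>' where "\<eta>' b x = (\<lambda>\<rho>. - k (\<rho> / R\<^sup>2) / c / R\<^sup>2) ((x - 0) \<bullet> (x - 0) + 0) * (2 * ((x - 0) \<bullet> b))" for b x :: 'a
    define \<kappa>' where "\<kappa>' b x = G' ((x - 0) \<bullet> (x - 0) + 0) * (2 * ((x - 0) \<bullet> b))" for b x :: 'a
    define \<kappa>'' where "\<kappa>'' b x = G'' ((x - 0) \<bullet> (x - 0) + 0) * (4 * ((x - 0) \<bullet> b)\<^sup>2) + 2 * G' ((x - 0) \<bullet> (x - 0) + 0)" for b x :: 'a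
    have scale: "((\<lambda>\<rho>. F (\<rho> / R\<^sup>2)) has_real_derivative F' (\<rho> / R\<^sup>2) / R\<^sup>2) (at \<rho>)"
      if "\<And>t. t > -1 \<Longrightarrow> (F has_real_derivative F' t) (at t)" "\<rho> \<ge> 0" for F F' and \<rho> :: real
    proof -
      have "(F has_real_derivative F' (\<rho> / R\<^sup>2)) (at (\<rho> / R\<^sup>2))"
        using that(2) R by (intro that(1)) (smt (verit) divide_nonneg_nonneg zero_le_power2)
      then have "((\<lambda>\<rho>. F (\<rho> / R\<^sup>2)) has_real_derivative F' (\<rho> / R\<^sup>2) * (1 / R\<^sup>2)) (at \<rho>)"
        by (rule DERIV_chain2) (rule DERIV_cdivide[OF DERIV_ident])
      then show ?thesis by simp
    qed
    have dG: "(G has_real_derivative G' \<rho>) (at \<rho>)" if "\<rho> \<ge> 0" for \<rho>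
      unfolding G_def[abs_def] G'_def
      using DERIV_cdivide[OF scale[OF dX that], of "R\<^sup>2"] by simp
    have dG': "(G' has_real_derivative G'' \<rho>) (at \<rho>)" if "\<rho> \<ge> 0" for \<rho>
      unfolding G'_def[abs_def] G''_def
      using DERIV_cdivide[OF scale[OF dX1 that], of "R ^ 4"] by simp
    have pdeta: "has_pd \<eta> b (\<eta>' b)" for b
      unfolding \<eta>_def[abs_def] \<eta>'_def[abs_def]
      by (rule has_pd_radial) (rule scale[OF dE])
    have cdiv: "continuous_on UNIV (\<lambda>x::'a. F (((x - 0) \<bullet> (x - 0) + 0) / R\<^sup>2))" if "continuous_on UNIV F" for F :: "real \<Rightarrow> real"
      by (rule continuous_on_compose2[OF that]) (use R in \<open>auto intro!: continuous_intros\<close>)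
    have ceta': "continuous_on UNIV (\<eta>' b)" for b
      unfolding \<eta>'_def by (intro continuous_intros cdiv ck) (use R cpos in auto)
    have cchi: "continuous_on UNIV (\<kappa>' b)" "continuous_on UNIV (\<kappa>'' b)" for b
      unfolding \<kappa>'_def \<kappa>''_def G'_def G''_def using R by (auto intro!: continuous_intros cX cdiv[simplified])
    have small: "((x - 0) \<bullet> (x - 0) + 0) / R\<^sup>2 \<le> 1" if "norm x \<le> R" for x :: 'a
      using power_mono[OF that, of 2] R by (simp add: dot_square_norm)
    have big: "((x - 0) \<bullet> (x - 0) + 0) / R\<^sup>2 \<ge> 2" if "2 * R < norm x" for x :: 'a
    proof -
      have "4 * R\<^sup>2 \<le> (norm x)\<^sup>2" using power_mono[OF less_imp_le[OF that], of 2] R by simp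
      then have "2 * R\<^sup>2 \<le> (norm x)\<^sup>2" using zero_le_power2[of R] by linarith
      then show ?thesis using R by (simp add: dot_square_norm field_simps)
    qed
    have eta0: "\<eta> x = 0" if "2 * R < norm x" for x
      using big[OF that] K2 cpos by (simp add: \<eta>_def E_def)
    have "continuous_on UNIV \<eta>"
      unfolding \<eta>_def by (rule continuous_on_radial)
        (auto intro!: continuous_at_imp_continuous_on DERIV_isCont[OF scale[OF dE]])
    then have cceta: "cc \<eta>" using eta0 by (rule ccI)
    have chi_eq: "(\<Sum>a\<in>Basis. (\<eta>' a x)\<^sup>2) = G ((x - 0) \<bullet> (x - 0) + 0)" for x
    proof -
      have "(\<Sum>a\<in>Basis. (\<eta>' a x)\<^sup>2) = (k ((x \<bullet> x) / R\<^sup>2) / c / R\<^sup>2)\<^sup>2 * 4 * (\<Sum>a\<in>Basis. (x \<bullet> a)\<^sup>2)"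
        by (simp add: \<eta>'_def power_mult_distrib power_divide sum_distrib_left mult.assoc)
      then show ?thesis
        using R cpos unfolding sum_Basis_inner_sq by (simp add: G_def X_def k_def power_divide field_simps flip: power_mult)
    qed
    have lap_eq: "(\<Sum>b\<in>Basis. \<kappa>'' b x) = Y ((x \<bullet> x) / R\<^sup>2) / R ^ 4" for x
    proof -
      show ?thesis
        using R unfolding \<kappa>''_def radial_laplacian
        by (simp add: Y_def G''_def G'_def add_divide_distrib)
    qed
    show "\<exists>(\<eta>::'a \<Rightarrow> real) \<eta>' \<kappa>' \<kappa>''. cutoff \<bar>B\<bar> R \<eta> \<eta>' \<kappa>' \<kappa>''"
      unfolding cutoff_def
    proof (rule exI[of _ \<eta>], rule exI[of _ \<eta>'], rule exI[of _ \<kappa>'], rule exI[of _ \<kappa>''],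
        intro conjI allI ballI impI)
      show "\<eta> x = 1" if "norm x \<le> R" for x
        using small[OF that] K1 by (simp add: \<eta>_def E_def)
      show "has_pd (\<lambda>x. \<Sum>a\<in>Basis. (\<eta>' a x)\<^sup>2) b (\<kappa>' b)" for b
        unfolding chi_eq \<kappa>'_def[abs_def] by (rule has_pd_radial[OF dG])
      show "has_pd (\<kappa>' b) b (\<kappa>'' b)" if "b \<in> Basis" for b
        unfolding \<kappa>'_def[abs_def] \<kappa>''_def[abs_def] by (rule has_pd_radial2[OF dG' that])
      fix x :: 'a
      show "\<bar>\<Sum>b\<in>Basis. \<kappa>'' b x\<bar> \<le> \<bar>B\<bar> / R ^ 4"
        unfolding lap_eq using B R by (simp add: abs_divide divide_right_mono)
      assume "norm x < R \<or> 2 * R < norm x"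
      then have "(x \<bullet> x) / R\<^sup>2 \<le> 1 \<or> (x \<bullet> x) / R\<^sup>2 \<ge> 2"
        using small[of x] big[of x] by auto
      then show "(\<Sum>a\<in>Basis. (\<eta>' a x)\<^sup>2) = 0" "(\<Sum>b\<in>Basis. \<kappa>'' b x) = 0"
        unfolding chi_eq lap_eq using X0 by (simp_all add: G_def Y_def)
    qed (use cceta pdeta ceta' cchi in auto)
  qed simp
qed

section \<open>Energy decay\<close>

locale stable_solution = semilinear f u for f and u :: "'a::euclidean_space \<Rightarrow> real" +
  fixes \<delta> :: real
  assumes f0: "f 0 = 0"
    and \<delta>pos: "\<delta> > 0"
    and f_dec: "\<forall>s. \<bar>s\<bar> < \<delta> \<longrightarrow> deriv f s \<le> 0"
    and decay: "(u \<longlongrightarrow> 0) at_infinity"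
    and stab: "stable f u"
begin

lemma f_sign:
  assumes "\<bar>s\<bar> < \<delta>"
  shows "s \<ge> 0 \<Longrightarrow> f s \<le> 0" and "s \<le> 0 \<Longrightarrow> f s \<ge> 0"
proof -
  have d: "\<exists>y. (f has_real_derivative y) (at x) \<and> y \<le> 0" if "\<bar>x\<bar> < \<delta>" for x
    using f_deriv[of x] f_dec that by blast
  show "f s \<le> 0" if "s \<ge> 0"
    using DERIV_nonpos_imp_nonincreasing[of 0 s f] d assms that f0 by force
  show "f s \<ge> 0" if "s \<le> 0"
    using DERIV_nonpos_imp_nonincreasing[of s 0 f] d assms that f0 by force
qed

lemma small_outside: "\<exists>R0>0. \<forall>x. R0 \<le> norm x \<longrightarrow> \<bar>u x\<bar> < \<delta>"
proof -
  have "\<forall>\<^sub>F x in at_infinity. \<bar>u x\<bar> < \<delta>"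
    using tendstoD[OF decay \<delta>pos] by (simp add: dist_norm)
  then obtain B where "\<forall>x. B \<le> norm x \<longrightarrow> \<bar>u x\<bar> < \<delta>" by (auto simp: eventually_at_infinity)
  then show ?thesis by (intro exI[of _ "max B 1"]) auto
qed

text \<open>Four times this is at least N - 2 in every dimension; it is 0 for N at most 2, where
  smallness of \<open>u\<close> at infinity is enough.\<close>

definition decay_exp :: real where
  "decay_exp = max 0 ((real DIM('a) - 2) / 4)"

text \<open>|u| is not C^2, so the comparison runs separately for \<open>u\<close> and its negative;
  by \<open>f_sign\<close> each is subharmonic outside the ball where it is positive.\<close>

lemma u_decay: "\<exists>K R0. 0 < R0 \<and> 0 \<le> K \<and> (\<forall>x. R0 \<le> norm x \<longrightarrow> \<bar>u x\<bar> < \<delta> \<and> \<bar>u x\<bar> \<le> K * (x \<bullet> x + 1) powr (- decay_exp))"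
proof -
  obtain R0 where R0: "R0 > 0" "\<And>x. R0 \<le> norm x \<Longrightarrow> \<bar>u x\<bar> < \<delta>" using small_outside by blast
  show ?thesis
  proof (cases "DIM('a) \<le> 2")
    case True
    then have "decay_exp = 0" by (simp add: decay_exp_def max_def)
    moreover have "x \<bullet> x + 1 \<noteq> 0" for x :: 'a using inner_ge_zero[of x] by linarith
    ultimately have "\<bar>u x\<bar> \<le> \<delta> * (x \<bullet> x + 1) powr (- decay_exp)" if "R0 \<le> norm x" for x
      using R0(2)[OF that] by simp
    then show ?thesis using R0 \<delta>pos less_imp_le by blast
  next
    case False
    define m where "m = (real DIM('a) - 2) / 4"
    have m: "0 < m" "4 * m = real DIM('a) - 2" "decay_exp = m" using False by (auto simp: m_def decay_exp_def)
    have lap: "(\<Sum>b\<in>Basis. pd (pd u b) b x) = - f (u x)" for x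
      using eq by (simp add: laplacian_def add_eq_0_iff)
    have up: "u x \<le> \<delta> * (R0\<^sup>2 + 1) powr m * (x \<bullet> x + 1) powr (- m)" if "R0 \<le> norm x" for x
    proof (rule exterior_decay[where v'="pd u" and v''="\<lambda>b. pd (pd u b) b"])
      show "0 \<le> (\<Sum>b\<in>Basis. pd (pd u b) b x)" if "R0 < norm x" "0 < u x" for x
        unfolding lap using f_sign(1)[OF R0(2)[of x]] that by simp
      show "u x \<le> \<delta>" if "norm x = R0" for x using R0(2)[of x] that by simp
    qed (use u decay m that R0 \<delta>pos in auto)
    have lo: "(-1) * u x \<le> \<delta> * (R0\<^sup>2 + 1) powr m * (x \<bullet> x + 1) powr (- m)" if "R0 \<le> norm x" for x
    proof (rule exterior_decay[where v="\<lambda>x. (-1) * u x" and v'="\<lambda>b x. (-1) * pd u b x" and v''="\<lambda>b x. (-1) * pd (pd u b) b x"])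
      show "0 \<le> (\<Sum>b\<in>Basis. (-1) * pd (pd u b) b x)" if "R0 < norm x" "0 < (-1) * u x" for x
        unfolding sum_distrib_left[symmetric] lap using f_sign(2)[OF R0(2)[of x]] that by simp
      show "(-1) * u x \<le> \<delta>" if "norm x = R0" for x using R0(2)[of x] that by simp
      show "((\<lambda>x. (-1) * u x) \<longlongrightarrow> 0) at_infinity" using tendsto_mult_left[OF decay, of "-1"] by simp
      show "continuous_on UNIV (\<lambda>x. (-1) * u x)" by (intro continuous_intros u)
      show "has_pd (\<lambda>x. (-1) * u x) b (\<lambda>x. (-1) * pd u b x)" if "b \<in> Basis" for b
        by (intro has_pd_cmult u that)
      show "has_pd (\<lambda>x. (-1) * pd u b x) b (\<lambda>x. (-1) * pd (pd u b) b x)" if "b \<in> Basis" for b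
        by (intro has_pd_cmult u that)
    qed (use m that R0 \<delta>pos in auto)
    have "\<bar>u x\<bar> \<le> (\<delta> * (R0\<^sup>2 + 1) powr m) * (x \<bullet> x + 1) powr (- decay_exp)" if "R0 \<le> norm x" for x
      using up[OF that] lo[OF that] unfolding m(3) by linarith
    moreover have "0 \<le> \<delta> * (R0\<^sup>2 + 1) powr m" using \<delta>pos by simp
    ultimately show ?thesis using R0 by blast
  qed
qed

text \<open>Since \<open>\<Delta>(u\<^sup>2) = 2 \<bar>\<nabla>u\<bar>\<^sup>2 - 2 f(u) u \<ge> 2 \<bar>\<nabla>u\<bar>\<^sup>2\<close> where \<open>\<bar>u\<bar> < \<delta>\<close>.\<close>

lemma energy_inequality:
  assumes \<kappa>: "cc \<kappa>" "\<And>x. 0 \<le> \<kappa> x" "\<And>x. \<kappa> x \<noteq> 0 \<Longrightarrow> \<bar>u x\<bar> < \<delta>"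
    "\<And>b. b \<in> Basis \<Longrightarrow> has_pd \<kappa> b (\<kappa>' b)" "\<And>b. b \<in> Basis \<Longrightarrow> continuous_on UNIV (\<kappa>' b)"
    "\<And>b. b \<in> Basis \<Longrightarrow> has_pd (\<kappa>' b) b (\<kappa>'' b)" "\<And>b. b \<in> Basis \<Longrightarrow> continuous_on UNIV (\<kappa>'' b)"
  shows "2 * (\<integral>x. (\<Sum>b\<in>Basis. (pd u b x)\<^sup>2) * \<kappa> x \<partial>lborel) \<le> (\<integral>x. (u x)\<^sup>2 * (\<Sum>b\<in>Basis. \<kappa>'' b x) \<partial>lborel)"
proof -
  have \<kappa>': "cc (\<kappa>' b)" if "b \<in> Basis" for b using has_pd_cc \<kappa>(1,4,5) that by blast
  have \<kappa>'': "cc (\<kappa>'' b)" if "b \<in> Basis" for b using has_pd_cc \<kappa>'[OF that] \<kappa>(6,7) that by blast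
  have cu2: "continuous_on UNIV (\<lambda>x. u x * u x)" by (intro continuous_intros u)
  \<comment> \<open>The weak equation is tested with the product of \<open>u\<close> and
    \<open>\<kappa>\<close>.\<close>
  have "(\<integral>x. (\<Sum>b\<in>Basis. pd u b x * (pd u b x * \<kappa> x + u x * \<kappa>' b x)) \<partial>lborel) = (\<integral>x. f (u x) * (u x * \<kappa> x) \<partial>lborel)"
    by (intro weak_eq cc_mult(1) has_pd_mult u \<kappa> continuous_intros cc_continuous[OF \<kappa>(1)])
  also have "\<dots> \<le> 0"
  proof -
    have "f (u x) * (u x * \<kappa> x) \<le> 0" for x
    proof (cases "\<kappa> x = 0")
      case False
      then have "f (u x) * u x \<le> 0"
        using f_sign[OF \<kappa>(3)[OF False]] by (cases "u x \<ge> 0") (auto simp: mult_le_0_iff)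
      then show ?thesis using \<kappa>(2)[of x] by (simp add: mult.assoc[symmetric] mult_nonpos_nonneg)
    qed simp
    then show ?thesis
      using Bochner_Integration.integral_nonneg[of lborel "\<lambda>x. - (f (u x) * (u x * \<kappa> x))"] by simp
  qed
  also have "(\<integral>x. (\<Sum>b\<in>Basis. pd u b x * (pd u b x * \<kappa> x + u x * \<kappa>' b x)) \<partial>lborel) =
     (\<integral>x. (\<Sum>b\<in>Basis. (pd u b x)\<^sup>2) * \<kappa> x + (\<Sum>b\<in>Basis. (u x * pd u b x) * \<kappa>' b x) \<partial>lborel)"
    by (intro Bochner_Integration.integral_cong) (auto simp: power2_eq_square algebra_simps sum.distrib sum_distrib_left)
  also have "\<dots> = (\<integral>x. (\<Sum>b\<in>Basis. (pd u b x)\<^sup>2) * \<kappa> x \<partial>lborel) + (\<integral>x. (\<Sum>b\<in>Basis. (u x * pd u b x) * \<kappa>' b x) \<partial>lborel)"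
    by (intro Bochner_Integration.integral_add cc_integrable cc_mult(1) cc_sum \<kappa>' \<kappa>(1) u continuous_intros) auto
  finally have 1: "(\<integral>x. (\<Sum>b\<in>Basis. (pd u b x)\<^sup>2) * \<kappa> x \<partial>lborel) \<le> - (\<integral>x. (\<Sum>b\<in>Basis. (u x * pd u b x) * \<kappa>' b x) \<partial>lborel)"
    by simp
  \<comment> \<open>As 2 u grad u is the gradient of u^2, a second integration by parts puts both
    derivatives on \<open>\<kappa>\<close>.\<close>
  have "2 * (\<integral>x. (\<Sum>b\<in>Basis. (u x * pd u b x) * \<kappa>' b x) \<partial>lborel) = (\<Sum>b\<in>Basis. 2 * (\<integral>x. (u x * pd u b x) * \<kappa>' b x \<partial>lborel))"
    unfolding sum_distrib_left[symmetric]
    by (subst Bochner_Integration.integral_sum) (auto intro!: cc_integrable cc_mult(1) \<kappa>' u continuous_intros)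
  also have "\<dots> = (\<Sum>b\<in>Basis. - (\<integral>x. (u x * u x) * \<kappa>'' b x \<partial>lborel))"
  proof (rule sum.cong[OF refl])
    fix b :: 'a assume b: "b \<in> Basis"
    have "(\<integral>x. (pd u b x * u x + u x * pd u b x) * \<kappa>' b x \<partial>lborel) = - (\<integral>x. (u x * u x) * \<kappa>'' b x \<partial>lborel)"
      by (intro integration_by_parts_pd[where b=b] has_pd_mult u b \<kappa> \<kappa>' continuous_intros)
    then show "2 * (\<integral>x. (u x * pd u b x) * \<kappa>' b x \<partial>lborel) = - (\<integral>x. (u x * u x) * \<kappa>'' b x \<partial>lborel)"
      unfolding Bochner_Integration.integral_mult_right_zero[symmetric]
      by (simp add: algebra_simps)
  qed
  also have "\<dots> = - (\<integral>x. (u x)\<^sup>2 * (\<Sum>b\<in>Basis. \<kappa>'' b x) \<partial>lborel)"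
    unfolding sum_negf sum_distrib_left power2_eq_square
    by (subst Bochner_Integration.integral_sum) (auto intro!: cc_integrable cc_mult(1) \<kappa>'' cu2)
  finally show ?thesis using 1 by linarith
qed

text \<open>|grad \<eta>|^2 itself serves as the weight \<open>\<kappa>\<close> of
  \<open>energy_inequality\<close>, which spares a second cutoff around the annulus. The bound on
  the full gradient is later used for its single component \<open>pd u e\<close>.\<close>

lemma cutoff_energy:
  "\<exists>C R1. 0 < R1 \<and> (\<forall>R\<ge>R1. \<exists>\<eta> \<eta>'. cc \<eta> \<and> (\<forall>x. norm x \<le> R \<longrightarrow> \<eta> x = 1) \<and>
    (\<forall>b\<in>Basis. has_pd \<eta> b (\<eta>' b) \<and> continuous_on UNIV (\<eta>' b)) \<and>
    (\<forall>b\<in>Basis. \<forall>x. norm x < R \<longrightarrow> \<eta>' b x = 0) \<and>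
    (\<integral>x. (\<Sum>b\<in>Basis. (pd u b x)\<^sup>2) * (\<Sum>b\<in>Basis. (\<eta>' b x)\<^sup>2) \<partial>lborel) \<le> C / R\<^sup>2)"
proof -
  obtain K R0 where K: "0 < R0" "0 \<le> K" "\<And>x. R0 \<le> norm x \<Longrightarrow> \<bar>u x\<bar> < \<delta>"
    "\<And>x. R0 \<le> norm x \<Longrightarrow> \<bar>u x\<bar> \<le> K * (x \<bullet> x + 1) powr (- decay_exp)"
    using u_decay by metis
  obtain C where C: "C \<ge> 0" and
    cut: "\<forall>R>0. \<exists>(\<eta>::'a \<Rightarrow> real) \<eta>' \<kappa>' \<kappa>''. cutoff C R \<eta> \<eta>' \<kappa>' \<kappa>''"
    using cutoff_exists[where 'a='a] by blast
  define n where "n = DIM('a)"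
  define C' where "C' = K\<^sup>2 * C * (unit_ball_vol (real n) * 2 ^ n)"
  have ex: "\<exists>\<eta> \<eta>'. cc \<eta> \<and> (\<forall>x. norm x \<le> R \<longrightarrow> \<eta> x = 1) \<and>
    (\<forall>b\<in>Basis. has_pd \<eta> b (\<eta>' b) \<and> continuous_on UNIV (\<eta>' b)) \<and>
    (\<forall>b\<in>Basis. \<forall>x. norm x < R \<longrightarrow> \<eta>' b x = 0) \<and>
    (\<integral>x. (\<Sum>b\<in>Basis. (pd u b x)\<^sup>2) * (\<Sum>b\<in>Basis. (\<eta>' b x)\<^sup>2) \<partial>lborel) \<le> C' / R\<^sup>2"
    if R: "R \<ge> max R0 1" for R
  proof -
    have R1: "R \<ge> 1" "R \<ge> R0" "R > 0" using R by auto
    obtain \<eta> :: "'a \<Rightarrow> real" and \<eta>' \<kappa>' \<kappa>'' where "cutoff C R \<eta> \<eta>' \<kappa>' \<kappa>''"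
      using cut R1(3) by blast
    then have \<eta>: "cc \<eta>" "\<And>x. norm x \<le> R \<Longrightarrow> \<eta> x = 1"
      "\<And>b. b \<in> Basis \<Longrightarrow> has_pd \<eta> b (\<eta>' b)" "\<And>b. b \<in> Basis \<Longrightarrow> continuous_on UNIV (\<eta>' b)"
      and \<kappa>: "\<And>b. b \<in> Basis \<Longrightarrow> has_pd (\<lambda>x. \<Sum>a\<in>Basis. (\<eta>' a x)\<^sup>2) b (\<kappa>' b)"
        "\<And>b. b \<in> Basis \<Longrightarrow> continuous_on UNIV (\<kappa>' b)"
        "\<And>b. b \<in> Basis \<Longrightarrow> has_pd (\<kappa>' b) b (\<kappa>'' b)"
        "\<And>b. b \<in> Basis \<Longrightarrow> continuous_on UNIV (\<kappa>'' b)"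
      and out: "\<And>x. norm x < R \<or> 2 * R < norm x \<Longrightarrow> (\<Sum>a\<in>Basis. (\<eta>' a x)\<^sup>2) = 0"
        "\<And>x. norm x < R \<or> 2 * R < norm x \<Longrightarrow> (\<Sum>b\<in>Basis. \<kappa>'' b x) = 0"
      and bd: "\<And>x. \<bar>\<Sum>b\<in>Basis. \<kappa>'' b x\<bar> \<le> C / R ^ 4"
      unfolding cutoff_def by blast+
    let ?\<kappa> = "\<lambda>x. \<Sum>a\<in>Basis. (\<eta>' a x)\<^sup>2"
    have cc\<kappa>: "cc ?\<kappa>" using out(1) by (intro ccI[where R="2*R"] continuous_intros \<eta>) auto
    have "2 * (\<integral>x. (\<Sum>b\<in>Basis. (pd u b x)\<^sup>2) * ?\<kappa> x \<partial>lborel) \<le> (\<integral>x. (u x)\<^sup>2 * (\<Sum>b\<in>Basis. \<kappa>'' b x) \<partial>lborel)"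
    proof (rule energy_inequality[OF cc\<kappa> _ _ \<kappa>])
      show "\<bar>u x\<bar> < \<delta>" if "?\<kappa> x \<noteq> 0" for x
        using out(1)[of x] that R1 by (intro K(3)) force
    qed (auto intro: sum_nonneg)
    \<comment> \<open>On the annulus the decay bounds u^2 and scaling bounds the Laplacian of the
      weight; elsewhere that Laplacian vanishes.\<close>
    also have "\<dots> \<le> (\<integral>x. indicator (cball (0::'a) (2 * R)) x * (K\<^sup>2 * R powr (- 4 * decay_exp) * (C / R ^ 4)) \<partial>lborel)"
    proof (rule Bochner_Integration.integral_mono)
      show "integrable lborel (\<lambda>x. (u x)\<^sup>2 * (\<Sum>b\<in>Basis. \<kappa>'' b x))"
        using out(2) by (intro cc_integrable cc_mult(1) continuous_intros u ccI[where R="2*R"] \<kappa>) auto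
      show "integrable lborel (\<lambda>x::'a. indicator (cball 0 (2 * R)) x * (K\<^sup>2 * R powr (- 4 * decay_exp) * (C / R ^ 4)))"
        by (intro integrable_mult_left integrable_real_indicator emeasure_bounded_finite) auto
      fix x :: 'a
      show "(u x)\<^sup>2 * (\<Sum>b\<in>Basis. \<kappa>'' b x) \<le> indicator (cball 0 (2 * R)) x * (K\<^sup>2 * R powr (- 4 * decay_exp) * (C / R ^ 4))"
      proof (cases "norm x < R \<or> 2 * R < norm x")
        case True
        then show ?thesis using out(2)[OF True] C R1 by (simp add: zero_le_mult_iff)
      next
        case False
        have m: "decay_exp \<ge> 0" by (simp add: decay_exp_def)
        have "R\<^sup>2 \<le> (norm x)\<^sup>2" using False R1 by (intro power_mono) auto
        then have "R\<^sup>2 \<le> x \<bullet> x + 1" by (simp add: dot_square_norm)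
        then have "(x \<bullet> x + 1) powr (- decay_exp) \<le> (R\<^sup>2) powr (- decay_exp)"
          using R1 m by (intro powr_mono2') auto
        also have "(R\<^sup>2) powr (- decay_exp) = R powr (- 2 * decay_exp)"
          using R1 powr_powr[of R 2 "- decay_exp"] by (simp add: powr_numeral)
        finally have "\<bar>u x\<bar> \<le> K * R powr (- 2 * decay_exp)"
          using K(4)[of x] K(2) False R1 by (smt (verit) mult_left_mono)
        then have "\<bar>u x\<bar>\<^sup>2 \<le> (K * R powr (- 2 * decay_exp))\<^sup>2" by (intro power_mono) auto
        also have "\<dots> = K\<^sup>2 * R powr (- 4 * decay_exp)"
          by (simp add: power_mult_distrib power2_eq_square flip: powr_add)
        finally have "(u x)\<^sup>2 * \<bar>\<Sum>b\<in>Basis. \<kappa>'' b x\<bar> \<le> K\<^sup>2 * R powr (- 4 * decay_exp) * (C / R ^ 4)"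
          using bd[of x] by (intro mult_mono) auto
        moreover have "(u x)\<^sup>2 * (\<Sum>b\<in>Basis. \<kappa>'' b x) \<le> (u x)\<^sup>2 * \<bar>\<Sum>b\<in>Basis. \<kappa>'' b x\<bar>"
          by (intro mult_left_mono) auto
        ultimately show ?thesis using False by simp
      qed
    qed
    also have "\<dots> = measure lborel (cball (0::'a) (2 * R)) * (K\<^sup>2 * R powr (- 4 * decay_exp) * (C / R ^ 4))"
      by simp
    also have "\<dots> = C' * (R powr (- 4 * decay_exp) * R ^ n / R ^ 4)"
      using content_cball[of "2 * R" "0::'a"] R1 by (simp add: C'_def n_def power_mult_distrib)
    also have "\<dots> \<le> C' * (1 / R\<^sup>2)"
    proof (rule mult_left_mono)
      \<comment> \<open>The exponent N - 4 - 4 \<open>decay_exp\<close> is at most -2 by the choice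
        of \<open>decay_exp\<close>; \<open>R \<ge> 1\<close> makes powers monotone in the
        exponent.\<close>
      have "R powr (- 4 * decay_exp) * R ^ n / R ^ 4 = R powr (- 4 * decay_exp + real n - 4)"
        using R1 by (simp add: powr_add powr_diff powr_realpow powr_minus field_simps)
      also have "\<dots> \<le> R powr (- 2)"
        using R1 by (intro powr_mono) (auto simp: decay_exp_def n_def max_def field_simps)
      also have "\<dots> = 1 / R\<^sup>2" using R1 by (simp add: powr_minus powr_numeral divide_inverse)
      finally show "R powr (- 4 * decay_exp) * R ^ n / R ^ 4 \<le> 1 / R\<^sup>2" .
      show "0 \<le> C'" using C by (simp add: C'_def unit_ball_vol_nonneg)
    qed
    finally have main: "2 * (\<integral>x. (\<Sum>b\<in>Basis. (pd u b x)\<^sup>2) * ?\<kappa> x \<partial>lborel) \<le> C' / R\<^sup>2" by simp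
    have "0 \<le> (\<integral>x. (\<Sum>b\<in>Basis. (pd u b x)\<^sup>2) * ?\<kappa> x \<partial>lborel)"
      by (intro Bochner_Integration.integral_nonneg mult_nonneg_nonneg sum_nonneg) auto
    then have "(\<integral>x. (\<Sum>b\<in>Basis. (pd u b x)\<^sup>2) * ?\<kappa> x \<partial>lborel) \<le> C' / R\<^sup>2" using main by linarith
    moreover have "\<eta>' b x = 0" if "norm x < R" "b \<in> Basis" for b x
      using out(1)[of x] that by (simp add: sum_nonneg_eq_0_iff)
    ultimately show ?thesis using \<eta> by (intro exI[of _ \<eta>] exI[of _ \<eta>']) auto
  qed
  show ?thesis by (rule exI[of _ C'], rule exI[of _ "max R0 1"], intro conjI allI impI ex) auto
qed

end

section \<open>The positive part of a partial derivative\<close>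

text \<open>The positive part (s + |s|)/2 with |s| replaced by sqrt (s^2 + \<epsilon>^2).\<close>

definition smooth_pos :: "real \<Rightarrow> real \<Rightarrow> real" where
  "smooth_pos \<epsilon> s = (s + sqrt (s\<^sup>2 + \<epsilon>\<^sup>2)) / 2"

definition smooth_pos' :: "real \<Rightarrow> real \<Rightarrow> real" where
  "smooth_pos' \<epsilon> s = (1 + s / sqrt (s\<^sup>2 + \<epsilon>\<^sup>2)) / 2"

definition smooth_pos'' :: "real \<Rightarrow> real \<Rightarrow> real" where
  "smooth_pos'' \<epsilon> s = \<epsilon>\<^sup>2 / (2 * sqrt (s\<^sup>2 + \<epsilon>\<^sup>2) ^ 3)"

context
  fixes \<epsilon> :: real
  assumes eps: "\<epsilon> > 0"
begin

lemma smooth_pos_root_pos: "0 < s\<^sup>2 + \<epsilon>\<^sup>2" "0 < sqrt (s\<^sup>2 + \<epsilon>\<^sup>2)" "(sqrt (s\<^sup>2 + \<epsilon>\<^sup>2))\<^sup>2 = s\<^sup>2 + \<epsilon>\<^sup>2"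
proof -
  show "0 < s\<^sup>2 + \<epsilon>\<^sup>2" using eps by (simp add: add_nonneg_pos)
  then show "0 < sqrt (s\<^sup>2 + \<epsilon>\<^sup>2)" "(sqrt (s\<^sup>2 + \<epsilon>\<^sup>2))\<^sup>2 = s\<^sup>2 + \<epsilon>\<^sup>2" by simp_all
qed

lemma smooth_pos_root_deriv: "((\<lambda>s. sqrt (s\<^sup>2 + \<epsilon>\<^sup>2)) has_real_derivative s / sqrt (s\<^sup>2 + \<epsilon>\<^sup>2)) (at s)"
  using smooth_pos_root_pos[of s] by (auto intro!: derivative_eq_intros simp: field_simps)

lemma smooth_pos_deriv: "(smooth_pos \<epsilon> has_real_derivative smooth_pos' \<epsilon> s) (at s)"
  unfolding smooth_pos_def[abs_def] smooth_pos'_def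
  by (intro DERIV_cdivide DERIV_add DERIV_ident smooth_pos_root_deriv)

lemma smooth_pos'_deriv: "(smooth_pos' \<epsilon> has_real_derivative smooth_pos'' \<epsilon> s) (at s)"
proof -
  define r where "r = sqrt (s\<^sup>2 + \<epsilon>\<^sup>2)"
  have r: "r > 0" "r\<^sup>2 = s\<^sup>2 + \<epsilon>\<^sup>2" using smooth_pos_root_pos[of s] by (auto simp: r_def)
  have "(smooth_pos' \<epsilon> has_real_derivative (0 + (1 * r - s * (s / r)) / (r * r)) / 2) (at s)"
    unfolding smooth_pos'_def[abs_def] r_def
    by (intro DERIV_cdivide DERIV_add DERIV_const DERIV_divide DERIV_ident smooth_pos_root_deriv)
      (use smooth_pos_root_pos[of s] in auto)
  also have "(0 + (1 * r - s * (s / r)) / (r * r)) / 2 = \<epsilon>\<^sup>2 / (2 * r ^ 3)"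
  proof -
    have "r * r - s * s = \<epsilon>\<^sup>2" using r(2) by (simp add: power2_eq_square)
    then show ?thesis using r(1) by (simp add: field_simps eval_nat_numeral)
  qed
  finally show ?thesis by (simp add: smooth_pos''_def r_def)
qed

text \<open>Nonnegativity of \<open>smooth_pos''\<close> is convexity and will discard a term with
  |grad w|^2. The fourth bound measures the failure of homogeneity: s p' - p is zero for the
  positive part away from 0, and here it is -\<epsilon>^2 / (2 r) with r the square root.\<close>

lemma smooth_pos_bounds:
  shows "0 \<le> smooth_pos \<epsilon> s" "0 \<le> smooth_pos'' \<epsilon> s" "(smooth_pos \<epsilon> s)\<^sup>2 \<le> s\<^sup>2 + \<epsilon>\<^sup>2"
    "\<bar>(s * smooth_pos' \<epsilon> s - smooth_pos \<epsilon> s) * smooth_pos \<epsilon> s\<bar> \<le> \<epsilon>\<^sup>2"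
    "\<bar>smooth_pos \<epsilon> s - max 0 s\<bar> \<le> \<epsilon>"
proof -
  define r where "r = sqrt (s\<^sup>2 + \<epsilon>\<^sup>2)"
  have r: "r > 0" "r\<^sup>2 = s\<^sup>2 + \<epsilon>\<^sup>2" using smooth_pos_root_pos[of s] by (auto simp: r_def)
  have rs: "\<bar>s\<bar> \<le> r" using r by (simp add: r_def)
  have re: "r \<le> \<bar>s\<bar> + \<epsilon>"
  proof (rule power2_le_imp_le)
    show "r\<^sup>2 \<le> (\<bar>s\<bar> + \<epsilon>)\<^sup>2" unfolding r(2) using eps by (simp add: power2_sum)
  qed (use eps in auto)
  have P: "smooth_pos \<epsilon> s = (s + r) / 2" by (simp add: smooth_pos_def r_def)
  have P': "smooth_pos' \<epsilon> s = (1 + s / r) / 2" by (simp add: smooth_pos'_def r_def)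
  show P0: "0 \<le> smooth_pos \<epsilon> s" using P rs by simp
  have Pr: "smooth_pos \<epsilon> s \<le> r" using P rs by simp
  show "0 \<le> smooth_pos'' \<epsilon> s" using r by (simp add: smooth_pos''_def r_def[symmetric])
  show "(smooth_pos \<epsilon> s)\<^sup>2 \<le> s\<^sup>2 + \<epsilon>\<^sup>2" using power_mono[OF Pr P0, of 2] r by simp
  have rr: "r * r = s * s + \<epsilon>\<^sup>2" using r(2) by (simp add: power2_eq_square)
  have "s * smooth_pos' \<epsilon> s - smooth_pos \<epsilon> s = (s * s - r * r) / (2 * r)"
    unfolding P P' using r(1) by (simp add: field_simps)
  then have e: "s * smooth_pos' \<epsilon> s - smooth_pos \<epsilon> s = - (\<epsilon>\<^sup>2 / (2 * r))" unfolding rr by simp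
  have "\<bar>(s * smooth_pos' \<epsilon> s - smooth_pos \<epsilon> s) * smooth_pos \<epsilon> s\<bar> = \<epsilon>\<^sup>2 / (2 * r) * smooth_pos \<epsilon> s"
    unfolding e using P0 r(1) by (simp add: abs_mult)
  also have "\<dots> \<le> \<epsilon>\<^sup>2 / (2 * r) * r" using Pr r(1) by (intro mult_left_mono) auto
  also have "\<dots> \<le> \<epsilon>\<^sup>2" using r(1) by simp
  finally show "\<bar>(s * smooth_pos' \<epsilon> s - smooth_pos \<epsilon> s) * smooth_pos \<epsilon> s\<bar> \<le> \<epsilon>\<^sup>2" .
  show "\<bar>smooth_pos \<epsilon> s - max 0 s\<bar> \<le> \<epsilon>" using P rs re eps by (auto simp: max_def abs_if split: if_splits)
qed

lemma smooth_pos_continuous: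
  assumes "continuous_on UNIV w"
  shows "continuous_on UNIV (\<lambda>x. smooth_pos \<epsilon> (w x))" "continuous_on UNIV (\<lambda>x. smooth_pos' \<epsilon> (w x))"
    "continuous_on UNIV (\<lambda>x. smooth_pos'' \<epsilon> (w x))"
  unfolding smooth_pos_def smooth_pos'_def smooth_pos''_def
  using smooth_pos_root_pos(1) by (auto intro!: continuous_intros assms simp: less_imp_neq[symmetric])

end

lemma cc_integral_add: "cc g \<Longrightarrow> cc h \<Longrightarrow> (\<integral>x. g x + h x \<partial>lborel) = (\<integral>x. g x \<partial>lborel) + (\<integral>x. h x \<partial>lborel)"
  by (intro Bochner_Integration.integral_add cc_integrable)

lemma cc_integral_diff: "cc g \<Longrightarrow> cc h \<Longrightarrow> (\<integral>x. g x - h x \<partial>lborel) = (\<integral>x. g x \<partial>lborel) - (\<integral>x. h x \<partial>lborel)"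
  by (intro Bochner_Integration.integral_diff cc_integrable)

lemma cc_integral_mono: "cc g \<Longrightarrow> cc h \<Longrightarrow> (\<And>x. g x \<le> h x) \<Longrightarrow> (\<integral>x. g x \<partial>lborel) \<le> (\<integral>x. h x \<partial>lborel)"
  by (intro Bochner_Integration.integral_mono cc_integrable)

context stable_solution
begin

text \<open>Stability at p \<eta> + t \<zeta>, with p the regularised positive part of w =
  \<open>pd u e\<close>. As \<eta> = 1 wherever \<zeta> or its gradient is nonzero, the mixed terms
  do not see \<eta>. Subtracting the weak linearized equation leaves a quadratic polynomial in
  t.\<close>

lemma test_inequality:
  fixes \<eta> \<zeta> :: "'a \<Rightarrow> real" and t \<epsilon> :: real
  assumes e: "e \<in> Basis" and eps: "\<epsilon> > 0"
    and \<eta>: "cc \<eta>" "\<And>b. b \<in> Basis \<Longrightarrow> has_pd \<eta> b (\<eta>' b)" "\<And>b. b \<in> Basis \<Longrightarrow> continuous_on UNIV (\<eta>' b)"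
    and \<zeta>: "cc \<zeta>" "\<And>b. b \<in> Basis \<Longrightarrow> has_pd \<zeta> b (\<zeta>' b)" "\<And>b. b \<in> Basis \<Longrightarrow> continuous_on UNIV (\<zeta>' b)"
      "\<And>b. b \<in> Basis \<Longrightarrow> has_pd (\<zeta>' b) b (\<zeta>'' b)" "\<And>b. b \<in> Basis \<Longrightarrow> continuous_on UNIV (\<zeta>'' b)"
    and one: "\<And>x. \<zeta> x \<noteq> 0 \<Longrightarrow> \<eta> x = 1" "\<And>b x. b \<in> Basis \<Longrightarrow> \<zeta>' b x \<noteq> 0 \<Longrightarrow> \<eta> x = 1 \<and> (\<forall>c\<in>Basis. \<eta>' c x = 0)"
  shows "0 \<le> (\<integral>x. (pd u e x)\<^sup>2 * (\<Sum>b\<in>Basis. (\<eta>' b x)\<^sup>2) \<partial>lborel)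
    + \<epsilon>\<^sup>2 * (\<integral>x. (\<Sum>b\<in>Basis. (\<eta>' b x)\<^sup>2) + \<bar>deriv f (u x)\<bar> * (\<eta> x)\<^sup>2 \<partial>lborel)
    - 2 * t * (\<integral>x. smooth_pos \<epsilon> (pd u e x) * ((\<Sum>b\<in>Basis. \<zeta>'' b x) + deriv f (u x) * \<zeta> x) \<partial>lborel)
    + t\<^sup>2 * (\<integral>x. (\<Sum>b\<in>Basis. (\<zeta>' b x)\<^sup>2) - deriv f (u x) * (\<zeta> x)\<^sup>2 \<partial>lborel)"
proof -
  define w where "w = pd u e"
  define w' where "w' b = pd (pd u e) b" for b
  define V where "V x = deriv f (u x)" for x
  define p where "p x = smooth_pos \<epsilon> (w x)" for x
  define p1 where "p1 x = smooth_pos' \<epsilon> (w x)" for x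
  define p2 where "p2 x = smooth_pos'' \<epsilon> (w x)" for x
  have cw: "continuous_on UNIV w" and cw': "b \<in> Basis \<Longrightarrow> continuous_on UNIV (w' b)"
    and dw: "b \<in> Basis \<Longrightarrow> has_pd w b (w' b)" for b
    using u e by (auto simp: w_def w'_def)
  have cV: "continuous_on UNIV V" unfolding V_def[abs_def] by (rule V_cont)
  have cp: "continuous_on UNIV p" "continuous_on UNIV p1" "continuous_on UNIV p2"
    unfolding p_def[abs_def] p1_def[abs_def] p2_def[abs_def] by (intro smooth_pos_continuous[OF eps] cw)+
  have dp: "has_pd p b (\<lambda>x. p1 x * w' b x)" and dp1: "has_pd p1 b (\<lambda>x. p2 x * w' b x)" if "b \<in> Basis" for b
    unfolding p_def[abs_def] p1_def[abs_def] p2_def[abs_def]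
    by (intro has_pd_compose dw that smooth_pos_deriv[OF eps] smooth_pos'_deriv[OF eps])+
  have \<eta>': "cc (\<eta>' b)" if "b \<in> Basis" for b using has_pd_cc \<eta> that by blast
  have \<zeta>': "cc (\<zeta>' b)" if "b \<in> Basis" for b using has_pd_cc \<zeta> that by blast
  have \<zeta>'': "cc (\<zeta>'' b)" if "b \<in> Basis" for b using has_pd_cc[OF \<zeta>(4)] \<zeta>(5) \<zeta>' that by blast
  note c\<eta> = cc_continuous[OF \<eta>(1)] and c\<zeta> = cc_continuous[OF \<zeta>(1)]

  define \<phi>' where "\<phi>' b x = ((p1 x * w' b x) * \<eta> x + p x * \<eta>' b x) + t * \<zeta>' b x" for b x
  have Q: "0 \<le> (\<integral>x. (\<Sum>b\<in>Basis. (\<phi>' b x)\<^sup>2) - V x * (p x * \<eta> x + t * \<zeta> x)\<^sup>2 \<partial>lborel)"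
    unfolding V_def
  proof (rule stable_C1[OF stab V_cont])
    show "cc (\<lambda>x. p x * \<eta> x + t * \<zeta> x)" by (intro cc_add cc_mult(1) cc_cmult cp \<eta> \<zeta>)
    show "has_pd (\<lambda>x. p x * \<eta> x + t * \<zeta> x) b (\<phi>' b)" if "b \<in> Basis" for b
      unfolding \<phi>'_def[abs_def] by (intro has_pd_add has_pd_mult has_pd_cmult dp \<eta> \<zeta> that)
    show "continuous_on UNIV (\<phi>' b)" if "b \<in> Basis" for b
      unfolding \<phi>'_def[abs_def] by (intro continuous_intros cp cw' \<eta> c\<eta> \<zeta> that)
  qed

  \<comment> \<open>Gradient of p p' \<eta>^2. Testing the linearized equation with this function
    removes from the stability form both p'^2 \<eta>^2 |grad w|^2 and the cross term 2 p p' \<eta>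
    (grad w . grad \<eta>).\<close>
  define \<xi>' where "\<xi>' b x = ((p1 x * w' b x) * p1 x + p x * (p2 x * w' b x)) * (\<eta> x * \<eta> x) + (p x * p1 x) * (\<eta>' b x * \<eta> x + \<eta> x * \<eta>' b x)" for b x
  have \<xi>: "cc (\<lambda>x. (p x * p1 x) * (\<eta> x * \<eta> x))"
    "\<And>b. b \<in> Basis \<Longrightarrow> has_pd (\<lambda>x. (p x * p1 x) * (\<eta> x * \<eta> x)) b (\<xi>' b)"
    "\<And>b. b \<in> Basis \<Longrightarrow> continuous_on UNIV (\<xi>' b)"
    unfolding \<xi>'_def[abs_def]
    by (intro cc_mult(1) has_pd_mult dp dp1 continuous_intros cp cw' c\<eta> \<eta>; assumption)+
  have lin: "(\<integral>x. (\<Sum>b\<in>Basis. w' b x * \<xi>' b x) \<partial>lborel) = (\<integral>x. V x * w x * ((p x * p1 x) * (\<eta> x * \<eta> x)) \<partial>lborel)"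
    unfolding V_def w_def w'_def by (rule linearized_weak_eq[OF e \<xi>])
  have cc\<xi>: "cc (\<lambda>x. \<Sum>b\<in>Basis. w' b x * \<xi>' b x)"
    using has_pd_cc[OF \<xi>(2) \<xi>(1) \<xi>(3)] by (intro cc_sum cc_mult(1) cw') auto

  define S1 where "S1 x = (\<Sum>b\<in>Basis. (w' b x)\<^sup>2)" for x
  define S2 where "S2 x = (\<Sum>b\<in>Basis. w' b x * \<eta>' b x)" for x
  define S3 where "S3 x = (\<Sum>b\<in>Basis. (\<eta>' b x)\<^sup>2)" for x
  define S4 where "S4 x = (\<Sum>b\<in>Basis. w' b x * \<zeta>' b x)" for x
  define S6 where "S6 x = (\<Sum>b\<in>Basis. (\<zeta>' b x)\<^sup>2)" for x
  have S1n: "S1 x \<ge> 0" and S3n: "S3 x \<ge> 0" for x by (auto simp: S1_def S3_def intro: sum_nonneg)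
  have ccS3: "cc S3" unfolding S3_def[abs_def] power2_eq_square by (intro cc_sum cc_mult(1) \<eta> \<eta>') auto
  have ccS6: "cc S6" unfolding S6_def[abs_def] power2_eq_square by (intro cc_sum cc_mult(1) \<zeta> \<zeta>') auto
  have ccS4: "cc S4" unfolding S4_def[abs_def] by (intro cc_sum cc_mult(1) cw' \<zeta>') auto
  have cS1: "continuous_on UNIV S1" unfolding S1_def[abs_def] by (intro continuous_intros cw')
  \<comment> \<open>What survives at t = 0: the cost of the cutoff, a convexity term of favourable
    sign, and the homogeneity defect, of order \<epsilon>^2.\<close>
  define r where "r x = p x * p x * S3 x - (p x * p2 x * S1 x * \<eta> x) * \<eta> x + (V x * ((w x * p1 x - p x) * p x) * \<eta> x) * \<eta> x" for x
  have ccr: "cc r" unfolding r_def[abs_def]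
    by (intro cc_add cc_diff cc_mult(1) continuous_intros cp cw cV cS1 c\<eta> ccS3 \<eta>(1))
  define L where "L x = (\<Sum>b\<in>Basis. \<zeta>'' b x) + V x * \<zeta> x" for x

  have phi_sq: "(\<Sum>b\<in>Basis. (\<phi>' b x)\<^sup>2) = p1 x * p1 x * (\<eta> x * \<eta> x) * S1 x + 2 * (p x * p1 x * \<eta> x) * S2 x + p x * p x * S3 x
      + 2 * t * (p1 x * S4 x) + t\<^sup>2 * S6 x" for x
  proof -
    have "(\<phi>' b x)\<^sup>2 = p1 x * p1 x * (\<eta> x * \<eta> x) * (w' b x)\<^sup>2 + 2 * (p x * p1 x * \<eta> x) * (w' b x * \<eta>' b x) + p x * p x * (\<eta>' b x)\<^sup>2
      + 2 * t * (p1 x * (w' b x * \<zeta>' b x)) + t\<^sup>2 * (\<zeta>' b x)\<^sup>2" if b: "b \<in> Basis" for b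
    proof (cases "\<zeta>' b x = 0")
      case True
      then show ?thesis by (simp add: \<phi>'_def power2_eq_square algebra_simps)
    next
      case False
      then have "\<eta> x = 1" "\<eta>' b x = 0" using one(2)[OF b False] b by auto
      then show ?thesis by (simp add: \<phi>'_def power2_eq_square algebra_simps)
    qed
    then have "(\<Sum>b\<in>Basis. (\<phi>' b x)\<^sup>2) = (\<Sum>b\<in>Basis. p1 x * p1 x * (\<eta> x * \<eta> x) * (w' b x)\<^sup>2 + 2 * (p x * p1 x * \<eta> x) * (w' b x * \<eta>' b x) + p x * p x * (\<eta>' b x)\<^sup>2
      + 2 * t * (p1 x * (w' b x * \<zeta>' b x)) + t\<^sup>2 * (\<zeta>' b x)\<^sup>2)" by (rule sum.cong[OF refl])
    then show ?thesis by (simp add: S1_def S2_def S3_def S4_def S6_def sum.distrib sum_distrib_left)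
  qed
  have xi_sum: "(\<Sum>b\<in>Basis. w' b x * \<xi>' b x) = (p1 x * p1 x + p x * p2 x) * (\<eta> x * \<eta> x) * S1 x + 2 * (p x * p1 x * \<eta> x) * S2 x" for x
  proof -
    have "w' b x * \<xi>' b x = (p1 x * p1 x + p x * p2 x) * (\<eta> x * \<eta> x) * (w' b x)\<^sup>2 + 2 * (p x * p1 x * \<eta> x) * (w' b x * \<eta>' b x)" for b
      by (simp add: \<xi>'_def power2_eq_square algebra_simps)
    then show ?thesis by (simp add: S1_def S2_def sum.distrib sum_distrib_left)
  qed
  have zz: "\<eta> x * \<zeta> x = \<zeta> x" for x using one(1)[of x] by (cases "\<zeta> x = 0") auto
  have point: "(\<Sum>b\<in>Basis. (\<phi>' b x)\<^sup>2) - V x * (p x * \<eta> x + t * \<zeta> x)\<^sup>2 =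
     ((\<Sum>b\<in>Basis. w' b x * \<xi>' b x) - V x * w x * ((p x * p1 x) * (\<eta> x * \<eta> x))) +
     (r x + ((2 * t) * (p1 x * S4 x - (p x * V x) * \<zeta> x) + t\<^sup>2 * (S6 x - (V x * \<zeta> x) * \<zeta> x)))" for x
  proof -
    have "V x * (p x * \<eta> x + t * \<zeta> x)\<^sup>2 = V x * (p x * p x) * (\<eta> x * \<eta> x) + 2 * t * (p x * V x) * (\<eta> x * \<zeta> x) + t\<^sup>2 * (V x * \<zeta> x * \<zeta> x)"
      by (simp add: power2_eq_square algebra_simps)
    then show ?thesis unfolding zz phi_sq xi_sum r_def by (simp add: algebra_simps)
  qed
  have cc1: "cc (\<lambda>x. V x * w x * ((p x * p1 x) * (\<eta> x * \<eta> x)))"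
    by (intro cc_mult(1) continuous_intros cp c\<eta> cV cw \<eta>(1))
  have cc2: "cc (\<lambda>x. p1 x * S4 x - (p x * V x) * \<zeta> x)"
    by (intro cc_diff cc_mult(1) continuous_intros cp cV ccS4 \<zeta>(1))
  have cc3: "cc (\<lambda>x. S6 x - (V x * \<zeta> x) * \<zeta> x)"
    by (intro cc_diff cc_mult(1) continuous_intros c\<zeta> cV ccS6 \<zeta>(1))
  have "(\<integral>x. (\<Sum>b\<in>Basis. (\<phi>' b x)\<^sup>2) - V x * (p x * \<eta> x + t * \<zeta> x)\<^sup>2 \<partial>lborel) =
    ((\<integral>x. (\<Sum>b\<in>Basis. w' b x * \<xi>' b x) \<partial>lborel) - (\<integral>x. V x * w x * ((p x * p1 x) * (\<eta> x * \<eta> x)) \<partial>lborel)) +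
    ((\<integral>x. r x \<partial>lborel) + ((2 * t) * (\<integral>x. p1 x * S4 x - (p x * V x) * \<zeta> x \<partial>lborel) + t\<^sup>2 * (\<integral>x. S6 x - (V x * \<zeta> x) * \<zeta> x \<partial>lborel)))"
    unfolding point
    by (simp only: cc_integral_add cc_integral_diff[OF cc\<xi> cc1] cc_diff cc_add cc_cmult cc\<xi> cc1 cc2 cc3 ccr
        Bochner_Integration.integral_mult_right_zero)
  also have "\<dots> = (\<integral>x. r x \<partial>lborel) + ((2 * t) * (\<integral>x. p1 x * S4 x - (p x * V x) * \<zeta> x \<partial>lborel) + t\<^sup>2 * (\<integral>x. S6 x - (V x * \<zeta> x) * \<zeta> x \<partial>lborel))"
    unfolding lin by simp
  finally have main: "0 \<le> (\<integral>x. r x \<partial>lborel) + ((2 * t) * (\<integral>x. p1 x * S4 x - (p x * V x) * \<zeta> x \<partial>lborel) + t\<^sup>2 * (\<integral>x. S6 x - (V x * \<zeta> x) * \<zeta> x \<partial>lborel))"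
    using Q by simp

  \<comment> \<open>p' grad w is the gradient of p, so one more integration by parts leaves only p
    itself, which converges uniformly as \<epsilon> tends to 0.\<close>
  have "(\<integral>x. p1 x * S4 x - (p x * V x) * \<zeta> x \<partial>lborel) = - (\<integral>x. p x * L x \<partial>lborel)"
  proof -
    have "(\<integral>x. p1 x * S4 x \<partial>lborel) = (\<Sum>b\<in>Basis. \<integral>x. (p1 x * w' b x) * \<zeta>' b x \<partial>lborel)"
      unfolding S4_def sum_distrib_left mult.assoc[symmetric]
      by (intro Bochner_Integration.integral_sum cc_integrable cc_mult(1) continuous_intros cp cw' \<zeta>')
    also have "\<dots> = (\<Sum>b\<in>Basis. - (\<integral>x. p x * \<zeta>'' b x \<partial>lborel))"
    proof (rule sum.cong[OF refl])
      fix b :: 'a assume b: "b \<in> Basis"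
      show "(\<integral>x. (p1 x * w' b x) * \<zeta>' b x \<partial>lborel) = - (\<integral>x. p x * \<zeta>'' b x \<partial>lborel)"
        by (rule integration_by_parts_pd[OF dp[OF b] \<zeta>(4)[OF b] cp(1) _ \<zeta>'[OF b] \<zeta>(5)[OF b]])
          (intro continuous_intros cp cw' b)
    qed
    also have "\<dots> = - (\<integral>x. p x * (\<Sum>b\<in>Basis. \<zeta>'' b x) \<partial>lborel)"
      unfolding sum_negf sum_distrib_left
      by (subst Bochner_Integration.integral_sum) (auto intro!: cc_integrable cc_mult(1) cp \<zeta>'')
    finally have "(\<integral>x. p1 x * S4 x \<partial>lborel) = - (\<integral>x. p x * (\<Sum>b\<in>Basis. \<zeta>'' b x) \<partial>lborel)" .
    moreover have "(\<integral>x. p1 x * S4 x - (p x * V x) * \<zeta> x \<partial>lborel) = (\<integral>x. p1 x * S4 x \<partial>lborel) - (\<integral>x. (p x * V x) * \<zeta> x \<partial>lborel)"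
      by (intro cc_integral_diff cc_mult(1) continuous_intros cp cV ccS4 \<zeta>(1))
    moreover have "(\<integral>x. p x * L x \<partial>lborel) = (\<integral>x. p x * (\<Sum>b\<in>Basis. \<zeta>'' b x) \<partial>lborel) + (\<integral>x. (p x * V x) * \<zeta> x \<partial>lborel)"
      unfolding L_def distrib_left mult.assoc[symmetric]
      by (intro cc_integral_add cc_mult(1) continuous_intros cp cV \<zeta>(1) cc_sum \<zeta>'') auto
    ultimately show ?thesis by simp
  qed
  moreover have "(\<integral>x. r x \<partial>lborel) \<le> (\<integral>x. (w x)\<^sup>2 * S3 x \<partial>lborel) + \<epsilon>\<^sup>2 * (\<integral>x. S3 x + \<bar>V x\<bar> * (\<eta> x)\<^sup>2 \<partial>lborel)"
  proof -
    have cc4: "cc (\<lambda>x. (w x)\<^sup>2 * S3 x)" by (intro cc_mult(1) continuous_intros cw ccS3)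
    have cc5: "cc (\<lambda>x. S3 x + \<bar>V x\<bar> * (\<eta> x)\<^sup>2)"
      unfolding power2_eq_square by (intro cc_add cc_mult(1) continuous_intros cV c\<eta> \<eta>(1) ccS3)
    have "r x \<le> (w x)\<^sup>2 * S3 x + \<epsilon>\<^sup>2 * (S3 x + \<bar>V x\<bar> * (\<eta> x)\<^sup>2)" for x
    proof -
      note b = smooth_pos_bounds[OF eps, of "w x", folded p_def p1_def p2_def]
      have "p x * p x * S3 x \<le> ((w x)\<^sup>2 + \<epsilon>\<^sup>2) * S3 x"
        using b(3) S3n[of x] by (intro mult_right_mono) (simp_all add: power2_eq_square)
      moreover have "0 \<le> (p x * p2 x * S1 x * \<eta> x) * \<eta> x"
      proof -
        have "0 \<le> (p x * p2 x * S1 x) * (\<eta> x * \<eta> x)"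
          by (intro mult_nonneg_nonneg b S1n zero_le_square)
        then show ?thesis by (simp add: mult.assoc)
      qed
      moreover have "(V x * ((w x * p1 x - p x) * p x) * \<eta> x) * \<eta> x \<le> \<epsilon>\<^sup>2 * (\<bar>V x\<bar> * (\<eta> x)\<^sup>2)"
      proof -
        have "V x * ((w x * p1 x - p x) * p x) \<le> \<bar>V x\<bar> * \<bar>(w x * p1 x - p x) * p x\<bar>"
          by (metis abs_ge_self abs_mult)
        also have "\<dots> \<le> \<bar>V x\<bar> * \<epsilon>\<^sup>2" by (intro mult_left_mono b) auto
        finally have "V x * ((w x * p1 x - p x) * p x) * (\<eta> x)\<^sup>2 \<le> \<bar>V x\<bar> * \<epsilon>\<^sup>2 * (\<eta> x)\<^sup>2"
          by (intro mult_right_mono) auto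
        then show ?thesis by (simp add: power2_eq_square mult_ac)
      qed
      ultimately show ?thesis unfolding r_def by (simp add: algebra_simps)
    qed
    then have "(\<integral>x. r x \<partial>lborel) \<le> (\<integral>x. (w x)\<^sup>2 * S3 x + \<epsilon>\<^sup>2 * (S3 x + \<bar>V x\<bar> * (\<eta> x)\<^sup>2) \<partial>lborel)"
      by (intro cc_integral_mono ccr cc_add cc4 cc_cmult cc5)
    then show ?thesis using cc_integral_add[OF cc4 cc_cmult[OF cc5]] by simp
  qed
  moreover have "(\<integral>x. S6 x - (V x * \<zeta> x) * \<zeta> x \<partial>lborel) = (\<integral>x. S6 x - V x * (\<zeta> x)\<^sup>2 \<partial>lborel)"
    by (simp add: power2_eq_square mult.assoc)
  ultimately show ?thesis using main
    by (simp add: w_def V_def S3_def S6_def L_def p_def)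
qed

end

context stable_solution
begin

text \<open>The positive part of \<open>pd u e\<close> has zero energy, hence it minimises the stability form and
  satisfies the linearized equation weakly.\<close>

lemma positive_part_supersolution:
  fixes \<zeta> :: "'a \<Rightarrow> real"
  assumes e: "e \<in> Basis"
    and \<zeta>: "cc \<zeta>" "\<And>b. b \<in> Basis \<Longrightarrow> has_pd \<zeta> b (\<zeta>' b)" "\<And>b. b \<in> Basis \<Longrightarrow> continuous_on UNIV (\<zeta>' b)"
      "\<And>b. b \<in> Basis \<Longrightarrow> has_pd (\<zeta>' b) b (\<zeta>'' b)" "\<And>b. b \<in> Basis \<Longrightarrow> continuous_on UNIV (\<zeta>'' b)"
  shows "(\<integral>x. max 0 (pd u e x) * ((\<Sum>b\<in>Basis. \<zeta>'' b x) + deriv f (u x) * \<zeta> x) \<partial>lborel) \<le> 0"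
proof -
  define L where "L x = (\<Sum>b\<in>Basis. \<zeta>'' b x) + deriv f (u x) * \<zeta> x" for x
  define J where "J = (\<integral>x. max 0 (pd u e x) * L x \<partial>lborel)"
  define D where "D = (\<integral>x. (\<Sum>b\<in>Basis. (\<zeta>' b x)\<^sup>2) - deriv f (u x) * (\<zeta> x)\<^sup>2 \<partial>lborel)"
  have \<zeta>': "cc (\<zeta>' b)" if "b \<in> Basis" for b using has_pd_cc \<zeta> that by blast
  have \<zeta>'': "cc (\<zeta>'' b)" if "b \<in> Basis" for b using has_pd_cc[OF \<zeta>(4)] \<zeta>(5) \<zeta>' that by blast
  have ccL: "cc L" unfolding L_def[abs_def] by (intro cc_add cc_sum \<zeta>'' cc_mult(1) V_cont \<zeta>(1)) auto
  have ccAL: "cc (\<lambda>x. \<bar>L x\<bar>)" using ccL by (auto simp: cc_def intro!: continuous_intros)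
  define A where "A = (\<integral>x. \<bar>L x\<bar> \<partial>lborel)"
  obtain R2 where R2: "\<And>x. R2 < norm x \<Longrightarrow> \<zeta> x = 0" using \<zeta>(1) by (auto simp: cc_def)
  obtain C R1 where R1: "0 < R1" and cut: "\<And>R. R \<ge> R1 \<Longrightarrow> \<exists>\<eta> \<eta>'. cc \<eta> \<and> (\<forall>x. norm x \<le> R \<longrightarrow> \<eta> x = 1) \<and>
    (\<forall>b\<in>Basis. has_pd \<eta> b (\<eta>' b) \<and> continuous_on UNIV (\<eta>' b)) \<and>
    (\<forall>b\<in>Basis. \<forall>x. norm x < R \<longrightarrow> \<eta>' b x = 0) \<and>
    (\<integral>x. (\<Sum>b\<in>Basis. (pd u b x)\<^sup>2) * (\<Sum>b\<in>Basis. (\<eta>' b x)\<^sup>2) \<partial>lborel) \<le> C / R\<^sup>2"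
    using cutoff_energy by blast
  note cw = u(3)[OF e]
  \<comment> \<open>\<epsilon> tends to 0 first, with \<open>R\<close> and \<open>t\<close> fixed,
    because the coefficient \<open>K\<close> of \<epsilon>^2 may grow with \<open>R\<close>.\<close>
  have step1: "0 \<le> C / R\<^sup>2 - 2 * t * J + t\<^sup>2 * D" if R: "R \<ge> R1" "R > R2" and t: "t > 0" for R t
  proof -
    obtain \<eta> \<eta>' where \<eta>: "cc \<eta>" "\<And>x. norm x \<le> R \<Longrightarrow> \<eta> x = 1"
      "\<And>b. b \<in> Basis \<Longrightarrow> has_pd \<eta> b (\<eta>' b)" "\<And>b. b \<in> Basis \<Longrightarrow> continuous_on UNIV (\<eta>' b)"
      "\<And>b x. b \<in> Basis \<Longrightarrow> norm x < R \<Longrightarrow> \<eta>' b x = 0"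
      "(\<integral>x. (\<Sum>b\<in>Basis. (pd u b x)\<^sup>2) * (\<Sum>b\<in>Basis. (\<eta>' b x)\<^sup>2) \<partial>lborel) \<le> C / R\<^sup>2"
      using cut[OF R(1)] by blast
    have \<eta>': "cc (\<eta>' b)" if "b \<in> Basis" for b using has_pd_cc \<eta> that by blast
    have ccS: "cc (\<lambda>x. \<Sum>b\<in>Basis. (\<eta>' b x)\<^sup>2)"
      unfolding power2_eq_square by (intro cc_sum cc_mult(1) \<eta> \<eta>') auto
    have "(\<integral>x. (pd u e x)\<^sup>2 * (\<Sum>b\<in>Basis. (\<eta>' b x)\<^sup>2) \<partial>lborel) \<le> (\<integral>x. (\<Sum>b\<in>Basis. (pd u b x)\<^sup>2) * (\<Sum>b\<in>Basis. (\<eta>' b x)\<^sup>2) \<partial>lborel)"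
    proof (rule cc_integral_mono)
      show "(pd u e x)\<^sup>2 * (\<Sum>b\<in>Basis. (\<eta>' b x)\<^sup>2) \<le> (\<Sum>b\<in>Basis. (pd u b x)\<^sup>2) * (\<Sum>b\<in>Basis. (\<eta>' b x)\<^sup>2)" for x
        by (intro mult_right_mono sum_nonneg member_le_sum[OF e]) auto
    qed (intro cc_mult(1) continuous_intros u e ccS)+
    then have en: "(\<integral>x. (pd u e x)\<^sup>2 * (\<Sum>b\<in>Basis. (\<eta>' b x)\<^sup>2) \<partial>lborel) \<le> C / R\<^sup>2" using \<eta>(6) by linarith
    define K where "K = (\<integral>x. (\<Sum>b\<in>Basis. (\<eta>' b x)\<^sup>2) + \<bar>deriv f (u x)\<bar> * (\<eta> x)\<^sup>2 \<partial>lborel)"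
    have inside: "norm x < R" if "\<zeta> x \<noteq> 0" for x using that R2[of x] R(2) by (cases "R2 < norm x") auto
    have inside': "norm x < R" if "\<zeta>' b x \<noteq> 0" "b \<in> Basis" for x b
    proof (rule ccontr)
      assume "\<not> norm x < R"
      then have "R2 < norm x" using R(2) by linarith
      then show False using has_pd_zero_outside[OF \<zeta>(2)[OF that(2)] R2] that(1) by blast
    qed
    \<comment> \<open>The term \<open>\<epsilon> * A\<close> bounds the change when
      \<open>smooth_pos\<close> is replaced by the positive part in the linear term.\<close>
    have ineq: "0 \<le> C / R\<^sup>2 + \<epsilon>\<^sup>2 * K - 2 * t * (J - \<epsilon> * A) + t\<^sup>2 * D" if eps: "\<epsilon> > 0" for \<epsilon>
    proof -
      have "J - \<epsilon> * A = (\<integral>x. max 0 (pd u e x) * L x - \<epsilon> * \<bar>L x\<bar> \<partial>lborel)"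
        unfolding J_def A_def
        by (subst cc_integral_diff) (auto intro!: cc_mult(1) continuous_intros cw ccL cc_cmult ccAL)
      also have "\<dots> \<le> (\<integral>x. smooth_pos \<epsilon> (pd u e x) * L x \<partial>lborel)"
      proof (rule cc_integral_mono)
        show "cc (\<lambda>x. max 0 (pd u e x) * L x - \<epsilon> * \<bar>L x\<bar>)"
          by (intro cc_diff cc_mult(1) continuous_intros cw ccL cc_cmult ccAL)
        show "cc (\<lambda>x. smooth_pos \<epsilon> (pd u e x) * L x)"
          by (intro cc_mult(1) smooth_pos_continuous[OF eps] cw ccL)
        fix x
        have "\<bar>(max 0 (pd u e x) - smooth_pos \<epsilon> (pd u e x)) * L x\<bar> \<le> \<epsilon> * \<bar>L x\<bar>"
          unfolding abs_mult using smooth_pos_bounds(5)[OF eps, of "pd u e x"]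
          by (intro mult_right_mono) (auto simp: abs_minus_commute)
        then show "max 0 (pd u e x) * L x - \<epsilon> * \<bar>L x\<bar> \<le> smooth_pos \<epsilon> (pd u e x) * L x"
          by (simp add: left_diff_distrib)
      qed
      finally have "t * (J - \<epsilon> * A) \<le> t * (\<integral>x. smooth_pos \<epsilon> (pd u e x) * L x \<partial>lborel)"
        using t by (intro mult_left_mono) auto
      moreover have "0 \<le> (\<integral>x. (pd u e x)\<^sup>2 * (\<Sum>b\<in>Basis. (\<eta>' b x)\<^sup>2) \<partial>lborel) + \<epsilon>\<^sup>2 * K
          - 2 * t * (\<integral>x. smooth_pos \<epsilon> (pd u e x) * L x \<partial>lborel) + t\<^sup>2 * D"
        unfolding K_def L_def D_def
        by (rule test_inequality[OF e eps \<eta>(1,3,4) \<zeta>]) (use \<eta>(2,5) inside inside' in \<open>auto simp: less_imp_le\<close>)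
      ultimately show ?thesis using en by linarith
    qed
    have "((\<lambda>\<epsilon>. C / R\<^sup>2 + \<epsilon>\<^sup>2 * K - 2 * t * (J - \<epsilon> * A) + t\<^sup>2 * D) \<longlongrightarrow> C / R\<^sup>2 + 0\<^sup>2 * K - 2 * t * (J - 0 * A) + t\<^sup>2 * D) (at_right 0)"
      by (intro tendsto_intros)
    moreover have "\<forall>\<^sub>F \<epsilon> in at_right 0. 0 \<le> C / R\<^sup>2 + \<epsilon>\<^sup>2 * K - 2 * t * (J - \<epsilon> * A) + t\<^sup>2 * D"
      using ineq by (auto simp: eventually_at_right_field intro: exI[of _ 1])
    ultimately have "0 \<le> C / R\<^sup>2 + 0\<^sup>2 * K - 2 * t * (J - 0 * A) + t\<^sup>2 * D"
      by (rule tendsto_lowerbound) simp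
    then show ?thesis by simp
  qed
  \<comment> \<open>Now \<open>R\<close> tends to infinity and the inequality is divided by
    \<open>t\<close>, so that the linear coefficient \<open>J\<close> is isolated when
    \<open>t\<close> tends to 0.\<close>
  have step2: "0 \<le> t * D - 2 * J" if t: "t > 0" for t
  proof -
    have "((\<lambda>R::real. C * (inverse R)\<^sup>2 - 2 * t * J + t\<^sup>2 * D) \<longlongrightarrow> C * 0\<^sup>2 - 2 * t * J + t\<^sup>2 * D) at_top"
      by (intro tendsto_intros tendsto_inverse_0_at_top filterlim_ident)
    moreover have "\<forall>\<^sub>F R in at_top. 0 \<le> C * (inverse R)\<^sup>2 - 2 * t * J + t\<^sup>2 * D"
      using eventually_ge_at_top[of R1] eventually_gt_at_top[of R2]
      by eventually_elim (use step1[OF _ _ t] in \<open>simp add: field_simps\<close>)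
    ultimately have "0 \<le> C * 0\<^sup>2 - 2 * t * J + t\<^sup>2 * D" by (rule tendsto_lowerbound) simp
    then have "0 \<le> t * (t * D - 2 * J)" by (simp add: power2_eq_square algebra_simps)
    then show ?thesis using t by (simp add: zero_le_mult_iff)
  qed
  have "((\<lambda>t. t * D - 2 * J) \<longlongrightarrow> 0 * D - 2 * J) (at_right 0)" by (intro tendsto_intros)
  moreover have "\<forall>\<^sub>F t in at_right 0. 0 \<le> t * D - 2 * J"
    using step2 by (auto simp: eventually_at_right_field intro: exI[of _ 1])
  ultimately have "0 \<le> 0 * D - 2 * J" by (rule tendsto_lowerbound) simp
  then show ?thesis by (simp add: J_def L_def)
qed

end

section \<open>Strong maximum principle\<close>

text \<open>The increment from \<open>x0\<close> to \<open>x\<close> is taken one coordinate at a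
  time, with the mean value theorem on each segment.\<close>

lemma has_pd_local_lipschitz:
  fixes w :: "'a::euclidean_space \<Rightarrow> real"
  assumes dw: "\<And>b. b \<in> Basis \<Longrightarrow> has_pd w b (w' b)" and cw': "\<And>b. b \<in> Basis \<Longrightarrow> continuous_on UNIV (w' b)"
  shows "\<exists>M\<ge>0. \<forall>x. norm (x - x0) \<le> 1 \<longrightarrow> \<bar>w x - w x0\<bar> \<le> M * norm (x - x0)"
proof -
  define n where "n = real DIM('a)"
  define h where "h x = (\<Sum>b\<in>Basis. \<bar>w' b x\<bar>)" for x
  \<comment> \<open>The points of the coordinate path lie within the l^1 norm of
    \<open>x - x0\<close>, which is at most \<open>n\<close> when
    \<open>norm (x - x0) \<le> 1\<close>.\<close>
  have "compact (h ` cball x0 n)"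
    unfolding h_def by (intro compact_continuous_image continuous_intros continuous_on_subset[OF cw']) auto
  from compact_imp_bounded[OF this] obtain M where "\<forall>y\<in>h ` cball x0 n. norm y \<le> M"
    unfolding bounded_iff by blast
  then have hM: "\<bar>h x\<bar> \<le> M" if "x \<in> cball x0 n" for x using that by simp
  have n0: "n \<ge> 0" by (simp add: n_def)
  then have M0: "M \<ge> 0" using hM[of x0] by simp
  have bnd: "\<bar>w' b x\<bar> \<le> M" if "b \<in> Basis" "norm (x - x0) \<le> n" for b x
  proof -
    have "\<bar>w' b x\<bar> \<le> h x" unfolding h_def by (intro member_le_sum that) auto
    then show ?thesis using hM[of x] that(2) by (simp add: dist_norm norm_minus_commute)
  qed
  have "\<bar>w x - w x0\<bar> \<le> (M * n) * norm (x - x0)" if x: "norm (x - x0) \<le> 1" for x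
  proof -
    define y where "y = x - x0"
    have tot: "(\<Sum>b\<in>Basis. \<bar>y \<bullet> b\<bar>) \<le> n * norm y"
      using sum_bounded_above[of Basis "\<lambda>b. \<bar>y \<bullet> b\<bar>" "norm y"] Basis_le_norm[of _ y] by (simp add: n_def)
    have "\<bar>w (x0 + (\<Sum>b\<in>B. (y \<bullet> b) *\<^sub>R b)) - w x0\<bar> \<le> M * (\<Sum>b\<in>B. \<bar>y \<bullet> b\<bar>)" if "finite B" "B \<subseteq> Basis" for B
      using that
    proof (induction B rule: finite_induct)
      case (insert b B)
      then have b: "b \<in> Basis" and BB: "B \<subseteq> Basis" by auto
      define z where "z = x0 + (\<Sum>b\<in>B. (y \<bullet> b) *\<^sub>R b)"
      define F where "F t = w (z + (t * (y \<bullet> b)) *\<^sub>R b)" for t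
      have "(F has_real_derivative w' b (z + (t * (y \<bullet> b)) *\<^sub>R b) * (y \<bullet> b)) (at t)" for t
        unfolding F_def by (rule DERIV_chain2[OF has_pd_line[OF dw[OF b]]]) (auto intro!: derivative_eq_intros)
      then obtain t where t: "0 < t" "t < 1" "F 1 - F 0 = (1 - 0) * (w' b (z + (t * (y \<bullet> b)) *\<^sub>R b) * (y \<bullet> b))"
        using MVT2[of 0 1 F "\<lambda>t. w' b (z + (t * (y \<bullet> b)) *\<^sub>R b) * (y \<bullet> b)"] by force
      have "norm ((z + (t * (y \<bullet> b)) *\<^sub>R b) - x0) \<le> norm (\<Sum>b\<in>B. (y \<bullet> b) *\<^sub>R b) + norm ((t * (y \<bullet> b)) *\<^sub>R b)"
      proof -
        have eq: "(z + (t * (y \<bullet> b)) *\<^sub>R b) - x0 = (\<Sum>b\<in>B. (y \<bullet> b) *\<^sub>R b) + (t * (y \<bullet> b)) *\<^sub>R b"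
          by (simp add: z_def)
        show ?thesis unfolding eq by (rule norm_triangle_ineq)
      qed
      also have "\<dots> \<le> (\<Sum>b\<in>B. \<bar>y \<bullet> b\<bar>) + \<bar>y \<bullet> b\<bar>"
      proof (rule add_mono)
        show "norm (\<Sum>b\<in>B. (y \<bullet> b) *\<^sub>R b) \<le> (\<Sum>b\<in>B. \<bar>y \<bullet> b\<bar>)"
          using BB by (intro sum_norm_le) auto
        show "norm ((t * (y \<bullet> b)) *\<^sub>R b) \<le> \<bar>y \<bullet> b\<bar>" using t b by (simp add: abs_mult mult_left_le_one_le)
      qed
      also have "\<dots> = (\<Sum>b\<in>insert b B. \<bar>y \<bullet> b\<bar>)" using insert by simp
      also have "\<dots> \<le> (\<Sum>b\<in>Basis. \<bar>y \<bullet> b\<bar>)" using insert.prems by (intro sum_mono2) auto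
      also have "\<dots> \<le> n" using tot x n0 mult_left_mono[of "norm y" 1 n] by (simp add: y_def)
      finally have "\<bar>w' b (z + (t * (y \<bullet> b)) *\<^sub>R b)\<bar> \<le> M" using bnd[OF b] by blast
      then have "\<bar>F 1 - F 0\<bar> \<le> M * \<bar>y \<bullet> b\<bar>" unfolding t(3) by (simp add: abs_mult mult_right_mono)
      moreover have "\<bar>F 0 - w x0\<bar> \<le> M * (\<Sum>b\<in>B. \<bar>y \<bullet> b\<bar>)" using insert.IH BB by (simp add: F_def z_def)
      moreover have "F 1 = w (x0 + (\<Sum>b\<in>insert b B. (y \<bullet> b) *\<^sub>R b))" using insert by (simp add: F_def z_def algebra_simps)
      ultimately show ?case using insert by (simp add: algebra_simps)
    qed simp
    from this[of Basis] have "\<bar>w x - w x0\<bar> \<le> M * (\<Sum>b\<in>Basis. \<bar>y \<bullet> b\<bar>)"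
      by (simp add: euclidean_representation y_def)
    also have "\<dots> \<le> M * (n * norm y)" using M0 tot by (intro mult_left_mono)
    finally show ?thesis by (simp add: y_def mult.assoc)
  qed
  then show ?thesis using M0 n0 by (intro exI[of _ "M * n"]) auto
qed

text \<open>\<open>g\<close> is the integral of s^(-q) (R - s)_+^2 from \<rho> to R: the power
  creates the singularity at 0, and the squared factor makes \<open>g\<close> C^2 across R. The
  integrand decreases up to R, so the integral is at most R times its value at \<rho>.\<close>

lemma barrier_exists:
  fixes \<sigma> R q :: real
  assumes "0 < \<sigma>" "\<sigma> < R" "0 < q"
  shows "\<exists>g. (\<forall>\<rho>\<ge>\<sigma>. (g has_real_derivative - (\<rho> powr (- q) * (max 0 (R - \<rho>))\<^sup>2)) (at \<rho>)) \<and>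
    (\<forall>\<rho>\<ge>R. g \<rho> = 0) \<and> (\<forall>\<rho>\<ge>\<sigma>. 0 \<le> g \<rho> \<and> g \<rho> \<le> \<rho> powr (- q) * (max 0 (R - \<rho>))\<^sup>2 * R)"
proof -
  define k where "k \<rho> = \<rho> powr (- q) * (max 0 (R - \<rho>))\<^sup>2" for \<rho>
  \<comment> \<open>The lower endpoint \<sigma>/2 leaves room for a two-sided derivative at
    \<sigma>.\<close>
  have ck: "continuous_on {\<sigma>/2..} k"
    unfolding k_def using assms by (intro continuous_intros) auto
  define g where "g \<rho> = integral {\<sigma>/2..R} k - integral {\<sigma>/2..\<rho>} k" for \<rho>
  have dg: "(g has_real_derivative - k \<rho>) (at \<rho>)" if "\<rho> \<ge> \<sigma>" for \<rho>
  proof -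
    have "(g has_real_derivative 0 - k \<rho>) (at \<rho>)"
      unfolding g_def[abs_def] using that assms by (intro DERIV_diff DERIV_const DERIV_integral_upper[OF ck]) auto
    then show ?thesis by simp
  qed
  have g0: "g \<rho> = 0" if "\<rho> \<ge> R" for \<rho>
  proof -
    have "integral {\<sigma>/2..R} k + integral {R..\<rho>} k = integral {\<sigma>/2..\<rho>} k"
      using that assms by (intro Henstock_Kurzweil_Integration.integral_combine integrable_continuous_real continuous_on_subset[OF ck]) auto
    moreover have "integral {R..\<rho>} k = integral {R..\<rho>} (\<lambda>_. 0)"
      by (rule Henstock_Kurzweil_Integration.integral_cong) (auto simp: k_def)
    ultimately show ?thesis by (simp add: g_def)
  qed
  have "0 \<le> g \<rho> \<and> g \<rho> \<le> k \<rho> * R" if \<rho>: "\<rho> \<ge> \<sigma>" for \<rho>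
  proof (cases "\<rho> \<ge> R")
    case True
    then show ?thesis using g0 assms by (simp add: k_def)
  next
    case False
    then obtain z where z: "\<rho> < z" "z < R" "g R - g \<rho> = (R - \<rho>) * (- k z)"
      using MVT2[of \<rho> R g "\<lambda>\<rho>. - k \<rho>"] dg \<rho> by force
    then have gz: "g \<rho> = (R - \<rho>) * k z" using g0[of R] by simp
    have kz: "0 \<le> k z" by (simp add: k_def)
    have "k z \<le> k \<rho>" unfolding k_def
      using z \<rho> assms by (intro mult_mono powr_mono2' power_mono) auto
    then have "g \<rho> \<le> R * k \<rho>" unfolding gz using \<rho> assms z kz False by (intro mult_mono) auto
    then show ?thesis using gz kz False by (simp add: mult.commute)
  qed
  then show ?thesis using dg g0 unfolding k_def by blast
qed

text \<open>\<open>d\<close> is |x - x0|^2, and at \<rho> = d + \<sigma> \<open>T\<close> is (R -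
  \<rho>)_+ and \<open>P\<close> is \<rho>^(-q). The choice of \<open>q\<close> leaves a surplus of
  1 over the 2N that comes from g'; half of it is lost to the offset \<sigma> and a quarter to the
  potential.\<close>

lemma barrier_laplacian_bound:
  fixes N c R d \<sigma> T P g V q G2 :: real
  assumes N: "N \<ge> 1" and c: "c > 0" "c * R \<le> 1 / 4" and d: "d \<ge> 0" and \<sigma>: "\<sigma> > 0" and T: "T \<ge> 0" and P: "P \<ge> 0"
    and q: "4 * q = 2 * N + 1"
    and G2: "G2 \<ge> q * (P / (d + \<sigma>)) * T\<^sup>2"
    and g: "0 \<le> g" "g \<le> P * T\<^sup>2 * R" and V: "\<bar>V\<bar> \<le> c"
  shows "4 * d * G2 + 2 * N * (- (P * T\<^sup>2)) + V * g \<ge> - (P * T\<^sup>2) * (2 * N + 1)"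
    and "d \<ge> (4 * N + 1) * \<sigma> \<Longrightarrow> 4 * d * G2 + 2 * N * (- (P * T\<^sup>2)) + V * g \<ge> P * T\<^sup>2 / 4"
proof -
  define Y where "Y = P * T\<^sup>2"
  have Y: "Y \<ge> 0" using P by (simp add: Y_def)
  have rho: "d + \<sigma> > 0" using d \<sigma> by simp
  have "- (c * g) \<le> V * g" using V g(1) mult_right_mono[of "-c" V g] by auto
  moreover have "c * g \<le> c * (Y * R)" using g(2) c by (simp add: Y_def)
  moreover have "c * (Y * R) \<le> Y * (1 / 4)" using mult_left_mono[OF c(2) Y] by (simp add: mult_ac)
  ultimately have 1: "V * g \<ge> - (Y / 4)" by simp
  have "4 * d * G2 \<ge> 4 * d * (q * (P / (d + \<sigma>)) * T\<^sup>2)" using G2 d by (intro mult_left_mono) auto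
  also have "4 * d * (q * (P / (d + \<sigma>)) * T\<^sup>2) = (2 * N + 1) * (d / (d + \<sigma>)) * Y"
    unfolding q[symmetric] Y_def by simp
  finally have 2: "4 * d * G2 \<ge> (2 * N + 1) * (d / (d + \<sigma>)) * Y" .
  have "0 \<le> (2 * N + 1) * (d / (d + \<sigma>)) * Y" using N d rho Y by (intro mult_nonneg_nonneg) auto
  then show "4 * d * G2 + 2 * N * (- (P * T\<^sup>2)) + V * g \<ge> - (P * T\<^sup>2) * (2 * N + 1)"
    using 1 2 Y unfolding Y_def[symmetric] by (simp add: algebra_simps)
  assume large: "d \<ge> (4 * N + 1) * \<sigma>"
  \<comment> \<open>Equality holds at the threshold, where d / (d + \<sigma>) = (4N + 1) / (4N +
    2).\<close>
  have "(2 * N + 1) * (d / (d + \<sigma>)) \<ge> 2 * N + 1 / 2"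
    using rho large by (simp add: field_simps)
  then have "(2 * N + 1) * (d / (d + \<sigma>)) * Y \<ge> (2 * N + 1 / 2) * Y" using Y by (rule mult_right_mono)
  then show "4 * d * G2 + 2 * N * (- (P * T\<^sup>2)) + V * g \<ge> P * T\<^sup>2 / 4"
    using 1 2 unfolding Y_def[symmetric] by (simp add: algebra_simps)
qed

context stable_solution
begin

lemma V_bounded: "\<exists>c>0. \<forall>x. \<bar>deriv f (u x)\<bar> \<le> c"
proof -
  have "\<exists>B. \<forall>x. \<bar>u x\<bar> \<le> B"
  proof -
    obtain R0 where R0: "\<And>x. R0 \<le> norm x \<Longrightarrow> \<bar>u x\<bar> < \<delta>" using small_outside by blast
    have "compact (u ` cball 0 R0)"
      by (intro compact_continuous_image continuous_on_subset[OF u(1)]) auto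
    from compact_imp_bounded[OF this] obtain M where "\<forall>y\<in>u ` cball 0 R0. norm y \<le> M"
      unfolding bounded_iff by blast
    then have M: "\<bar>u x\<bar> \<le> M" if "norm x \<le> R0" for x using that by simp
    have "\<bar>u x\<bar> \<le> max M \<delta>" for x
      using M[of x] R0[of x] by (cases "norm x \<le> R0") (auto simp: le_max_iff_disj)
    then show ?thesis by blast
  qed
  then obtain B where B: "\<And>x. \<bar>u x\<bar> \<le> B" by blast
  have "compact (deriv f ` {-B..B})"
    by (intro compact_continuous_image continuous_on_subset[OF f'_cont]) auto
  from compact_imp_bounded[OF this] obtain M where "\<forall>y\<in>deriv f ` {-B..B}. norm y \<le> M"
    unfolding bounded_iff by blast
  then have "\<bar>deriv f (u x)\<bar> \<le> M" for x using B[of x] by (simp add: abs_le_iff)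
  then have "\<bar>deriv f (u x)\<bar> \<le> max M 1" for x by (simp add: le_max_iff_disj)
  then show ?thesis by (intro exI[of _ "max M 1"]) auto
qed

text \<open>Strong maximum principle in weak form: test with a regularisation at scale \<open>\<surd>\<sigma>\<close> of a
  compactly supported radial function that behaves like \<open>\<bar>x - x0\<bar> powr (3/2 - N)\<close> at \<open>x0\<close>.
  It is slightly more singular than the Green function, so \<open>\<Delta> + V\<close> of it is positive away from
  \<open>x0\<close>; the negative part sits in a ball of radius \<open>O(\<surd>\<sigma>)\<close> and is compensated by the linear
  vanishing of the positive part of \<open>pd u e\<close> at \<open>x0\<close>.\<close>

lemma pd_nonpos_ball:
  assumes e: "e \<in> Basis" and c: "c > 0" "\<And>x. \<bar>deriv f (u x)\<bar> \<le> c" "c * R \<le> 1 / 4" and R: "R > 0"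
    and x0: "pd u e x0 \<le> 0" and x1: "(x1 - x0) \<bullet> (x1 - x0) < R"
  shows "pd u e x1 \<le> 0"
proof (rule ccontr)
  assume "\<not> pd u e x1 \<le> 0"
  then have w1: "pd u e x1 > 0" by simp
  define w where "w = pd u e"
  define W where "W x = max 0 (w x)" for x
  define m where "m = w x1 / 2"
  have m: "m > 0" using w1 by (simp add: m_def w_def)
  have cw: "continuous_on UNIV w" unfolding w_def by (rule u(3)[OF e])
  define dd where "dd x = (x - x0) \<bullet> (x - x0)" for x
  have cdd: "continuous_on UNIV dd" unfolding dd_def by (intro continuous_intros)
  have dd0: "dd x \<ge> 0" for x by (simp add: dd_def)
  have "x1 \<noteq> x0" using w1 x0 by auto
  then have a: "dd x1 > 0" by (simp add: dd_def)
  \<comment> \<open>\<open>A\<close> and \<open>B\<close> keep a ball around \<open>x1\<close> away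
    from the singularity and from the edge of the support of the barrier.\<close>
  define A where "A = dd x1 / 2"
  define B where "B = (dd x1 + R) / 2"
  have AB: "A > 0" "B < R" "dd x1 < B" "A < dd x1" using a x1 by (auto simp: A_def B_def dd_def)
  have "open {x. m < w x \<and> A < dd x \<and> dd x < B}"
    by (intro open_Collect_conj open_Collect_less cw cdd continuous_intros)
  moreover have "x1 \<in> {x. m < w x \<and> A < dd x \<and> dd x < B}" using AB m by (simp add: m_def)
  ultimately obtain r1 where r1: "r1 > 0" "cball x1 r1 \<subseteq> {x. m < w x \<and> A < dd x \<and> dd x < B}"
    using open_contains_cball by blast
  obtain M where M: "M \<ge> 0" "\<And>x. norm (x - x0) \<le> 1 \<Longrightarrow> \<bar>w x - w x0\<bar> \<le> M * norm (x - x0)"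
    using has_pd_local_lipschitz[of w "\<lambda>b. pd w b" x0] u e unfolding w_def by metis
  define N where "N = real DIM('a)"
  have N: "N \<ge> 1" using DIM_positive[where 'a='a] by (simp add: N_def Suc_le_eq[symmetric])
  \<comment> \<open>q > N/2 gives the positive surplus, and q < (N + 1)/2 makes the bad contribution
    near \<open>x0\<close> tend to 0; this value is midway.\<close>
  define q where "q = N / 2 + 1 / 4"
  have q: "4 * q = 2 * N + 1" "q > 0" using N by (auto simp: q_def)
  define h where "h = 4 * N + 1"
  have h: "h > 0" using N by (simp add: h_def)
  \<comment> \<open>Lower bound for \<open>L\<close> on the ball around \<open>x1\<close>, uniform
    in \<sigma>: there dd + \<sigma> is at most R and R - (dd + \<sigma>) is at least (R -
    B)/2.\<close>
  define \<kappa> where "\<kappa> = R powr (- q) * ((R - B) / 2)\<^sup>2 / 4"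
  have \<kappa>: "\<kappa> > 0" using R AB by (simp add: \<kappa>_def)
  define v1 where "v1 = measure lborel (cball x1 r1)"
  have v1: "v1 > 0" using r1(1) by (simp add: v1_def)
  \<comment> \<open>Collects the Lipschitz bound for \<open>W\<close>, the bound for -L and the
    volume of the bad ball, with the power of \<sigma> split off.\<close>
  define K where "K = M * R\<^sup>2 * (2 * N + 1) * unit_ball_vol N * h powr ((N + 1) / 2)"
  have bound: "m * \<kappa> * v1 \<le> K * \<sigma> powr (1 / 4)"
    if \<sigma>: "\<sigma> > 0" "h * \<sigma> \<le> A" "\<sigma> \<le> (R - B) / 2" "h * \<sigma> \<le> 1" for \<sigma>
  proof -
    have sR: "\<sigma> < R" using \<sigma> AB a by simp
    \<comment> \<open>Outside the ball of this radius around \<open>x0\<close>, \<open>L\<close> is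
      nonnegative; \<open>h\<close> is the threshold from
      \<open>barrier_laplacian_bound\<close>.\<close>
    define r where "r = sqrt (h * \<sigma>)"
    have r: "r > 0" "r\<^sup>2 = h * \<sigma>" "r \<le> 1" using h \<sigma> by (auto simp: r_def)
    obtain g where g: "\<And>\<rho>. \<rho> \<ge> \<sigma> \<Longrightarrow> (g has_real_derivative - (\<rho> powr (- q) * (max 0 (R - \<rho>))\<^sup>2)) (at \<rho>)"
      "\<And>\<rho>. \<rho> \<ge> R \<Longrightarrow> g \<rho> = 0"
      "\<And>\<rho>. \<rho> \<ge> \<sigma> \<Longrightarrow> 0 \<le> g \<rho> \<and> g \<rho> \<le> \<rho> powr (- q) * (max 0 (R - \<rho>))\<^sup>2 * R"
      using barrier_exists[OF \<sigma>(1) sR q(2)] by blast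
    define G1 where "G1 \<rho> = - (\<rho> powr (- q) * (max 0 (R - \<rho>))\<^sup>2)" for \<rho>
    define G2 where "G2 \<rho> = q * \<rho> powr (- q - 1) * (max 0 (R - \<rho>))\<^sup>2 + 2 * \<rho> powr (- q) * max 0 (R - \<rho>)" for \<rho>
    have dG1: "(G1 has_real_derivative G2 \<rho>) (at \<rho>)" if "\<rho> \<ge> \<sigma>" for \<rho>
    proof -
      have 1: "((\<lambda>\<rho>. (max 0 (R - \<rho>))\<^sup>2) has_real_derivative (2 * max 0 (R - \<rho>)) * (-1)) (at \<rho>)"
        by (rule DERIV_chain2[where f="\<lambda>t. (max 0 t)\<^sup>2"])
          (use DERIV_pospart_power[of 0 "R - \<rho>"] in \<open>auto intro!: derivative_eq_intros simp: power2_eq_square\<close>)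
      have 2: "((\<lambda>\<rho>. \<rho> powr (- q)) has_real_derivative (- q) * \<rho> powr (- q - 1)) (at \<rho>)"
        using that \<sigma>(1) by (intro has_real_derivative_powr) auto
      show ?thesis
        unfolding G1_def[abs_def] G2_def using DERIV_minus[OF DERIV_mult[OF 2 1]] by (simp add: algebra_simps)
    qed
    have dg: "(g has_real_derivative G1 \<rho>) (at \<rho>)" if "\<rho> \<ge> \<sigma>" for \<rho>
      unfolding G1_def using g(1)[OF that] .
    have cG: "continuous_on {\<sigma>..} g" "continuous_on {\<sigma>..} G1" "continuous_on {\<sigma>..} G2"
    proof -
      show "continuous_on {\<sigma>..} g" "continuous_on {\<sigma>..} G1"
        using dg dG1 by (auto intro!: continuous_at_imp_continuous_on DERIV_isCont)
      show "continuous_on {\<sigma>..} G2"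
        unfolding G2_def using \<sigma>(1) by (intro continuous_intros) auto
    qed
    define \<zeta> where "\<zeta> x = g ((x - x0) \<bullet> (x - x0) + \<sigma>)" for x
    define \<zeta>' where "\<zeta>' b x = G1 ((x - x0) \<bullet> (x - x0) + \<sigma>) * (2 * ((x - x0) \<bullet> b))" for b x
    define \<zeta>'' where "\<zeta>'' b x = G2 ((x - x0) \<bullet> (x - x0) + \<sigma>) * (4 * ((x - x0) \<bullet> b)\<^sup>2) + 2 * G1 ((x - x0) \<bullet> (x - x0) + \<sigma>)" for b x
    have cc\<zeta>: "cc \<zeta>"
    proof (rule ccI[where R="norm x0 + sqrt R"])
      show "continuous_on UNIV \<zeta>" unfolding \<zeta>_def[abs_def] by (rule continuous_on_radial[OF cG(1)])
      fix x :: 'a assume "norm x0 + sqrt R < norm x"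
      then have "sqrt R < norm (x - x0)" using norm_triangle_ineq2[of x x0] by linarith
      then have "(sqrt R)\<^sup>2 < (norm (x - x0))\<^sup>2" using R by (intro power_strict_mono) auto
      then have "R \<le> (x - x0) \<bullet> (x - x0) + \<sigma>" using R \<sigma>(1) by (simp add: dot_square_norm)
      then show "\<zeta> x = 0" unfolding \<zeta>_def by (rule g(2))
    qed
    have d\<zeta>: "has_pd \<zeta> b (\<zeta>' b)" "continuous_on UNIV (\<zeta>' b)" for b
      unfolding \<zeta>_def[abs_def] \<zeta>'_def[abs_def]
      by (intro has_pd_radial dg, assumption, intro continuous_intros continuous_on_radial cG)
    have d\<zeta>': "has_pd (\<zeta>' b) b (\<zeta>'' b)" "continuous_on UNIV (\<zeta>'' b)" if "b \<in> Basis" for b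
      unfolding \<zeta>'_def[abs_def] \<zeta>''_def[abs_def]
      by (intro has_pd_radial2 dG1 that, assumption, intro continuous_intros continuous_on_radial cG)
    define L where "L x = (\<Sum>b\<in>Basis. \<zeta>'' b x) + deriv f (u x) * \<zeta> x" for x
    have J: "(\<integral>x. W x * L x \<partial>lborel) \<le> 0"
      unfolding W_def w_def L_def by (rule positive_part_supersolution[OF e cc\<zeta> d\<zeta> d\<zeta>'])
    have Leq: "L x = 4 * dd x * G2 (dd x + \<sigma>) + 2 * N * G1 (dd x + \<sigma>) + deriv f (u x) * g (dd x + \<sigma>)" for x
      unfolding L_def \<zeta>''_def radial_laplacian \<zeta>_def dd_def N_def ..
    have rho: "dd x + \<sigma> \<ge> \<sigma>" "dd x + \<sigma> > 0" for x using dd0[of x] \<sigma>(1) by auto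
    have Lb: "L x \<ge> - ((dd x + \<sigma>) powr (- q) * (max 0 (R - (dd x + \<sigma>)))\<^sup>2) * (2 * N + 1)"
      "dd x \<ge> h * \<sigma> \<Longrightarrow> L x \<ge> (dd x + \<sigma>) powr (- q) * (max 0 (R - (dd x + \<sigma>)))\<^sup>2 / 4" for x
    proof -
      have "(dd x + \<sigma>) powr (- q - 1) = (dd x + \<sigma>) powr (- q) / (dd x + \<sigma>)"
        using rho(2)[of x] by (simp add: powr_diff)
      then have G2: "G2 (dd x + \<sigma>) \<ge> q * ((dd x + \<sigma>) powr (- q) / (dd x + \<sigma>)) * (max 0 (R - (dd x + \<sigma>)))\<^sup>2"
        by (simp add: G2_def)
      note b = barrier_laplacian_bound[OF N c(1,3) dd0 \<sigma>(1) _ _ q(1) G2 _ _ c(2)[of x],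
          of "g (dd x + \<sigma>)", folded h_def]
      show "L x \<ge> - ((dd x + \<sigma>) powr (- q) * (max 0 (R - (dd x + \<sigma>)))\<^sup>2) * (2 * N + 1)"
        unfolding Leq G1_def by (rule b(1)) (use g(3)[OF rho(1), of x] in auto)
      show "L x \<ge> (dd x + \<sigma>) powr (- q) * (max 0 (R - (dd x + \<sigma>)))\<^sup>2 / 4" if "dd x \<ge> h * \<sigma>"
        unfolding Leq G1_def by (rule b(2)[OF _ _ _ _ that]) (use g(3)[OF rho(1), of x] in auto)
    qed
    define E where "E = M * r * (\<sigma> powr (- q) * R\<^sup>2 * (2 * N + 1))"
    have E0: "E \<ge> 0" unfolding E_def using M(1) r(1) N by (intro mult_nonneg_nonneg) auto
    have W0: "W x \<ge> 0" for x by (simp add: W_def)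
    have point: "m * \<kappa> * indicator (cball x1 r1) x - E * indicator (cball x0 r) x \<le> W x * L x" for x
    proof (cases "x \<in> cball x1 r1")
      case True
      then have x: "m < w x" "A < dd x" "dd x < B" using r1(2) by auto
      then have hs: "dd x \<ge> h * \<sigma>" using \<sigma>(2) by linarith
      have "\<kappa> \<le> (dd x + \<sigma>) powr (- q) * (max 0 (R - (dd x + \<sigma>)))\<^sup>2 / 4"
        unfolding \<kappa>_def
      proof (intro divide_right_mono mult_mono)
        show "R powr (- q) \<le> (dd x + \<sigma>) powr (- q)"
          using x \<sigma> AB q rho(2)[of x] by (intro powr_mono2') auto
        show "((R - B) / 2)\<^sup>2 \<le> (max 0 (R - (dd x + \<sigma>)))\<^sup>2"
          using x \<sigma> AB by (intro power_mono) (auto simp: le_max_iff_disj field_simps)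
      qed auto
      then have "\<kappa> \<le> L x" using Lb(2)[OF hs] by linarith
      moreover have "m \<le> W x" using x by (simp add: W_def)
      ultimately have "m * \<kappa> \<le> W x * L x" using m \<kappa> by (intro mult_mono) auto
      moreover have "0 \<le> E * indicator (cball x0 r) x" using E0 by simp
      ultimately show ?thesis using True by simp
    next
      case False
      show ?thesis
      proof (cases "dd x \<ge> h * \<sigma>")
        case True
        have "0 \<le> (dd x + \<sigma>) powr (- q) * (max 0 (R - (dd x + \<sigma>)))\<^sup>2 / 4" by simp
        then have "0 \<le> L x" using Lb(2)[OF True] by linarith
        then have "0 \<le> W x * L x" using W0 by simp
        moreover have "0 \<le> E * indicator (cball x0 r) x" using E0 by simp
        ultimately show ?thesis using False by simp
      next
        case small: False
        then have "(norm (x - x0))\<^sup>2 \<le> r\<^sup>2" unfolding r(2) by (simp add: dd_def dot_square_norm)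
        then have nr: "norm (x - x0) \<le> r" using r(1) power2_le_imp_le by auto
        then have "\<bar>w x - w x0\<bar> \<le> M * norm (x - x0)" using M(2)[of x] r(3) by linarith
        also have "\<dots> \<le> M * r" using nr M(1) by (rule mult_left_mono)
        \<comment> \<open>Here \<open>w x0 \<le> 0\<close> enters: the positive part grows at most
          linearly away from \<open>x0\<close>.\<close>
        finally have "W x \<le> M * r" using x0 M(1) r(1) by (auto simp: W_def w_def)
        moreover have "(dd x + \<sigma>) powr (- q) * (max 0 (R - (dd x + \<sigma>)))\<^sup>2 * (2 * N + 1) \<le> \<sigma> powr (- q) * R\<^sup>2 * (2 * N + 1)"
        proof (intro mult_right_mono mult_mono)
          show "(dd x + \<sigma>) powr (- q) \<le> \<sigma> powr (- q)"
            using rho[of x] \<sigma>(1) q by (intro powr_mono2') auto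
          show "(max 0 (R - (dd x + \<sigma>)))\<^sup>2 \<le> R\<^sup>2" using rho(2)[of x] R by (intro power_mono) auto
        qed (use N in auto)
        then have "- L x \<le> \<sigma> powr (- q) * R\<^sup>2 * (2 * N + 1)" using Lb(1)[of x] unfolding mult_minus_left by linarith
        moreover have "0 \<le> \<sigma> powr (- q) * R\<^sup>2 * (2 * N + 1)" using N by simp
        ultimately have "W x * (- L x) \<le> E" unfolding E_def
          using W0[of x] by (smt (verit) mult_left_mono mult_right_mono)
        then show ?thesis using False nr by (simp add: dist_norm norm_minus_commute)
      qed
    qed
    have ccL: "cc L"
    proof -
      have "cc (\<zeta>'' b)" if "b \<in> Basis" for b
        using has_pd_cc[OF d\<zeta>'(1)[OF that] has_pd_cc[OF d\<zeta>(1) cc\<zeta> d\<zeta>(2)] d\<zeta>'(2)[OF that]] .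
      then show ?thesis unfolding L_def[abs_def] by (intro cc_add cc_sum cc_mult(1) V_cont cc\<zeta>) auto
    qed
    have indint: "integrable lborel (\<lambda>x. C * indicator (cball y s) x)" for C s :: real and y :: 'a
      by (intro integrable_mult_right integrable_real_indicator emeasure_bounded_finite) auto
    have "(\<integral>x. m * \<kappa> * indicator (cball x1 r1) x - E * indicator (cball x0 r) x \<partial>lborel) \<le> (\<integral>x. W x * L x \<partial>lborel)"
    proof (rule Bochner_Integration.integral_mono)
      show "integrable lborel (\<lambda>x. m * \<kappa> * indicator (cball x1 r1) x - E * indicator (cball x0 r) x)"
        by (intro Bochner_Integration.integrable_diff indint)
      show "integrable lborel (\<lambda>x. W x * L x)"
        unfolding W_def by (intro cc_integrable cc_mult(1) continuous_intros cw ccL)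
    qed (rule point)
    also have "(\<integral>x. m * \<kappa> * indicator (cball x1 r1) x - E * indicator (cball x0 r) x \<partial>lborel) = m * \<kappa> * v1 - E * measure lborel (cball x0 r)"
      by (subst Bochner_Integration.integral_diff[OF indint indint]) (simp add: v1_def)
    finally have "m * \<kappa> * v1 \<le> E * measure lborel (cball x0 r)" using J by linarith
    also have "measure lborel (cball x0 r) = unit_ball_vol N * r ^ DIM('a)"
      using content_cball[of r x0] r(1) by (simp add: N_def)
    also have "E * (unit_ball_vol N * r ^ DIM('a)) = M * R\<^sup>2 * (2 * N + 1) * unit_ball_vol N * (\<sigma> powr (- q) * (r * r ^ DIM('a)))"
      by (simp add: E_def algebra_simps)
    \<comment> \<open>One factor \<open>r\<close> comes from the linear vanishing, the others from
      the volume; since r^2 is proportional to \<sigma>, the exponent is (N + 1)/2 - q = 1/4 >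
      0.\<close>
    also have "\<sigma> powr (- q) * (r * r ^ DIM('a)) = h powr ((N + 1) / 2) * \<sigma> powr (1 / 4)"
    proof -
      have "r * r ^ DIM('a) = r powr (N + 1)"
        using r(1) powr_realpow[OF r(1), of "Suc DIM('a)"] by (simp add: N_def add.commute)
      also have "\<dots> = (h * \<sigma>) powr ((N + 1) / 2)"
        using h \<sigma>(1) by (simp add: r_def powr_half_sqrt[symmetric] powr_powr)
      also have "\<dots> = h powr ((N + 1) / 2) * \<sigma> powr ((N + 1) / 2)"
        using h \<sigma>(1) by (simp add: powr_mult)
      finally have "\<sigma> powr (- q) * (r * r ^ DIM('a)) = h powr ((N + 1) / 2) * (\<sigma> powr (- q) * \<sigma> powr ((N + 1) / 2))" by simp
      also have "\<sigma> powr (- q) * \<sigma> powr ((N + 1) / 2) = \<sigma> powr (1 / 4)"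
      proof -
        have expo: "- q + (N + 1) / 2 = 1 / 4" by (simp add: q_def field_simps)
        show ?thesis using powr_add[of \<sigma> "- q" "(N + 1) / 2", unfolded expo] by simp
      qed
      finally show ?thesis .
    qed
    finally show ?thesis by (simp add: K_def mult.assoc)
  qed
  have "((\<lambda>\<sigma>. K * \<sigma> powr (1 / 4)) \<longlongrightarrow> K * 0) (at_right 0)"
  proof (intro tendsto_mult tendsto_const)
    have "((\<lambda>\<sigma>::real. \<sigma> powr (1 / 4)) \<longlongrightarrow> 0 powr (1 / 4)) (at_right 0)"
      by (intro tendsto_powr' tendsto_intros) (auto simp: eventually_at_right_field intro: exI[of _ 1])
    then show "((\<lambda>\<sigma>::real. \<sigma> powr (1 / 4)) \<longlongrightarrow> 0) (at_right 0)" by simp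
  qed
  moreover have "\<forall>\<^sub>F \<sigma> in at_right 0. m * \<kappa> * v1 \<le> K * \<sigma> powr (1 / 4)"
  proof -
    define s0 where "s0 = min (A / h) (min ((R - B) / 2) (1 / h))"
    have "s0 > 0" using AB h by (simp add: s0_def)
    moreover have "m * \<kappa> * v1 \<le> K * \<sigma> powr (1 / 4)" if "0 < \<sigma>" "\<sigma> < s0" for \<sigma>
      using that h by (intro bound) (auto simp: s0_def field_simps)
    ultimately show ?thesis by (auto simp: eventually_at_right_field)
  qed
  ultimately have "m * \<kappa> * v1 \<le> K * 0" by (rule tendsto_lowerbound) simp
  moreover have "m * \<kappa> * v1 > 0" using m \<kappa> v1 by simp
  ultimately show False by simp
qed

section \<open>Monotonicity along lines and the conclusion\<close>

lemma u_eq_0_if_monotone: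
  assumes e: "e \<in> Basis" and sign: "(\<forall>x. s * pd u e x \<ge> 0)" and s: "s \<noteq> 0"
  shows "u x = 0"
proof -
  define F where "F t = s * u (x + t *\<^sub>R e)" for t
  have dF: "(F has_real_derivative s * pd u e (x + t *\<^sub>R e)) (at t)" for t
    unfolding F_def by (intro DERIV_cmult has_pd_line u e)
  have mono: "F a \<le> F b" if "a \<le> b" for a b
    using DERIV_nonneg_imp_nondecreasing[OF that, of F] dF sign by blast
  have line: "((\<lambda>t. F t) \<longlongrightarrow> 0) G" if "filterlim (\<lambda>t. x + t *\<^sub>R e) at_infinity G" for G
    using tendsto_mult_left[OF filterlim_compose[OF decay that], of s] by (simp add: F_def)
  have inf: "filterlim (\<lambda>t. x + t *\<^sub>R e) at_infinity G" if "filterlim (\<lambda>t::real. t) at_infinity G" for G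
  proof -
    have "filterlim (\<lambda>t. norm (t *\<^sub>R e)) at_top G"
      using filterlim_at_infinity_imp_norm_at_top[OF that] e by simp
    then have "filterlim (\<lambda>t. t *\<^sub>R e) at_infinity G" by (rule filterlim_norm_at_top_imp_at_infinity)
    from tendsto_add_filterlim_at_infinity[OF tendsto_const this, of x] show ?thesis .
  qed
  have "(F \<longlongrightarrow> 0) at_top" "(F \<longlongrightarrow> 0) at_bot"
    using line inf filterlim_mono[OF filterlim_ident at_top_le_at_infinity order_refl]
      filterlim_mono[OF filterlim_ident at_bot_le_at_infinity order_refl] by blast+
  then have "F 0 \<le> 0" "0 \<le> F 0"
    using mono
    by (intro tendsto_lowerbound[where F=at_top and f=F] tendsto_upperbound[where F=at_bot and f=F];
        auto intro: eventually_mono[OF eventually_ge_at_top[of 0]] eventually_mono[OF eventually_le_at_bot[of 0]])+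
  then show ?thesis using s by (simp add: F_def)
qed

text \<open>Continuity makes the set where \<open>pd u e\<close> is nonpositive closed and
  \<open>pd_nonpos_ball\<close> makes it open, so connectedness leaves two cases, each with a
  constant sign of \<open>pd u e\<close>.\<close>

lemma u_eq_0: "u x = 0"
proof -
  obtain e :: 'a where e: "e \<in> Basis" using nonempty_Basis by blast
  obtain c where c: "c > 0" "\<And>x. \<bar>deriv f (u x)\<bar> \<le> c" using V_bounded by blast
  \<comment> \<open>The largest \<open>R\<close> with \<open>c * R \<le> 1 / 4\<close>, the
    smallness under which the barrier absorbs the potential.\<close>
  define R where "R = 1 / (4 * c)"
  have R: "R > 0" "c * R \<le> 1 / 4" using c(1) by (auto simp: R_def)
  define Z where "Z = {x. pd u e x \<le> 0}"
  have "closed Z" unfolding Z_def by (intro closed_Collect_le u e continuous_intros)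
  moreover have "open Z"
    unfolding open_contains_ball
  proof
    fix x0 assume "x0 \<in> Z"
    have "ball x0 (sqrt R) \<subseteq> Z"
    proof
      fix x assume "x \<in> ball x0 (sqrt R)"
      then have "norm (x - x0) < sqrt R" by (simp add: dist_norm norm_minus_commute)
      then have "(norm (x - x0))\<^sup>2 < (sqrt R)\<^sup>2" by (intro power_strict_mono) auto
      then have "(x - x0) \<bullet> (x - x0) < R" using R by (simp add: dot_square_norm)
      then show "x \<in> Z" using pd_nonpos_ball[OF e c R(2,1), of x0 x] \<open>x0 \<in> Z\<close> by (simp add: Z_def)
    qed
    then show "\<exists>\<epsilon>>0. ball x0 \<epsilon> \<subseteq> Z" using R by (intro exI[of _ "sqrt R"]) auto
  qed
  ultimately consider "Z = {}" | "Z = UNIV" using clopen by blast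
  then show ?thesis
  proof cases
    case 1
    then have "\<forall>x. 1 * pd u e x \<ge> 0" by (auto simp: Z_def not_le less_imp_le)
    then show ?thesis using u_eq_0_if_monotone[OF e, of 1] by simp
  next
    case 2
    then have "\<forall>x. (-1) * pd u e x \<ge> 0" by (auto simp: Z_def)
    then show ?thesis using u_eq_0_if_monotone[OF e, of "-1"] by simp
  qed
qed

end

theorem theorem1p1:
  fixes f :: "real \<Rightarrow> real" and u :: "'a::euclidean_space \<Rightarrow> real" and \<delta> :: real
  assumes f_C1: "\<forall>s. f differentiable (at s)" "continuous_on UNIV (deriv f)"
    and f0: "f 0 = 0"
    and \<delta>pos: "\<delta> > 0"
    and f_dec: "\<forall>s. \<bar>s\<bar> < \<delta> \<longrightarrow> deriv f s \<le> 0"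
    and u_C2: "Ck 2 u"
    and eq: "\<forall>x. laplacian u x + f (u x) = 0"
    and decay: "(u \<longlongrightarrow> 0) at_infinity"
    and stab: "stable f u"
  shows "\<forall>x. u x = 0"
proof -
  interpret stable_solution f u \<delta>
    using assms by unfold_locales auto
  show ?thesis using u_eq_0 by blast
qed

end
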